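(* Let $N=10$ and let $a:[0,1]\to\mathbb{R}$ be such that $x\mapsto a(|x|)$ belongs to $C^2(\overline{B_1})$, $a(r)>0$ on $[0,1]$, and $a(0)=1$. Let $H$ be the first (Dirichlet) eigenvalue of $-\Delta$ in the unit ball of $\mathbb{R}^2$ and, for $h>-2(N-2)$, let $$a_h(r):=\Bigl(1+\frac{h}{2(N-2)}r^2\Bigr)e^{\frac{h}{2N}r^2}.$$ Then the bifurcation diagram of radial solutions of $$-\Delta u=\lambda a(|x|)e^{u}\ \text{ in } B_1,\qquad u>0\ \text{ in } B_1,\qquad u=0\ \text{ on }\partial B_1 \tag{P}$$ is of: (i) Type II if $(a/a_H)'\le0$ in $(0,1]$; (ii) Type III if $(a/a_H)'>0$ in $(0,1]$. In particular, when $N=10$ and $a=a_h$ (with $h>-2(N-2)$), the bifurcation diagram is of Type II if $h\le H$ and of Type III if $h>H$.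
   Context: $B_1\subset\mathbb{R}^N$ is the open unit ball, and $\lambda>0$ is a parameter. Radial functions are identified with functions of $r=|x|$, and then $\Delta=\frac{d^2}{dr^2}+\frac{N-1}{r}\frac{d}{dr}$. The prime in $(a/a_H)'$ is the derivative in $r$. For $\beta\in\mathbb{R}$, $v(\cdot,\beta)$ denotes the solution on $[0,1]$ of $-\Delta v=a(r)e^{v}$, $v(0,\beta)=\beta$, $\frac{d}{dr}v(0,\beta)=0$. Put $\lambda(\beta):=e^{v(1,\beta)}$, $u_\beta(r):=v(r,\beta)-\log\lambda(\beta)$, $\alpha(\beta):=\beta-\log\lambda(\beta)=\lVert u_\beta\rVert_{L^\infty(B_1)}$. The pairs $(\lambda(\beta),u_\beta)$, $\beta\in\mathbb{R}$, are exactly the classical radial solutions of (P), and $\mathcal{C}:=\{(\lambda(\beta),\alpha(\beta));\beta\in\mathbb{R}\}$ is called the bifurcation curve. A point $(\lambda(\beta),\alpha(\beta))$ is a turning point if the function $\lambda(\cdot)$ has a local minimum or a local maximum at $\beta$. Type II: the curve $\mathcal{C}$ can be parametrized by $\lambda$, with $\alpha$ increasing in $\lambda$ and blowing up at some value; i.e. there are $\lambda_*\in(0,\infty)$ and an increasing function $\lambda\mapsto\alpha(\lambda)$ on $(0,\lambda_* )$ with $\mathcal{C}=\{(\lambda,\alpha(\lambda)):0<\lambda<\lambda_*\}$ and $\alpha(\lambda)\to\infty$ as $\lambda\uparrow\lambda_*$. Type III: the curve $\mathcal{C}$ has at least one but only finitely many turning points. *)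

theory Defs
  imports "HOL-Analysis.Analysis"
begin

definition has_derivs2 ::
  "('a::euclidean_space \<Rightarrow> real) \<Rightarrow> ('a \<Rightarrow> 'a \<Rightarrow>\<^sub>L real) \<Rightarrow> ('a \<Rightarrow> 'a \<Rightarrow>\<^sub>L 'a \<Rightarrow>\<^sub>L real) \<Rightarrow> 'a set \<Rightarrow> bool"
  where "has_derivs2 f D D2 \<Omega> \<longleftrightarrow>
    (\<forall>x\<in>\<Omega>. (f has_derivative blinfun_apply (D x)) (at x) \<and>
           (D has_derivative blinfun_apply (D2 x)) (at x))"

definition C2_on :: "('a::euclidean_space \<Rightarrow> real) \<Rightarrow> 'a set \<Rightarrow> bool"
  where "C2_on f \<Omega> \<longleftrightarrow> (\<exists>D D2. has_derivs2 f D D2 \<Omega> \<and> continuous_on \<Omega> D2)"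

text \<open>The space \<open>C\<^sup>2\<close> of the closure of an open set \<open>\<Omega>\<close>: derivatives are taken in \<open>\<Omega>\<close> only, and
  those of order at most 2 extend continuously to the closure (the values of \<open>D\<close> and \<open>D2\<close> on
  the boundary are the extensions).\<close>

definition C2_on_closure :: "('a::euclidean_space \<Rightarrow> real) \<Rightarrow> 'a set \<Rightarrow> bool"
  where "C2_on_closure f \<Omega> \<longleftrightarrow>
    (\<exists>D D2. has_derivs2 f D D2 \<Omega> \<and> continuous_on (closure \<Omega>) f \<and>
      continuous_on (closure \<Omega>) D \<and> continuous_on (closure \<Omega>) D2)"

definition partial_deriv :: "'a::euclidean_space \<Rightarrow> ('a \<Rightarrow> real) \<Rightarrow> 'a \<Rightarrow> real"
  where "partial_deriv b f x = frechet_derivative f (at x) b"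

definition laplacian :: "('a::euclidean_space \<Rightarrow> real) \<Rightarrow> 'a \<Rightarrow> real"
  where "laplacian f x = (\<Sum>b\<in>Basis. partial_deriv b (partial_deriv b f) x)"

definition dirichlet_eigenvalue :: "'a::euclidean_space set \<Rightarrow> real \<Rightarrow> bool"
  where "dirichlet_eigenvalue \<Omega> \<mu> \<longleftrightarrow>
    (\<exists>\<phi>. C2_on \<phi> \<Omega> \<and> continuous_on (closure \<Omega>) \<phi> \<and> (\<exists>x\<in>\<Omega>. \<phi> x \<noteq> 0) \<and>
      (\<forall>x\<in>\<Omega>. - laplacian \<phi> x = \<mu> * \<phi> x) \<and> (\<forall>x\<in>frontier \<Omega>. \<phi> x = 0))"

definition H_disc :: real
  where "H_disc = (LEAST \<mu>. dirichlet_eigenvalue (ball (0 :: real^2) 1) \<mu>)"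

definition a_fam :: "nat \<Rightarrow> real \<Rightarrow> real \<Rightarrow> real"
  where "a_fam N h r =
    (1 + h / (2 * (real N - 2)) * r\<^sup>2) * exp (h / (2 * real N) * r\<^sup>2)"

text \<open>The initial value problem \<open>-\<Delta>v = a(r) e\<^sup>v\<close>, \<open>v(0) = \<beta>\<close>, \<open>v'(0) = 0\<close> on \<open>[0,1]\<close>, where
  \<open>\<Delta> = d\<^sup>2/dr\<^sup>2 + (N-1)/r d/dr\<close> is the Laplacian of \<open>\<real>\<^sup>N\<close> on radial functions. The solution is of
  class \<open>C\<^sup>2\<close> on \<open>[0,1]\<close>, with one-sided derivatives at the endpoints; the equation is singular
  at 0 and is imposed on \<open>(0,1]\<close>.\<close>

definition solves_radial_ivp ::
  "nat \<Rightarrow> (real \<Rightarrow> real) \<Rightarrow> real \<Rightarrow> (real \<Rightarrow> real) \<Rightarrow> bool"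
  where "solves_radial_ivp N a \<beta> v \<longleftrightarrow>
    (\<exists>v1 v2.
      (\<forall>r\<in>{0..1}. (v has_real_derivative v1 r) (at r within {0..1}) \<and>
                  (v1 has_real_derivative v2 r) (at r within {0..1})) \<and>
      continuous_on {0..1} v2 \<and>
      (\<forall>r\<in>{0<..1}. - (v2 r + (real N - 1) / r * v1 r) = a r * exp (v r)) \<and>
      v 0 = \<beta> \<and> v1 0 = 0)"

text \<open>The solution is unique only as a function on \<open>[0,1]\<close>, whence the choice operator; only
  values in \<open>[0,1]\<close> are used below.\<close>

definition radial_sol :: "nat \<Rightarrow> (real \<Rightarrow> real) \<Rightarrow> real \<Rightarrow> real \<Rightarrow> real"
  where "radial_sol N a \<beta> = (SOME v. solves_radial_ivp N a \<beta> v)"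

definition bif_lambda :: "nat \<Rightarrow> (real \<Rightarrow> real) \<Rightarrow> real \<Rightarrow> real"
  where "bif_lambda N a \<beta> = exp (radial_sol N a \<beta> 1)"

text \<open>With \<open>u\<^sub>\<beta> = v(\<cdot>,\<beta>) - log \<lambda>(\<beta>)\<close>, the pairs \<open>(\<lambda>(\<beta>), u\<^sub>\<beta>)\<close> are exactly the classical radial
  solutions of \<open>-\<Delta>u = \<lambda> a(|x|) e\<^sup>u\<close>, \<open>u > 0\<close> in the unit ball, \<open>u = 0\<close> on its boundary, and
  \<open>bif_alpha N a \<beta> = u\<^sub>\<beta>(0)\<close> is the supremum norm of \<open>u\<^sub>\<beta>\<close>.\<close>

definition bif_alpha :: "nat \<Rightarrow> (real \<Rightarrow> real) \<Rightarrow> real \<Rightarrow> real"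
  where "bif_alpha N a \<beta> = \<beta> - ln (bif_lambda N a \<beta>)"

definition bifurcation_curve :: "nat \<Rightarrow> (real \<Rightarrow> real) \<Rightarrow> (real \<times> real) set"
  where "bifurcation_curve N a = {(bif_lambda N a \<beta>, bif_alpha N a \<beta>) | \<beta>. True}"

definition local_extremum :: "(real \<Rightarrow> real) \<Rightarrow> real \<Rightarrow> bool"
  where "local_extremum f x \<longleftrightarrow>
    (\<forall>\<^sub>F y in nhds x. f x \<le> f y) \<or> (\<forall>\<^sub>F y in nhds x. f y \<le> f x)"

definition turning_points :: "nat \<Rightarrow> (real \<Rightarrow> real) \<Rightarrow> (real \<times> real) set"
  where "turning_points N a =
    {(bif_lambda N a \<beta>, bif_alpha N a \<beta>) | \<beta>. local_extremum (bif_lambda N a) \<beta>}"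

definition type_II :: "nat \<Rightarrow> (real \<Rightarrow> real) \<Rightarrow> bool"
  where "type_II N a \<longleftrightarrow>
    (\<exists>L>0. \<exists>\<alpha>. strict_mono_on {0<..<L} \<alpha> \<and>
      bifurcation_curve N a = {(l, \<alpha> l) | l. 0 < l \<and> l < L} \<and>
      filterlim \<alpha> at_top (at_left L))"

definition type_III :: "nat \<Rightarrow> (real \<Rightarrow> real) \<Rightarrow> bool"
  where "type_III N a \<longleftrightarrow> turning_points N a \<noteq> {} \<and> finite (turning_points N a)"

text \<open>The derivative on \<open>[0,1]\<close>, one-sided at the endpoints.\<close>

definition deriv01 :: "(real \<Rightarrow> real) \<Rightarrow> real \<Rightarrow> real"
  where "deriv01 f r = vector_derivative f (at r within {0..1})"

end

theory Submission
  imports Defs "HOL-Complex_Analysis.Complex_Analysis" "HOL-Real_Asymp.Real_Asymp"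
begin

text \<open>In the variable \<open>t = log r\<close>, multiplication by \<open>r\<^sup>4\<close> turns the 10-dimensional radial Laplacian into
  \<open>d\<^sup>2/dt\<^sup>2\<close> minus the constant 16, so that 10 is exactly the dimension in which the Hardy term cancels the
  linearization at \<open>log (16/r\<^sup>2)\<close>. For the weight \<open>a\<^sub>H\<close> the singular solution is explicit and its linearization has
  the kernel \<open>r\<^sup>-\<^sup>4 J\<^sub>0(\<surd>H r)\<close>; everything is a comparison with this function.

  If \<open>a/a\<^sub>H\<close> is nonincreasing, a convexity and Wronskian argument shows that no regular solution crosses the
  threshold potential \<open>16/r\<^sup>2 + H\<close>; Sturm comparison then makes \<open>v(r, \<beta>)\<close> increasing in \<open>\<beta>\<close>, and the curve is
  a graph over \<open>\<lambda>\<close>.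

  If \<open>a/a\<^sub>H\<close> is increasing, the regular solutions converge to a singular one at a rate exponential in \<open>\<beta>\<close>. The
  Wronskian of the difference of two regular solutions with the solution \<open>G\<close> of the limiting linearized equation that
  vanishes at \<open>r = 1\<close> is dominated by the region \<open>r \<approx> exp (-\<beta>/2)\<close>, where it has a sign; hence \<open>\<lambda>\<close> is strictly
  monotone for large \<open>\<beta>\<close>. It is increasing for very negative \<open>\<beta>\<close> and real analytic, so it has finitely many
  extrema. Without any extremum, \<open>v(r, \<beta>)\<close> would be increasing in \<open>\<beta>\<close> for every \<open>r\<close>, so \<open>G\<close> would not vanish in
  the interior; convexity then puts the singular potential above \<open>16/r\<^sup>2 + H\<close>, contradicting Sturm comparison.\<close>

section \<open>Functions on the half line\<close>

text \<open>The double root -4 of the linearization at \<open>log (16/r^2)\<close> shapes the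
  estimates: complex roots would make differences of solutions oscillate, distinct real roots would
  separate two exponential rates, whereas here the scaled limiting solutions behave like
  \<open>c + d * t\<close> as t tends to -infinity. The Wronskian estimate therefore loses a factor
  linear in \<beta>, which the convergence rate \<open>exp (- 3 / 2 * \<beta>)\<close> pays for. In
  dimension 10 the function \<open>U = log (16/r^2) - H r^2 / 20\<close> satisfies
  \<open>- Delta U = 16/r^2 + H\<close>, and \<open>a_H\<close> is the weight for which the
  right-hand side is \<open>a_H e^U\<close>; hence the constants 16 and 20. Once the Hardy term is
  gone, \<open>d^2/dt^2\<close> is also r^2 times the radial Laplacian of the plane, which is why a
  disc in the plane decides. Convexity of the exponential enters in two forms:
  \<open>exp W - 1 - W \<ge> 0\<close> when regular solutions are held below the threshold, and
  \<open>1 - exp W + W * exp W \<ge> 0\<close> when the singular one is pushed above it.\<close>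

definition hderiv :: "(real \<Rightarrow> real) \<Rightarrow> (real \<Rightarrow> real) \<Rightarrow> bool"
  where "hderiv f f' \<longleftrightarrow> (\<forall>t\<le>0. (f has_real_derivative f' t) (at t within {..0}))"

lemma hderivD: "hderiv f f' \<Longrightarrow> t \<le> 0 \<Longrightarrow> (f has_real_derivative f' t) (at t within {..0})"
  by (simp add: hderiv_def)

lemma hderivI: "(\<And>t. t \<le> 0 \<Longrightarrow> (f has_real_derivative f' t) (at t within {..0})) \<Longrightarrow> hderiv f f'"
  by (simp add: hderiv_def)

lemma hderiv_at: "hderiv f f' \<Longrightarrow> t < 0 \<Longrightarrow> (f has_real_derivative f' t) (at t)"
  using at_within_open_subset[of t "{..<0}" "{..0}"] unfolding hderiv_def
  by (metis lessThan_iff less_imp_le open_lessThan subsetI atMost_iff)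

lemma hderiv_cont: "hderiv f f' \<Longrightarrow> S \<subseteq> {..0} \<Longrightarrow> continuous_on S f"
  by (rule continuous_on_subset[of "{..0}"])
     (auto simp: hderiv_def intro!: DERIV_continuous_on)

lemma hderiv_mvt:
  assumes "hderiv f f'" "s < t" "t \<le> 0"
  obtains x where "s < x" "x < t" "f t - f s = (t - s) * f' x"
proof -
  have "\<exists>l z. s < z \<and> z < t \<and> DERIV f z :> l \<and> f t - f s = (t - s) * l"
  proof (intro MVT hderiv_cont[OF assms(1)])
    fix x assume "s < x" "x < t"
    then show "f differentiable at x"
      using hderiv_at[OF assms(1), of x] assms(3) real_differentiable_def by auto
  qed (use assms in auto)
  then obtain l z where z: "s < z" "z < t" "DERIV f z :> l" "f t - f s = (t - s) * l" by blast
  moreover have "l = f' z"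
    using z hderiv_at[OF assms(1), of z] assms(3) DERIV_unique by force
  ultimately show ?thesis using that by blast
qed

lemma hderiv_mono:
  assumes "hderiv f f'" "s \<le> t" "t \<le> 0" "\<And>x. s < x \<Longrightarrow> x < t \<Longrightarrow> f' x \<ge> 0"
  shows "f s \<le> f t"
proof (cases "s = t")
  case False
  then obtain x where "s < x" "x < t" "f t - f s = (t - s) * f' x"
    using assms by (meson hderiv_mvt order_le_less)
  then show ?thesis using assms(2) assms(4)[of x]
    by (smt (verit) mult_nonneg_nonneg)
qed simp

lemma hderiv_strict_mono:
  assumes "hderiv f f'" "s < t" "t \<le> 0" "\<And>x. s < x \<Longrightarrow> x < t \<Longrightarrow> f' x > 0"
  shows "f s < f t"
proof -
  obtain x where "s < x" "x < t" "f t - f s = (t - s) * f' x"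
    using assms by (meson hderiv_mvt)
  then show ?thesis using assms(2) assms(4)[of x]
    by (smt (verit) mult_pos_pos)
qed

lemma hderiv_mono_from_bot:
  assumes "hderiv f f'" "T \<le> 0" "\<And>x. x < T \<Longrightarrow> f' x \<ge> 0" "(f \<longlongrightarrow> l) at_bot" "t \<le> T"
  shows "l \<le> f t"
proof (rule tendsto_upperbound[OF assms(4)])
  show "\<forall>\<^sub>F s in at_bot. f s \<le> f t"
    using eventually_le_at_bot[of t]
    by eventually_elim (use assms in \<open>auto intro!: hderiv_mono[OF assms(1)]\<close>)
qed simp

lemma hderiv_strict_mono_from_bot:
  assumes "hderiv f f'" "T \<le> 0" "\<And>x. x < T \<Longrightarrow> f' x > 0" "(f \<longlongrightarrow> l) at_bot" "t \<le> T"
  shows "l < f t"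
proof -
  have "l \<le> f (t - 1)"
    using assms by (intro hderiv_mono_from_bot[OF assms(1,2) _ assms(4)]) (auto intro: less_imp_le)
  also have "\<dots> < f t"
    using assms by (intro hderiv_strict_mono[OF assms(1)]) auto
  finally show ?thesis .
qed

lemma hderiv_add [intro]: "hderiv f f' \<Longrightarrow> hderiv g g' \<Longrightarrow> hderiv (\<lambda>t. f t + g t) (\<lambda>t. f' t + g' t)"
  and hderiv_diff [intro]: "hderiv f f' \<Longrightarrow> hderiv g g' \<Longrightarrow> hderiv (\<lambda>t. f t - g t) (\<lambda>t. f' t - g' t)"
  and hderiv_mult [intro]: "hderiv f f' \<Longrightarrow> hderiv g g' \<Longrightarrow> hderiv (\<lambda>t. f t * g t) (\<lambda>t. f' t * g t + g' t * f t)"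
  by (auto simp: hderiv_def intro!: derivative_eq_intros)

lemma hderiv_exp: "hderiv (\<lambda>t. exp (c * t)) (\<lambda>t. c * exp (c * t))"
  by (auto simp: hderiv_def intro!: derivative_eq_intros)

lemma hderiv_const: "hderiv (\<lambda>t. c) (\<lambda>t. 0)"
  by (auto simp: hderiv_def intro!: derivative_eq_intros)

lemma hderiv_ident: "hderiv (\<lambda>t. t) (\<lambda>t. 1)"
  by (auto simp: hderiv_def intro!: derivative_eq_intros)

lemma hderiv_cmult: "hderiv f f' \<Longrightarrow> hderiv (\<lambda>t. c * f t) (\<lambda>t. c * f' t)"
  by (auto simp: hderiv_def intro!: derivative_eq_intros)

lemma hderiv_minus: "hderiv f f' \<Longrightarrow> hderiv (\<lambda>t. - f t) (\<lambda>t. - f' t)"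
  by (auto simp: hderiv_def intro!: derivative_eq_intros)

lemma hderiv_cong: "hderiv f f' \<Longrightarrow> (\<And>t. t \<le> 0 \<Longrightarrow> f' t = g' t) \<Longrightarrow> hderiv f g'"
  by (auto simp: hderiv_def)

section \<open>First zeros, Sturm comparison and energy growth\<close>

lemma first_zero:
  fixes D :: "real \<Rightarrow> real"
  assumes "continuous_on {..0} D" "\<forall>\<^sub>F t in at_bot. D t > 0" "s \<le> 0" "D s \<le> 0"
  obtains z where "z \<le> s" "D z = 0" "\<And>t. t < z \<Longrightarrow> D t > 0"
proof -
  obtain N where N: "\<And>t. t \<le> N \<Longrightarrow> D t > 0"
    using assms(2) by (auto simp: eventually_at_bot_linorder)
  have "N < s" using N[of s] assms(4) by linarith
  \<comment> \<open>With \<open>\<le>\<close> instead of \<open>=\<close> the set is closed and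
    contains s at once; the intermediate value theorem afterwards upgrades
    \<open>D z \<le> 0\<close> to equality.\<close>
  define Z where "Z = {t\<in>{N..s}. D t \<le> 0}"
  have c: "continuous_on {N..s} D"
    using assms(1) by (rule continuous_on_subset) (use assms(3) in auto)
  have "closed Z"
    unfolding Z_def by (intro continuous_on_closed_Collect_le continuous_on_const c) auto
  moreover have "s \<in> Z" using \<open>N < s\<close> assms(4) by (auto simp: Z_def)
  moreover have bb: "bdd_below Z" by (auto simp: Z_def bdd_below_def)
  ultimately have zZ: "Inf Z \<in> Z" by (intro closed_contains_Inf) auto
  define z where "z = Inf Z"
  have before: "D t > 0" if "t < z" for t
  proof (cases "t \<le> N")
    case False
    have "t \<notin> Z" using that cInf_lower[OF _ bb, of t] by (auto simp: z_def)
    then show ?thesis using False that zZ by (auto simp: Z_def z_def)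
  qed (use N in auto)
  have "D z \<le> 0" "N \<le> z" "z \<le> s" using zZ by (auto simp: Z_def z_def)
  have "N < z" using N[of N] \<open>D z \<le> 0\<close> \<open>N \<le> z\<close> by (cases "N = z") auto
  have "D z = 0"
  proof (rule ccontr)
    assume "D z \<noteq> 0"
    then have "D z < 0" using \<open>D z \<le> 0\<close> by simp
    moreover have "continuous_on {N..z} D"
      using c by (rule continuous_on_subset) (use \<open>z \<le> s\<close> in auto)
    ultimately obtain x where "N \<le> x" "x \<le> z" "D x = 0"
      using IVT2'[of D z 0 N] N[of N] \<open>N \<le> z\<close> by auto
    then show False using before[of x] \<open>D z < 0\<close> by (cases "x = z") auto
  qed
  then show ?thesis using that before \<open>z \<le> s\<close> by blast
qed

text \<open>Up to the first zero of \<open>D\<close> the Wronskian increases from 0, so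
  \<open>D / \<psi>\<close> is nondecreasing and cannot reach 0. Before that zero only points with
  \<open>D > 0\<close> occur, whence the form of \<open>le\<close>. There is no initial point on the
  half line; the limit of the Wronskian at \<open>at_bot\<close> takes the place of initial
  data.\<close>

lemma sturm_positivity:
  assumes D: "hderiv D D1" "hderiv D1 D2" and psi: "hderiv \<psi> \<psi>1" "hderiv \<psi>1 \<psi>2"
    and T: "T \<le> 0" and pos: "\<forall>\<^sub>F t in at_bot. D t > 0"
    and psi_pos: "\<And>t. t < T \<Longrightarrow> \<psi> t > 0"
    and lim: "((\<lambda>t. \<psi> t * D1 t - D t * \<psi>1 t) \<longlongrightarrow> 0) at_bot"
    and le: "\<And>t. t < T \<Longrightarrow> D t > 0 \<Longrightarrow> \<psi> t * D2 t \<ge> D t * \<psi>2 t"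
  shows "\<And>t. t < T \<Longrightarrow> D t > 0" "\<And>t. t \<le> T \<Longrightarrow> \<psi> t * D1 t - D t * \<psi>1 t \<ge> 0"
proof -
  define w where "w = (\<lambda>t. \<psi> t * D1 t - D t * \<psi>1 t)"
  have w: "hderiv w (\<lambda>t. \<psi> t * D2 t - D t * \<psi>2 t)"
    unfolding w_def
    by (rule hderiv_cong[OF hderiv_diff[OF hderiv_mult[OF psi(1) D(2)] hderiv_mult[OF D(1) psi(2)]]])
       (auto simp: algebra_simps)
  have Dpos: "D t > 0" if t: "t < T" for t
  proof (rule ccontr)
    assume "\<not> D t > 0"
    then obtain z where z: "z \<le> t" "D z = 0" "\<And>t. t < z \<Longrightarrow> D t > 0"
      using first_zero[OF hderiv_cont[OF D(1) order.refl] pos, of t] t T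
      by (metis less_eq_real_def not_less order.trans)
    have w0: "w s \<ge> 0" if "s \<le> z" for s
    proof (rule hderiv_mono_from_bot[OF w _ _ lim[folded w_def] that])
      fix x assume "x < z"
      then show "0 \<le> \<psi> x * D2 x - D x * \<psi>2 x"
        using le[of x] z(1) z(3)[of x] t by simp
    qed (use z(1) t T in simp)
    have "D (z-1) / \<psi> (z-1) \<le> D z / \<psi> z"
    proof (rule DERIV_nonneg_imp_nondecreasing[of "z-1" z "\<lambda>t. D t / \<psi> t"])
      fix x assume x: "z - 1 \<le> x" "x \<le> z"
      then have "x < T" "x < 0" using z t T by auto
      have "((\<lambda>t. D t / \<psi> t) has_real_derivative (D1 x * \<psi> x - D x * \<psi>1 x) / (\<psi> x * \<psi> x)) (at x)"
        using psi_pos[OF \<open>x < T\<close>]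
        by (intro DERIV_divide hderiv_at[OF D(1)] hderiv_at[OF psi(1)]) (use \<open>x < 0\<close> in auto)
      moreover have "(D1 x * \<psi> x - D x * \<psi>1 x) / (\<psi> x * \<psi> x) \<ge> 0"
        using w0[OF x(2)] by (simp add: w_def mult.commute)
      ultimately show "\<exists>y. ((\<lambda>t. D t / \<psi> t) has_real_derivative y) (at x) \<and> 0 \<le> y" by blast
    qed simp
    then show False using z(2) z(3)[of "z-1"] psi_pos[of "z-1"] z(1) t
      by (auto simp: divide_le_0_iff)
  qed
  show "\<And>t. t < T \<Longrightarrow> D t > 0" by (fact Dpos)
  show "\<psi> t * D1 t - D t * \<psi>1 t \<ge> 0" if "t \<le> T" for t
    using hderiv_mono_from_bot[OF w T _ lim[folded w_def] that] le Dpos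
    by (simp add: w_def)
qed

text \<open>\<open>2 D D1 (1 - P)\<close> is at most \<open>(1 + C) (D^2 + D1^2)\<close>. As no sign
  of \<open>P\<close> is involved, bounds pass through regions where comparison fails; moreover a
  double zero of \<open>D\<close> at s forces \<open>D = 0\<close> to its right.\<close>

lemma energy_gronwall:
  assumes D: "hderiv D D1" "hderiv D1 (\<lambda>t. - P t * D t)" and C: "\<And>x. s < x \<Longrightarrow> x < t \<Longrightarrow> \<bar>P x\<bar> \<le> C"
    and st: "s \<le> t" "t \<le> 0"
  shows "(D t)\<^sup>2 + (D1 t)\<^sup>2 \<le> ((D s)\<^sup>2 + (D1 s)\<^sup>2) * exp ((1 + C) * (t - s))"
proof -
  define E where "E = (\<lambda>t. (D t)\<^sup>2 + (D1 t)\<^sup>2)"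
  have "hderiv (\<lambda>t. - (E t * exp (- (1+C) * t)))
     (\<lambda>t. ((1+C) * E t - 2 * D t * D1 t * (1 - P t)) * exp (- (1+C) * t))"
    unfolding E_def power2_eq_square
    by (rule hderiv_cong[OF hderiv_minus[OF hderiv_mult[OF hderiv_add[OF hderiv_mult[OF D(1) D(1)] hderiv_mult[OF D(2) D(2)]] hderiv_exp]]])
       (auto simp: algebra_simps)
  then have "- (E s * exp (- (1+C) * s)) \<le> - (E t * exp (- (1+C) * t))"
  proof (rule hderiv_mono[OF _ st])
    fix x assume x: "s < x" "x < t"
    have "2 * D x * D1 x * (1 - P x) \<le> \<bar>2 * D x * D1 x\<bar> * \<bar>1 - P x\<bar>"
      by (metis abs_ge_self abs_mult)
    also have "\<dots> \<le> E x * (1 + C)"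
    proof (rule mult_mono)
      show "\<bar>2 * D x * D1 x\<bar> \<le> E x"
        using sum_squares_bound[of "\<bar>D x\<bar>" "\<bar>D1 x\<bar>"] by (simp add: E_def abs_mult)
      show "\<bar>1 - P x\<bar> \<le> 1 + C" using C[OF x] by linarith
    qed (auto simp: E_def)
    finally show "0 \<le> ((1+C) * E x - 2 * D x * D1 x * (1 - P x)) * exp (- (1+C) * x)"
      by (simp add: mult.commute)
  qed
  then have "E t * exp (- (1+C) * t) * exp ((1+C)*t) \<le> E s * exp (- (1+C) * s) * exp ((1+C)*t)"
    by (intro mult_right_mono) auto
  then show ?thesis by (simp add: E_def mult.assoc exp_add[symmetric] algebra_simps)
qed

section \<open>The first Dirichlet eigenvalue of the disc\<close>

text \<open>Radial functions are written through \<open>x \<bullet> x\<close> instead of the norm,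
  so that the origin is no special point: only smoothness in the squared radius enters.\<close>

lemma has_derivs2_inner_self:
  fixes g g1 g2 :: "real \<Rightarrow> real"
  assumes g: "\<And>s. (g has_real_derivative g1 s) (at s)" and g1: "\<And>s. (g1 has_real_derivative g2 s) (at s)"
    and g2: "continuous_on UNIV g2"
  obtains D D2 where "has_derivs2 (\<lambda>x::'a::euclidean_space. g (x \<bullet> x)) D D2 UNIV"
    "continuous_on UNIV D" "continuous_on UNIV D2"
    "\<And>x y z. blinfun_apply (blinfun_apply (D2 x) y) z = 4 * g2 (x \<bullet> x) * (x \<bullet> y) * (x \<bullet> z) + 2 * g1 (x \<bullet> x) * (y \<bullet> z)"
proof -
  define I where "I = (blinfun_inner_right :: 'a \<Rightarrow> 'a \<Rightarrow>\<^sub>L real)"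
  have I: "bounded_linear I" unfolding I_def by (rule bounded_linear_blinfun_inner_right)
  define J where "J = Blinfun I"
  have J: "blinfun_apply J = I" unfolding J_def by (rule bounded_linear_Blinfun_apply[OF I])
  define D where "D = (\<lambda>x::'a. (2 * g1 (x \<bullet> x)) *\<^sub>R I x)"
  define D2 where "D2 = (\<lambda>x::'a. (4 * g2 (x \<bullet> x)) *\<^sub>R (blinfun_scaleR_left (I x) o\<^sub>L I x) + (2 * g1 (x \<bullet> x)) *\<^sub>R J)"
  have I_cont: "continuous_on UNIV I"
    by (rule linear_continuous_on[OF I])
  have g1_cont: "continuous_on UNIV g1" using g1 by (meson DERIV_isCont continuous_at_imp_continuous_on)
  have hd: "((\<lambda>x. g (x \<bullet> x)) has_derivative blinfun_apply (D x)) (at x)" for x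
  proof -
    have "((\<lambda>x. g (x \<bullet> x)) has_derivative (\<lambda>h. g1 (x \<bullet> x) * (2 * (x \<bullet> h)))) (at x)"
      by (rule has_derivative_compose[of "\<lambda>x. x \<bullet> x" "\<lambda>h. 2 * (x \<bullet> h)" x UNIV g "\<lambda>h. g1 (x \<bullet> x) * h"])
         (auto intro!: derivative_eq_intros simp: inner_commute has_field_derivative_imp_has_derivative[OF g])
    then show ?thesis by (rule has_derivative_eq_rhs) (auto simp: D_def I_def blinfun.scaleR_left)
  qed
  have hd2: "(D has_derivative blinfun_apply (D2 x)) (at x)" for x
  proof -
    have 1: "((\<lambda>x. 2 * g1 (x \<bullet> x)) has_derivative (\<lambda>h. 2 * (g2 (x \<bullet> x) * (2 * (x \<bullet> h))))) (at x)"
      by (intro has_derivative_mult_right has_derivative_compose[of "\<lambda>x. x \<bullet> x" "\<lambda>h. 2 * (x \<bullet> h)" x UNIV g1 "\<lambda>h. g2 (x \<bullet> x) * h"])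
         (auto intro!: derivative_eq_intros simp: inner_commute has_field_derivative_imp_has_derivative[OF g1])
    have 2: "(I has_derivative I) (at x)" by (rule bounded_linear_imp_has_derivative[OF I])
    show ?thesis unfolding D_def
      by (rule has_derivative_eq_rhs[OF has_derivative_scaleR[OF 1 2]])
         (auto simp: D2_def J I_def blinfun.add_left blinfun.scaleR_left intro!: ext)
  qed
  have cg: "continuous_on UNIV (\<lambda>x::'a. g2 (x \<bullet> x))" "continuous_on UNIV (\<lambda>x::'a. g1 (x \<bullet> x))"
    by (auto intro!: continuous_on_compose2[OF g2] continuous_on_compose2[OF g1_cont] continuous_intros)
  have "continuous_on UNIV (\<lambda>x. blinfun_scaleR_left (I x) o\<^sub>L I x)"
    by (intro bounded_bilinear.continuous_on[OF bounded_bilinear_blinfun_compose]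
          linear_continuous_on bounded_linear_compose[OF bounded_linear_blinfun_scaleR_left I] I)
  then have "continuous_on UNIV D" "continuous_on UNIV D2"
    unfolding D_def D2_def by (auto intro!: continuous_intros cg I_cont)
  moreover have "blinfun_apply (blinfun_apply (D2 x) y) z = 4 * g2 (x \<bullet> x) * (x \<bullet> y) * (x \<bullet> z) + 2 * g1 (x \<bullet> x) * (y \<bullet> z)" for x y z
    by (simp add: D2_def J I_def blinfun.add_left blinfun.scaleR_left)
  ultimately show ?thesis
    by (intro that[of D D2]) (auto simp: has_derivs2_def hd hd2)
qed

lemma laplacian_has_derivs2:
  assumes f: "has_derivs2 f D D2 \<Omega>" and "open \<Omega>" "x \<in> \<Omega>"
  shows "laplacian f x = (\<Sum>b\<in>Basis. blinfun_apply (blinfun_apply (D2 x) b) b)"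
proof -
  have pd: "partial_deriv b f y = blinfun_apply (D y) b" if "y \<in> \<Omega>" for b y
    using f that frechet_derivative_at unfolding has_derivs2_def partial_deriv_def by metis
  have "partial_deriv b (partial_deriv b f) x = blinfun_apply (blinfun_apply (D2 x) b) b" for b
  proof -
    have "(D has_derivative blinfun_apply (D2 x)) (at x)"
      using f \<open>x \<in> \<Omega>\<close> by (auto simp: has_derivs2_def)
    then have "((\<lambda>y. blinfun_apply (D y) b) has_derivative (\<lambda>h. blinfun_apply (blinfun_apply (D2 x) h) b)) (at x)"
      by (auto intro!: derivative_eq_intros)
    then have "(partial_deriv b f has_derivative (\<lambda>h. blinfun_apply (blinfun_apply (D2 x) h) b)) (at x)"
      by (rule has_derivative_transform_within_open[OF _ assms(2,3)]) (simp add: pd)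
    then show ?thesis using frechet_derivative_at unfolding partial_deriv_def[of b "partial_deriv b f"] by metis
  qed
  then show ?thesis by (simp add: laplacian_def)
qed

text \<open>Along the line through \<open>x\<close> in direction \<open>b\<close> the first
  derivative \<open>h1\<close> vanishes at the minimum; a negative second derivative makes
  \<open>h1\<close> negative just afterwards, and \<open>h\<close> drops below its minimum.\<close>

lemma second_derivative_at_interior_min:
  assumes f: "has_derivs2 f D D2 \<Omega>" and "open \<Omega>" "x \<in> \<Omega>" and min: "\<And>y. y \<in> \<Omega> \<Longrightarrow> f x \<le> f y"
  shows "blinfun_apply (blinfun_apply (D2 x) b) b \<ge> 0"
proof (rule ccontr)
  assume neg: "\<not> ?thesis"
  obtain e where e: "e > 0" "ball x e \<subseteq> \<Omega>" using assms(2,3) openE by blast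
  \<comment> \<open>The summand 1 covers \<open>b = 0\<close>.\<close>
  define d where "d = e / (norm b + 1)"
  have nb: "norm b + 1 > 0" by (simp add: add_nonneg_pos)
  have d: "d > 0" using e(1) nb by (simp add: d_def)
  have dm: "x + t *\<^sub>R b \<in> \<Omega>" if "\<bar>t\<bar> < d" for t
  proof -
    have "norm (t *\<^sub>R b) \<le> \<bar>t\<bar> * (norm b + 1)" by (simp add: algebra_simps)
    also have "\<dots> < e" using that nb by (simp add: d_def pos_less_divide_eq)
    finally show ?thesis using e(2) by (auto simp: dist_norm subset_iff)
  qed
  define h where "h = (\<lambda>t. f (x + t *\<^sub>R b))"
  define h1 where "h1 = (\<lambda>t. blinfun_apply (D (x + t *\<^sub>R b)) b)"
  have lin: "((\<lambda>t. x + t *\<^sub>R b) has_derivative (\<lambda>s. s *\<^sub>R b)) (at t)" for t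
    by (auto intro!: derivative_eq_intros)
  have h: "(h has_real_derivative h1 t) (at t)" if "\<bar>t\<bar> < d" for t
  proof -
    have "(f has_derivative blinfun_apply (D (x + t *\<^sub>R b))) (at (x + t *\<^sub>R b))"
      using f dm[OF that] by (auto simp: has_derivs2_def)
    from has_derivative_compose[OF lin this] show ?thesis
      unfolding h_def h1_def has_field_derivative_def
      by (rule has_derivative_eq_rhs) (auto simp: blinfun.scaleR_right)
  qed
  have "(D has_derivative blinfun_apply (D2 x)) (at (x + 0 *\<^sub>R b))"
    using f \<open>x \<in> \<Omega>\<close> by (auto simp: has_derivs2_def)
  from has_derivative_compose[OF lin this]
  have "((\<lambda>t. D (x + t *\<^sub>R b)) has_derivative (\<lambda>s. blinfun_apply (D2 x) (s *\<^sub>R b))) (at 0)" by simp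
  then have "(h1 has_derivative (\<lambda>s. blinfun_apply (blinfun_apply (D2 x) (s *\<^sub>R b)) b)) (at 0)"
    unfolding h1_def by (auto intro!: derivative_eq_intros)
  then have h2: "(h1 has_real_derivative blinfun_apply (blinfun_apply (D2 x) b) b) (at 0)"
    unfolding has_field_derivative_def
    by (rule has_derivative_eq_rhs) (auto simp: blinfun.scaleR_right blinfun.scaleR_left)
  have "\<forall>y. \<bar>0 - y\<bar> < d \<longrightarrow> h 0 \<le> h y" using min dm by (auto simp: h_def)
  then have "h1 0 = 0" using DERIV_local_min[OF h[of 0] d] d by simp
  from DERIV_neg_dec_right[OF h2] neg obtain \<delta> where \<delta>: "\<delta> > 0" "\<And>s. 0 < s \<Longrightarrow> s < \<delta> \<Longrightarrow> h1 s < 0"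
    using \<open>h1 0 = 0\<close> by auto
  define m where "m = min \<delta> d / 2"
  have m: "0 < m" "m < \<delta>" "m < d" using \<delta>(1) d by (auto simp: m_def)
  have "h m < h 0"
  proof (rule DERIV_neg_imp_decreasing_open[of 0 m h])
    show "continuous_on {0..m} h" using m h by (intro DERIV_atLeastAtMost_imp_continuous_on) (auto intro!: exI h)
    fix s assume "0 < s" "s < m"
    then show "\<exists>y. (h has_real_derivative y) (at s) \<and> y < 0" using h[of s] \<delta>(2)[of s] m by auto
  qed (use m in auto)
  moreover have "h 0 \<le> h m" using min dm[of m] m by (auto simp: h_def)
  ultimately show False by simp
qed

text \<open>\<open>bj s = J\<^sub>0(\<surd>s)\<close>, an entire function of \<open>s\<close>; hence its first zero is the first Dirichlet
  eigenvalue of the unit disc.\<close>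

definition bj_coeff :: "nat \<Rightarrow> real"
  where "bj_coeff n = (-1/4) ^ n / (fact n)\<^sup>2"

definition bj :: "real \<Rightarrow> real" where "bj s = (\<Sum>n. bj_coeff n * s ^ n)"
definition bj1 :: "real \<Rightarrow> real" where "bj1 s = (\<Sum>n. diffs bj_coeff n * s ^ n)"
definition bj2 :: "real \<Rightarrow> real" where "bj2 s = (\<Sum>n. diffs (diffs bj_coeff) n * s ^ n)"

lemma bj_coeff_Suc: "of_nat (Suc n) ^ 2 * bj_coeff (Suc n) = - bj_coeff n / 4"
  unfolding bj_coeff_def fact_Suc by (simp add: power2_eq_square field_simps del: of_nat_Suc)

lemma bj_summable: "summable (\<lambda>n. bj_coeff n * s ^ n)"
proof (rule summable_comparison_test)
  show "summable (\<lambda>n. inverse (fact n) * \<bar>s\<bar> ^ n)" using summable_exp by auto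
  have "norm (bj_coeff n * s ^ n) \<le> inverse (fact n) * \<bar>s\<bar> ^ n" for n
  proof -
    have "\<bar>bj_coeff n\<bar> = (1/4) ^ n / (fact n * fact n)"
      by (simp add: bj_coeff_def power_abs power2_eq_square abs_mult)
    also have "\<dots> \<le> 1 / (fact n * 1)"
      by (intro frac_le mult_left_mono fact_ge_1 power_le_one) auto
    finally show ?thesis
      using mult_right_mono[of "\<bar>bj_coeff n\<bar>" "1 / fact n" "\<bar>s\<bar> ^ n"]
      by (simp add: abs_mult power_abs inverse_eq_divide)
  qed
  then show "\<exists>N. \<forall>n\<ge>N. norm (bj_coeff n * s ^ n) \<le> inverse (fact n) * \<bar>s\<bar> ^ n" by blast
qed

lemma bj_deriv: "(bj has_real_derivative bj1 s) (at s)"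
  and bj1_deriv: "(bj1 has_real_derivative bj2 s) (at s)"
  and bj2_cont: "continuous_on UNIV bj2"
proof -
  note s1 = termdiff_converges_all[OF bj_summable]
  note s2 = termdiff_converges_all[OF s1]
  show "(bj has_real_derivative bj1 s) (at s)"
    using termdiffs_strong_converges_everywhere[OF bj_summable] unfolding bj_def[abs_def] bj1_def by simp
  show "(bj1 has_real_derivative bj2 s) (at s)"
    using termdiffs_strong_converges_everywhere[OF s1] unfolding bj1_def[abs_def] bj2_def by simp
  have "(bj2 has_real_derivative (\<Sum>n. diffs (diffs (diffs bj_coeff)) n * s ^ n)) (at s)" for s
    using termdiffs_strong_converges_everywhere[OF s2] unfolding bj2_def[abs_def] by simp
  then show "continuous_on UNIV bj2" by (meson DERIV_isCont continuous_at_imp_continuous_on)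
qed

text \<open>Bessel's equation of order zero in the squared variable \<open>s\<close>; coefficient by
  coefficient it is the recursion \<open>bj_coeff_Suc\<close>.\<close>

lemma bj_ode: "s * bj2 s + bj1 s + bj s / 4 = 0"
proof -
  note s1 = termdiff_converges_all[OF bj_summable]
  note s2 = termdiff_converges_all[OF s1]
  have "(\<lambda>n. diffs (diffs bj_coeff) n * s ^ n) sums bj2 s" unfolding bj2_def by (intro summable_sums s2)
  then have "(\<lambda>n. s * (diffs (diffs bj_coeff) n * s ^ n)) sums (s * bj2 s)" by (rule sums_mult)
  moreover have "s * (diffs (diffs bj_coeff) n * s ^ n) = of_nat (Suc n) * diffs bj_coeff (Suc n) * s ^ Suc n" for n
    by (simp add: diffs_def)
  ultimately have "(\<lambda>n. of_nat (Suc n) * diffs bj_coeff (Suc n) * s ^ Suc n) sums (s * bj2 s)" by simp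
  then have A: "(\<lambda>n. of_nat n * diffs bj_coeff n * s ^ n) sums (s * bj2 s)"
    by (subst (asm) sums_Suc_iff) simp
  have B: "(\<lambda>n. diffs bj_coeff n * s ^ n) sums bj1 s" unfolding bj1_def by (intro summable_sums s1)
  have C: "(\<lambda>n. bj_coeff n * s ^ n / 4) sums (bj s / 4)" unfolding bj_def
    by (intro sums_divide summable_sums bj_summable)
  have "(\<lambda>n. of_nat n * diffs bj_coeff n * s ^ n + diffs bj_coeff n * s ^ n + bj_coeff n * s ^ n / 4)
      sums (s * bj2 s + bj1 s + bj s / 4)"
    by (intro sums_add A B C)
  moreover have "of_nat n * diffs bj_coeff n * s ^ n + diffs bj_coeff n * s ^ n + bj_coeff n * s ^ n / 4 = 0" for n
  proof -
    have "of_nat n * diffs bj_coeff n * s ^ n + diffs bj_coeff n * s ^ n + bj_coeff n * s ^ n / 4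
      = (of_nat (Suc n) ^ 2 * bj_coeff (Suc n) + bj_coeff n / 4) * s ^ n"
      by (simp add: diffs_def power2_eq_square algebra_simps)
    then show ?thesis unfolding bj_coeff_Suc by simp
  qed
  ultimately have "(\<lambda>n. 0::real) sums (s * bj2 s + bj1 s + bj s / 4)" by simp
  then show ?thesis by (metis sums_0 sums_unique2)
qed

lemma bj_0 [simp]: "bj 0 = 1"
  unfolding bj_def using powser_zero[of bj_coeff] by (simp add: bj_coeff_def)

text \<open>At 8 the first three terms are 1 - 2 + 1 and cancel. The tail alternates, shrinks and
  begins with a negative term, so grouping it in pairs shows its sign. Together with
  \<open>bj 0 = 1\<close> this guarantees a positive zero.\<close>

lemma bj_8_neg: "bj 8 < 0"
proof -
  define c where "c n = bj_coeff (n + 3) * 8 ^ (n + 3)" for n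
  define g where "g k = - (c (2 * k) + c (Suc (2 * k)))" for k
  have c: "c n = - ((-2) ^ n * 8 / (fact (n + 3))\<^sup>2)" for n
  proof -
    have "(-1/4) ^ (n+3) * 8 ^ (n+3) = ((-2) ^ (n+3) :: real)" by (simp flip: power_mult_distrib)
    also have "\<dots> = - ((-2) ^ n * 8)" by (simp add: power_add)
    finally show ?thesis by (simp add: c_def bj_coeff_def)
  qed
  have gpos: "g k > 0" for k
  proof -
    have f: "fact (Suc (2 * k) + 3) = (2 * real k + 4) * fact (2 * k + 3)"
      by (simp add: algebra_simps eval_nat_numeral)
    have "g k = 4 ^ k * 8 / (fact (2 * k + 3))\<^sup>2 * (1 - 2 / (2 * real k + 4)\<^sup>2)"
    proof -
      define F :: real where "F = (fact (2 * k + 3))\<^sup>2"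
      define K where "K = (2 * real k + 4)\<^sup>2"
      have "F > 0" "K > 0" by (simp_all add: F_def K_def add_nonneg_pos)
      have "c (2 * k) = - (4 ^ k * 8 / F)" by (simp add: c power_mult F_def)
      moreover have "c (Suc (2 * k)) = 2 * (4 ^ k * 8) / (K * F)"
        unfolding c f by (simp add: power_mult F_def K_def power_mult_distrib)
      ultimately show ?thesis using \<open>F > 0\<close> \<open>K > 0\<close>
        unfolding g_def F_def[symmetric] K_def[symmetric] by (simp add: field_simps)
    qed
    moreover have "2 / (2 * real k + 4)\<^sup>2 < 1"
    proof -
      have "(2 * real k + 4)\<^sup>2 \<ge> 4\<^sup>2" by (intro power_mono) auto
      then show ?thesis by simp
    qed
    ultimately show ?thesis by simp
  qed
  have "c sums (bj 8 - (\<Sum>n<3. bj_coeff n * 8 ^ n))"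
    unfolding c_def bj_def by (subst sums_iff_shift) (simp add: summable_sums[OF bj_summable])
  moreover have "(\<Sum>n<3. bj_coeff n * 8 ^ n) = 0"
    by (simp add: bj_coeff_def eval_nat_numeral)
  ultimately have "c sums bj 8" by simp
  from sums_minus[OF sums_group[OF this, of 2]]
  have "(\<lambda>n. - sum c {n * 2..<n * 2 + 2}) sums (- bj 8)" by simp
  moreover have "- sum c {n * 2..<n * 2 + 2} = g n" for n
    by (simp add: g_def mult.commute eval_nat_numeral)
  ultimately have "g sums (- bj 8)" by simp
  then have "- bj 8 = suminf g" "summable g" by (auto simp: sums_iff)
  then have "- bj 8 > 0" using suminf_pos[of g] gpos by simp
  then show ?thesis by simp
qed

section \<open>The first zero of the Bessel series as first eigenvalue of the disc\<close>

lemma bj_cont: "continuous_on S bj"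
  using bj_deriv by (meson DERIV_isCont continuous_at_imp_continuous_on)

definition bj_zero :: real where "bj_zero = Inf {s. s > 0 \<and> bj s = 0}"

lemma bj_zero: "bj_zero > 0" "bj bj_zero = 0" "\<And>s. 0 \<le> s \<Longrightarrow> s < bj_zero \<Longrightarrow> bj s > 0"
proof -
  define Z where "Z = {s\<in>{0..8}. bj s \<le> 0}"
  have "closed Z" unfolding Z_def by (intro continuous_on_closed_Collect_le bj_cont) auto
  moreover have "8 \<in> Z" "bdd_below Z" using bj_8_neg by (auto simp: Z_def)
  ultimately have z: "Inf Z \<in> Z" by (intro closed_contains_Inf) auto
  define z0 where "z0 = Inf Z"
  have pos: "bj s > 0" if "0 \<le> s" "s < z0" for s
  proof (rule ccontr)
    assume "\<not> bj s > 0"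
    then have "s \<in> Z" using that z by (auto simp: Z_def z0_def)
    then show False using cInf_lower[OF _ \<open>bdd_below Z\<close>] that by (force simp: z0_def)
  qed
  have z0: "0 \<le> z0" "bj z0 \<le> 0" using z by (auto simp: Z_def z0_def)
  then have "z0 > 0" by (cases "z0 = 0") auto
  have "bj z0 = 0"
  proof (rule ccontr)
    assume "bj z0 \<noteq> 0"
    then have "bj z0 < 0" using z0 by simp
    then obtain x where "0 \<le> x" "x \<le> z0" "bj x = 0"
      using IVT2'[of bj z0 0 0] bj_cont z0 by auto
    then show False using pos[of x] \<open>bj z0 < 0\<close> by (cases "x = z0") auto
  qed
  have "bj_zero = z0" unfolding bj_zero_def
  proof (rule cInf_eq_minimum)
    fix x assume "x \<in> {s. 0 < s \<and> bj s = 0}"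
    then show "z0 \<le> x" using pos[of x] by (cases "x < z0") auto
  qed (use \<open>z0 > 0\<close> \<open>bj z0 = 0\<close> in auto)
  then show "bj_zero > 0" "bj bj_zero = 0" "\<And>s. 0 \<le> s \<Longrightarrow> s < bj_zero \<Longrightarrow> bj s > 0"
    using \<open>z0 > 0\<close> \<open>bj z0 = 0\<close> pos by auto
qed

text \<open>The trace of the identity in the plane is 2, which gives \<open>bj1\<close> exactly the
  coefficient it has in \<open>bj_ode\<close>.\<close>

lemma bj_radial:
  obtains D D2 where "has_derivs2 (\<lambda>x::real^2. bj (m * (x \<bullet> x))) D D2 UNIV"
    "continuous_on UNIV D" "continuous_on UNIV D2"
    "\<And>x. (\<Sum>b\<in>Basis. blinfun_apply (blinfun_apply (D2 x) b) b) = - m * bj (m * (x \<bullet> x))"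
proof -
  have d: "((\<lambda>s. bj (m * s)) has_real_derivative m * bj1 (m * s)) (at s)"
     "((\<lambda>s. m * bj1 (m * s)) has_real_derivative m\<^sup>2 * bj2 (m * s)) (at s)" for s
    by (auto intro!: DERIV_cong[OF DERIV_chain2[OF bj_deriv DERIV_cmult_Id]]
        DERIV_cong[OF DERIV_cmult[OF DERIV_chain2[OF bj1_deriv DERIV_cmult_Id]]] simp: power2_eq_square)
  have c: "continuous_on UNIV (\<lambda>s. m\<^sup>2 * bj2 (m * s))"
    by (intro continuous_intros continuous_on_compose2[OF bj2_cont]) auto
  obtain D D2 where *: "has_derivs2 (\<lambda>x::real^2. bj (m * (x \<bullet> x))) D D2 UNIV"
    "continuous_on UNIV D" "continuous_on UNIV D2"
    "\<And>x y z. blinfun_apply (blinfun_apply (D2 x) y) z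
       = 4 * (m\<^sup>2 * bj2 (m * (x \<bullet> x))) * (x \<bullet> y) * (x \<bullet> z) + 2 * (m * bj1 (m * (x \<bullet> x))) * (y \<bullet> z)"
    by (rule has_derivs2_inner_self[OF d c]) (rule that)
  have "(\<Sum>b\<in>Basis. blinfun_apply (blinfun_apply (D2 x) b) b) = - m * bj (m * (x \<bullet> x))" for x
  proof -
    have "(\<Sum>b\<in>Basis. blinfun_apply (blinfun_apply (D2 x) b) b)
      = (\<Sum>b\<in>Basis. 4 * (m\<^sup>2 * bj2 (m * (x \<bullet> x))) * ((x \<bullet> b) * (x \<bullet> b))) + (\<Sum>b\<in>Basis. 2 * (m * bj1 (m * (x \<bullet> x))) * (b \<bullet> (b::real^2)))"
      by (simp add: * sum.distrib mult.assoc)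
    also have "(\<Sum>b\<in>Basis. 4 * (m\<^sup>2 * bj2 (m * (x \<bullet> x))) * ((x \<bullet> b) * (x \<bullet> b))) = 4 * (m\<^sup>2 * bj2 (m * (x \<bullet> x))) * (x \<bullet> x)"
      by (simp add: euclidean_inner[of x x] sum_distrib_left)
    also have "(\<Sum>b\<in>Basis. 2 * (m * bj1 (m * (x \<bullet> x))) * (b \<bullet> (b::real^2))) = 4 * (m * bj1 (m * (x \<bullet> x)))"
      by simp
    also have "4 * (m\<^sup>2 * bj2 (m * (x \<bullet> x))) * (x \<bullet> x) + 4 * (m * bj1 (m * (x \<bullet> x)))
       = 4 * m * ((m * (x \<bullet> x)) * bj2 (m * (x \<bullet> x)) + bj1 (m * (x \<bullet> x)) + bj (m * (x \<bullet> x)) / 4) - m * bj (m * (x \<bullet> x))"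
      by (simp add: algebra_simps power2_eq_square)
    also have "\<dots> = - m * bj (m * (x \<bullet> x))" by (simp add: bj_ode)
    finally show ?thesis .
  qed
  then show ?thesis using that *(1-3) by blast
qed

text \<open>Barta's comparison: for \<open>\<mu> < m < bj_zero\<close> the function
  \<open>\<psi>\<close> is positive on the closed disc and \<open>- Delta \<psi> = m \<psi>\<close>.
  The multiple \<open>k \<psi>\<close> that touches \<phi> from above does so inside, because \<phi>
  vanishes on the circle; at the contact point \<open>(\<mu> - m) k \<psi> \<ge> 0\<close>, which is
  impossible. The argument is pointwise, so continuity of \<phi> up to the circle is enough.\<close>

lemma no_small_eigenvalue_aux:
  fixes \<phi> :: "real^2 \<Rightarrow> real"
  assumes D: "has_derivs2 \<phi> D D2 (ball 0 1)" and c: "continuous_on (cball 0 1) \<phi>"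
    and x1: "x1 \<in> ball 0 1" "\<phi> x1 > 0"
    and eq: "\<And>x. x \<in> ball 0 1 \<Longrightarrow> - laplacian \<phi> x = \<mu> * \<phi> x"
    and bd: "\<And>x. x \<in> sphere 0 1 \<Longrightarrow> \<phi> x = 0"
  shows "\<mu> \<ge> bj_zero"
proof (rule ccontr)
  assume less: "\<not> \<mu> \<ge> bj_zero"
  \<comment> \<open>The maximum with 0 keeps \<open>m\<close> positive even for
    \<open>\<mu> \<le> 0\<close>, so that \<open>m * (x \<bullet> x)\<close> stays in
    \<open>[0, bj_zero)\<close>.\<close>
  define m where "m = (max \<mu> 0 + bj_zero) / 2"
  have m: "\<mu> < m" "0 < m" "m < bj_zero"
    using less bj_zero(1) by (auto simp: m_def max_def)
  define \<psi> where "\<psi> = (\<lambda>x::real^2. bj (m * (x \<bullet> x)))"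
  have pos: "\<psi> x > 0" if "x \<in> cball 0 1" for x
  proof -
    have "x \<bullet> x \<le> 1" using that by (simp add: dot_square_norm power_le_one)
    then have "m * (x \<bullet> x) \<le> m" using m by (simp add: mult_left_le)
    then have "m * (x \<bullet> x) < bj_zero" using m by linarith
    then show ?thesis unfolding \<psi>_def using m by (intro bj_zero(3)) auto
  qed
  obtain E E2 where E: "has_derivs2 \<psi> E E2 UNIV"
    "\<And>x. (\<Sum>b\<in>Basis. blinfun_apply (blinfun_apply (E2 x) b) b) = - m * \<psi> x"
    unfolding \<psi>_def by (rule bj_radial[of m]) blast
  have c\<psi>: "continuous_on (cball 0 1) \<psi>" unfolding \<psi>_def
    by (intro continuous_on_compose2[OF bj_cont[of UNIV]] continuous_intros) auto
  have "continuous_on (cball 0 1) (\<lambda>x. \<phi> x / \<psi> x)"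
    using pos by (intro continuous_intros c c\<psi>) force
  then obtain x0 where x0: "x0 \<in> cball 0 1" "\<And>y. y \<in> cball 0 1 \<Longrightarrow> \<phi> y / \<psi> y \<le> \<phi> x0 / \<psi> x0"
    using continuous_attains_sup[of "cball 0 1" "\<lambda>x. \<phi> x / \<psi> x"] by auto
  define k where "k = \<phi> x0 / \<psi> x0"
  have "k > 0" using x0(2)[of x1] x1 pos[of x1] unfolding k_def
    by (smt (verit, best) ball_subset_cball divide_pos_pos subsetD)
  have x0b: "x0 \<in> ball 0 1"
  proof (rule ccontr)
    assume "x0 \<notin> ball 0 1"
    then have "\<phi> x0 = 0" using x0(1) by (intro bd) auto
    then show False using \<open>k > 0\<close> by (simp add: k_def)
  qed
  have h: "has_derivs2 (\<lambda>x. k * \<psi> x - \<phi> x) (\<lambda>x. k *\<^sub>R E x - D x) (\<lambda>x. k *\<^sub>R E2 x - D2 x) (ball 0 1)"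
    unfolding has_derivs2_def
  proof (intro ballI conjI)
    fix x :: "real^2" assume x: "x \<in> ball 0 1"
    show "((\<lambda>x. k * \<psi> x - \<phi> x) has_derivative blinfun_apply (k *\<^sub>R E x - D x)) (at x)"
      using E(1) D x unfolding has_derivs2_def
      by (auto intro!: derivative_eq_intros simp: blinfun.diff_left blinfun.scaleR_left)
    show "((\<lambda>x. k *\<^sub>R E x - D x) has_derivative blinfun_apply (k *\<^sub>R E2 x - D2 x)) (at x)"
      using E(1) D x unfolding has_derivs2_def
      by (auto intro!: derivative_eq_intros simp: blinfun.diff_left blinfun.scaleR_left)
  qed
  have k0: "k * \<psi> x0 - \<phi> x0 = 0" using pos[OF x0(1)] by (simp add: k_def)
  have "k * \<psi> x0 - \<phi> x0 \<le> k * \<psi> y - \<phi> y" if "y \<in> ball 0 1" for y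
  proof -
    have "y \<in> cball 0 1" using that by simp
    then have "\<phi> y / \<psi> y \<le> k" "\<psi> y > 0" using x0(2) pos by (auto simp: k_def)
    then show ?thesis using k0 by (simp add: divide_le_eq)
  qed
  from second_derivative_at_interior_min[OF h open_ball x0b this]
  have "(\<Sum>b\<in>Basis. blinfun_apply (blinfun_apply (k *\<^sub>R E2 x0 - D2 x0) b) b) \<ge> 0"
    by (intro sum_nonneg) auto
  then have "k * (- m * \<psi> x0) - laplacian \<phi> x0 \<ge> 0"
    unfolding E(2)[symmetric] laplacian_has_derivs2[OF D open_ball x0b]
    by (simp add: blinfun.diff_left blinfun.scaleR_left sum_subtractf sum_distrib_left)
  then have "k * (- m * \<psi> x0) + \<mu> * \<phi> x0 \<ge> 0" using eq[OF x0b] by simp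
  moreover have "\<phi> x0 = k * \<psi> x0" using k0 by simp
  ultimately have "(\<mu> - m) * (k * \<psi> x0) \<ge> 0" by (simp add: algebra_simps)
  then show False using m(1) \<open>k > 0\<close> pos[OF x0(1)]
    by (metis diff_gt_0_iff_gt linorder_not_le minus_diff_eq mult_neg_pos mult_pos_pos neg_less_0_iff_less)
qed

text \<open>\<open>bj (bj_zero * (x \<bullet> x))\<close> is an eigenfunction for this value. Any
  other eigenfunction, radial or not, becomes positive somewhere after a change of sign, and then
  the comparison bounds its eigenvalue from below.\<close>

lemma H_disc_eq: "H_disc = bj_zero"
  unfolding H_disc_def
proof (rule Least_equality)
  define \<psi> where "\<psi> = (\<lambda>x::real^2. bj (bj_zero * (x \<bullet> x)))"
  obtain E E2 where E: "has_derivs2 \<psi> E E2 UNIV" "continuous_on UNIV E2"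
    "\<And>x. (\<Sum>b\<in>Basis. blinfun_apply (blinfun_apply (E2 x) b) b) = - bj_zero * \<psi> x"
    unfolding \<psi>_def by (rule bj_radial[of bj_zero]) blast
  have c\<psi>: "continuous_on S \<psi>" for S unfolding \<psi>_def
    by (intro continuous_on_compose2[OF bj_cont[of UNIV]] continuous_intros) auto
  show "dirichlet_eigenvalue (ball (0::real^2) 1) bj_zero"
    unfolding dirichlet_eigenvalue_def
  proof (intro exI[of _ \<psi>] conjI ballI)
    show "C2_on \<psi> (ball 0 1)"
      unfolding C2_on_def using E(1) continuous_on_subset[OF E(2)]
      by (auto intro!: exI[of _ E] exI[of _ E2] simp: has_derivs2_def)
    show "\<exists>x\<in>ball 0 1. \<psi> x \<noteq> 0" by (intro bexI[of _ 0]) (auto simp: \<psi>_def)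
    show "\<psi> x = 0" if "x \<in> frontier (ball 0 1)" for x
      using that by (simp add: \<psi>_def dot_square_norm bj_zero(2))
    show "- laplacian \<psi> x = bj_zero * \<psi> x" for x
      by (simp add: laplacian_has_derivs2[OF E(1)] E(3))
  qed (rule c\<psi>)
next
  fix \<mu> assume "dirichlet_eigenvalue (ball (0::real^2) 1) \<mu>"
  then obtain \<phi> :: "real^2 \<Rightarrow> real" and D D2 x where
    phi: "has_derivs2 \<phi> D D2 (ball 0 1)" "continuous_on (cball 0 1) \<phi>" "x \<in> ball 0 1" "\<phi> x \<noteq> 0"
      "\<And>x. x \<in> ball 0 1 \<Longrightarrow> - laplacian \<phi> x = \<mu> * \<phi> x" "\<And>x. x \<in> sphere 0 1 \<Longrightarrow> \<phi> x = 0"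
    unfolding dirichlet_eigenvalue_def C2_on_def by auto
  show "bj_zero \<le> \<mu>"
  proof (cases "\<phi> x > 0")
    case True
    then show ?thesis using no_small_eigenvalue_aux[OF phi(1-3)] phi(5,6) by blast
  next
    case False
    have d: "has_derivs2 (\<lambda>x. - \<phi> x) (\<lambda>x. - D x) (\<lambda>x. - D2 x) (ball 0 1)"
      using phi(1) unfolding has_derivs2_def
      by (auto intro!: derivative_eq_intros simp: blinfun.minus_left)
    have "- laplacian (\<lambda>x. - \<phi> x) y = \<mu> * - \<phi> y" if "y \<in> ball 0 1" for y
      using phi(5)[OF that] laplacian_has_derivs2[OF d open_ball that] laplacian_has_derivs2[OF phi(1) open_ball that]
      by (simp add: blinfun.minus_left sum_negf)
    then show ?thesis
      using no_small_eigenvalue_aux[OF d _ phi(3)] phi False by (auto intro: continuous_on_minus)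
  qed
qed

lemma a_fam_C2: "C2_on_closure (\<lambda>x::'a::euclidean_space. a_fam N h (norm x)) (ball 0 1)"
proof -
  define p q where "p = h / (2 * (real N - 2))" and "q = h / (2 * real N)"
  have d1: "((\<lambda>s. (1 + p * s) * exp (q * s)) has_real_derivative (p + q * (1 + p * s)) * exp (q * s)) (at s)"
    and d2: "((\<lambda>s. (p + q * (1 + p * s)) * exp (q * s)) has_real_derivative (q * p + q * (p + q * (1 + p * s))) * exp (q * s)) (at s)" for s
    by (auto intro!: derivative_eq_intros simp: algebra_simps)
  have c: "continuous_on UNIV (\<lambda>s. (q * p + q * (p + q * (1 + p * s))) * exp (q * s))"
    by (intro continuous_intros)
  have e: "(\<lambda>x::'a. a_fam N h (norm x)) = (\<lambda>x. (1 + p * (x \<bullet> x)) * exp (q * (x \<bullet> x)))"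
    by (simp add: a_fam_def p_def q_def dot_square_norm)
  obtain D D2 where D: "has_derivs2 (\<lambda>x::'a. (1 + p * (x \<bullet> x)) * exp (q * (x \<bullet> x))) D D2 UNIV"
    "continuous_on UNIV D" "continuous_on UNIV D2"
    by (rule has_derivs2_inner_self[OF d1 d2 c]) blast
  have "continuous_on (closure (ball 0 1)) (\<lambda>x::'a. (1 + p * (x \<bullet> x)) * exp (q * (x \<bullet> x)))"
    by (intro continuous_intros)
  then show ?thesis unfolding e C2_on_closure_def
    using D continuous_on_subset[OF D(2)] continuous_on_subset[OF D(3)]
    by (auto intro!: exI[of _ D] exI[of _ D2] simp: has_derivs2_def)
qed

section \<open>Existence and analytic dependence on the initial value\<close>

text \<open>Banach's theorem for a weighted supremum norm, stated pointwise so that no function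
  space has to be formed and \<open>\<omega>\<close> may be unbounded. The class \<open>\<F>\<close>
  carries whatever the iterates must keep (continuity, holomorphy, bounds, reality) and only has to
  be closed under geometrically convergent sequences.\<close>

lemma weighted_fixpoint:
  fixes T :: "('a \<Rightarrow> 'b::banach) \<Rightarrow> 'a \<Rightarrow> 'b"
  assumes u0: "u0 \<in> \<F>" and T: "\<And>u. u \<in> \<F> \<Longrightarrow> T u \<in> \<F>"
    and contr: "\<And>u w c x. u \<in> \<F> \<Longrightarrow> w \<in> \<F> \<Longrightarrow> (\<And>y. y \<in> S \<Longrightarrow> norm (u y - w y) \<le> c * \<omega> y) \<Longrightarrow>
       x \<in> S \<Longrightarrow> norm (T u x - T w x) \<le> c / 2 * \<omega> x"
    and init: "\<And>x. x \<in> S \<Longrightarrow> norm (T u0 x - u0 x) \<le> c * \<omega> x"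
    and c: "c \<ge> 0" and \<omega>: "\<And>x. x \<in> S \<Longrightarrow> \<omega> x > 0"
    and closed: "\<And>U u. (\<And>n. U n \<in> \<F>) \<Longrightarrow>
       (\<And>n x. x \<in> S \<Longrightarrow> norm (U n x - u x) \<le> 2 * c * (1/2) ^ n * \<omega> x) \<Longrightarrow> u \<in> \<F>"
  obtains u where "u \<in> \<F>" "\<And>x. x \<in> S \<Longrightarrow> T u x = u x"
proof -
  define U where "U n = (T ^^ n) u0" for n
  have U: "U n \<in> \<F>" for n by (induction n) (auto simp: U_def u0 T)
  have US: "U (Suc n) = T (U n)" for n by (simp add: U_def)
  have step: "norm (U (Suc n) x - U n x) \<le> c * (1/2) ^ n * \<omega> x" if "x \<in> S" for n x
    using that
  proof (induction n arbitrary: x)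
    case 0 then show ?case using init by (simp add: U_def)
  next
    case (Suc n)
    have "norm (T (U (Suc n)) x - T (U n) x) \<le> (c * (1/2) ^ n) / 2 * \<omega> x"
      using Suc by (intro contr U) auto
    then show ?case by (simp add: US)
  qed
  \<comment> \<open>The factor \<open>1 - (1/2) ^ k\<close> is the exact geometric sum; with the
    plain bound 1 the induction would not close.\<close>
  have tel: "norm (U (n + k) x - U n x) \<le> 2 * c * (1/2) ^ n * \<omega> x * (1 - (1/2) ^ k)" if x: "x \<in> S" for n k x
  proof (induction k)
    case (Suc k)
    have "norm (U (n + Suc k) x - U n x) \<le> norm (U (Suc (n + k)) x - U (n + k) x) + norm (U (n + k) x - U n x)"
      using norm_triangle_ineq[of "U (Suc (n + k)) x - U (n + k) x" "U (n + k) x - U n x"] by simp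
    also have "\<dots> \<le> c * (1/2) ^ (n + k) * \<omega> x + 2 * c * (1/2) ^ n * \<omega> x * (1 - (1/2) ^ k)"
      using step[OF x, of "n + k"] Suc by linarith
    also have "\<dots> = 2 * c * (1/2) ^ n * \<omega> x * (1 - (1/2) ^ Suc k)"
      by (simp add: power_add algebra_simps)
    finally show ?case .
  qed simp
  have tel': "norm (U m x - U n x) \<le> 2 * c * (1/2) ^ n * \<omega> x" if x: "x \<in> S" "n \<le> m" for n m x
  proof -
    have "norm (U (n + (m - n)) x - U n x) \<le> 2 * c * (1/2) ^ n * \<omega> x * (1 - (1/2) ^ (m - n))"
      using tel[OF x(1)] .
    also have "\<dots> \<le> 2 * c * (1/2) ^ n * \<omega> x * 1"
      using c \<omega>[OF x(1)] by (intro mult_left_mono) auto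
    finally show ?thesis using x(2) by simp
  qed
  define u where "u x = lim (\<lambda>n. U n x)" for x
  have lim: "(\<lambda>n. U n x) \<longlonglongrightarrow> u x" if x: "x \<in> S" for x
  proof -
    have "Cauchy (\<lambda>n. U n x)"
    proof (rule metric_CauchyI)
      fix e :: real assume "e > 0"
      have "(\<lambda>n. 2 * c * (1/2) ^ n * \<omega> x) \<longlonglongrightarrow> 2 * c * 0 * \<omega> x"
        by (intro tendsto_intros LIMSEQ_power_zero) auto
      then have "\<forall>\<^sub>F n in sequentially. 2 * c * (1/2) ^ n * \<omega> x < e / 2"
        using \<open>e > 0\<close> by (intro order_tendstoD) auto
      then obtain N where N: "2 * c * (1/2) ^ N * \<omega> x < e / 2" by (auto simp: eventually_sequentially)
      have "dist (U m x) (U n x) < e" if "N \<le> m" "N \<le> n" for m n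
        using tel'[OF x that(1)] tel'[OF x that(2)] N norm_triangle_ineq4[of "U m x - U N x" "U n x - U N x"]
        by (simp add: dist_norm)
      then show "\<exists>M. \<forall>m\<ge>M. \<forall>n\<ge>M. dist (U m x) (U n x) < e" by blast
    qed
    then show ?thesis unfolding u_def using Cauchy_convergent_iff convergent_LIMSEQ_iff by blast
  qed
  have err: "norm (U n x - u x) \<le> 2 * c * (1/2) ^ n * \<omega> x" if x: "x \<in> S" for n x
  proof (rule tendsto_upperbound)
    show "((\<lambda>m. norm (U n x - U m x)) \<longlongrightarrow> norm (U n x - u x)) sequentially"
      by (intro tendsto_intros lim x)
    show "\<forall>\<^sub>F m in sequentially. norm (U n x - U m x) \<le> 2 * c * (1/2) ^ n * \<omega> x"
      using eventually_ge_at_top[of n]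
      by eventually_elim (use tel'[OF x] in \<open>simp add: norm_minus_commute[of "U n x"]\<close>)
  qed simp
  have uF: "u \<in> \<F>" using closed[of U u] U err by blast
  have "T u x = u x" if x: "x \<in> S" for x
  proof -
    have "(\<lambda>n. U (Suc n) x) \<longlonglongrightarrow> T u x"
    proof (rule LIM_zero_cancel, rule Lim_null_comparison)
      show "\<forall>\<^sub>F n in sequentially. norm (U (Suc n) x - T u x) \<le> 2 * c * (1/2) ^ n / 2 * \<omega> x"
        unfolding US by (intro always_eventually allI contr U uF err x)
      have "(\<lambda>n. 2 * c * (1/2) ^ n / 2 * \<omega> x) \<longlonglongrightarrow> 2 * c * 0 / 2 * \<omega> x"
        by (intro tendsto_intros LIMSEQ_power_zero) auto
      then show "(\<lambda>n. 2 * c * (1/2) ^ n / 2 * \<omega> x) \<longlonglongrightarrow> 0" by simp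
    qed
    then show ?thesis using LIMSEQ_Suc[OF lim[OF x]] LIMSEQ_unique by blast
  qed
  then show ?thesis using that uF by blast
qed

lemma geometric_uniform_limit:
  fixes U :: "nat \<Rightarrow> 'a \<Rightarrow> 'b::real_normed_vector"
  assumes le: "\<And>n x. x \<in> S \<Longrightarrow> norm (U n x - u x) \<le> C * (1/2) ^ n * \<omega> x"
    and B: "\<And>x. x \<in> S \<Longrightarrow> \<omega> x \<le> B" and C: "C \<ge> 0"
  shows "uniform_limit S U u sequentially"
proof (rule uniform_limitI)
  fix e :: real assume "e > 0"
  have "(\<lambda>n. C * (1/2) ^ n * B) \<longlonglongrightarrow> C * 0 * B"
    by (intro tendsto_intros LIMSEQ_power_zero) auto
  then have "\<forall>\<^sub>F n in sequentially. C * (1/2) ^ n * B < e"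
    using \<open>e > 0\<close> by (intro order_tendstoD) auto
  then show "\<forall>\<^sub>F n in sequentially. \<forall>x\<in>S. dist (U n x) (u x) < e"
  proof eventually_elim
    case (elim n)
    have "norm (U n x - u x) < e" if "x \<in> S" for x
    proof -
      have "C * (1/2) ^ n * \<omega> x \<le> C * (1/2) ^ n * B" using C B[OF that] by (intro mult_left_mono) auto
      then show ?thesis using le[OF that, of n] elim by linarith
    qed
    then show ?case by (simp add: dist_norm)
  qed
qed

section \<open>The Green operator of the radial Laplacian\<close>

definition wint :: "(real \<Rightarrow> real) \<Rightarrow> (real \<Rightarrow> 'b::banach) \<Rightarrow> real \<Rightarrow> 'b"
  where "wint w F r = integral {0..1} (\<lambda>\<sigma>. w \<sigma> *\<^sub>R F (r * \<sigma>))"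

text \<open>The solution operator of \<open>\<Delta>u = F\<close>, \<open>u(0) = 0\<close>, \<open>u'(0) = 0\<close> on radial functions of \<open>\<real>\<^sup>1\<^sup>0\<close>;
  the kernel is rescaled so that the integral runs over \<open>[0,1]\<close>.\<close>

definition green :: "(real \<Rightarrow> 'b::banach) \<Rightarrow> real \<Rightarrow> 'b"
  where "green F r = (r\<^sup>2 / 8) *\<^sub>R wint (\<lambda>\<sigma>. \<sigma> - \<sigma> ^ 9) F r"

lemma wint_integrand_cont:
  fixes w :: "real \<Rightarrow> real" and F :: "real \<Rightarrow> 'b::banach"
  assumes "continuous_on {0..1} w" "continuous_on {0..1} F" "r \<in> {0..1}"
  shows "continuous_on {0..1} (\<lambda>\<sigma>. w \<sigma> *\<^sub>R F (r * \<sigma>))"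
  by (intro continuous_intros assms(1) continuous_on_compose2[OF assms(2)])
     (use assms(3) in \<open>auto intro: mult_le_one\<close>)

lemmas wint_integrable = integrable_continuous_interval[OF wint_integrand_cont]

lemma wint_param_cont:
  fixes f :: "'a::topological_space \<Rightarrow> real \<Rightarrow> 'b::banach"
  assumes w: "continuous_on {0..1} w" and f: "continuous_on (U \<times> {0..1}) (\<lambda>(z, s). f z s)"
  shows "continuous_on (U \<times> {0..1}) (\<lambda>(z, r). wint w (f z) r)"
proof -
  have "continuous_on ((U \<times> {0..1}) \<times> cbox 0 1) (\<lambda>(p, \<sigma>). w \<sigma> *\<^sub>R f (fst p) (snd p * \<sigma>))"
    unfolding split_beta
    by (intro continuous_intros continuous_on_compose2[OF w] continuous_on_compose2[OF f, where f = "\<lambda>x. (fst (fst x), snd (fst x) * snd x)", unfolded split_beta fst_conv snd_conv])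
       (auto intro: mult_le_one)
  from integral_continuous_on_param[OF this] show ?thesis
    unfolding wint_def split_beta by (simp add: split_beta)
qed

lemma wint_cont:
  assumes w: "continuous_on {0..1} w" and F: "continuous_on {0..1} F"
  shows "continuous_on {0..1} (wint w F)"
proof -
  have "continuous_on ({0::real} \<times> {0..1}) (\<lambda>(z, s). F s)"
    unfolding split_beta by (intro continuous_on_compose2[OF F] continuous_intros) auto
  from wint_param_cont[OF w this]
  have "continuous_on {0..1} (\<lambda>r. (\<lambda>(z, r). wint w F r) (0::real, r))"
    by (rule continuous_on_compose2) (auto intro!: continuous_intros)
  then show ?thesis by simp
qed

lemma green_cont: "continuous_on {0..1} F \<Longrightarrow> continuous_on {0..1} (green F)"
  unfolding green_def by (intro continuous_intros wint_cont) auto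

text \<open>Integrating an exponential weight gains \<open>1 / \<kappa>\<close>, while the kernel
  and \<open>r / 8\<close> are at most 1. With \<kappa> twice the Lipschitz constant of the
  nonlinearity, Picard iteration contracts on all of \<open>[0,1]\<close> at once.\<close>

lemma norm_green_le:
  fixes F :: "real \<Rightarrow> 'b::{banach}"
  assumes F: "continuous_on {0..1} F" and r: "r \<in> {0..1}" and \<kappa>: "\<kappa> > 0"
    and le: "\<And>s. s \<in> {0..1} \<Longrightarrow> norm (F s) \<le> c * exp (\<kappa> * s)"
  shows "norm (green F r) \<le> c * exp (\<kappa> * r) / \<kappa>"
proof (cases "r = 0")
  case True
  have "0 \<le> c" using le[of 0] by simp (metis norm_ge_zero order_trans)
  then show ?thesis using \<kappa> True by (simp add: green_def)
next
  case False
  then have r0: "r > 0" using r by simp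
  have c: "0 \<le> c" using le[of 0] by simp (metis norm_ge_zero order_trans)
  have hi: "((\<lambda>\<sigma>. c * exp (\<kappa> * (r * \<sigma>))) has_integral c * exp (\<kappa> * (r * 1)) / (\<kappa> * r) - c * exp (\<kappa> * (r * 0)) / (\<kappa> * r)) {0..1}"
    using r0 \<kappa> by (intro fundamental_theorem_of_calculus)
      (auto intro!: derivative_eq_intros simp flip: has_real_derivative_iff_has_vector_derivative)
  have "norm (wint (\<lambda>\<sigma>. \<sigma> - \<sigma> ^ 9) F r) \<le> integral {0..1} (\<lambda>\<sigma>. c * exp (\<kappa> * (r * \<sigma>)))"
    unfolding wint_def
  proof (rule integral_norm_bound_integral)
    show "(\<lambda>\<sigma>. (\<sigma> - \<sigma> ^ 9) *\<^sub>R F (r * \<sigma>)) integrable_on {0..1}"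
      by (intro wint_integrable continuous_intros F r)
    show "(\<lambda>\<sigma>. c * exp (\<kappa> * (r * \<sigma>))) integrable_on {0..1}"
      using hi by (rule has_integral_integrable)
    fix \<sigma> :: real assume s: "\<sigma> \<in> {0..1}"
    have "0 \<le> \<sigma> ^ 9" "\<sigma> ^ 9 \<le> \<sigma>" using s power_decreasing[of 1 9 \<sigma>] by auto
    then have "\<bar>\<sigma> - \<sigma> ^ 9\<bar> \<le> 1" using s unfolding atLeastAtMost_iff by linarith
    moreover have "norm (F (r * \<sigma>)) \<le> c * exp (\<kappa> * (r * \<sigma>))"
      using s r by (intro le) (auto intro: mult_le_one)
    ultimately have "\<bar>\<sigma> - \<sigma> ^ 9\<bar> * norm (F (r * \<sigma>)) \<le> 1 * (c * exp (\<kappa> * (r * \<sigma>)))"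
      by (intro mult_mono) auto
    then show "norm ((\<sigma> - \<sigma> ^ 9) *\<^sub>R F (r * \<sigma>)) \<le> c * exp (\<kappa> * (r * \<sigma>))" by simp
  qed
  also have "\<dots> = c * exp (\<kappa> * r) / (\<kappa> * r) - c / (\<kappa> * r)"
    using integral_unique[OF hi] by simp
  also have "\<dots> \<le> c * exp (\<kappa> * r) / (\<kappa> * r)" using c \<kappa> r0 by simp
  finally have "(r\<^sup>2 / 8) * norm (wint (\<lambda>\<sigma>. \<sigma> - \<sigma> ^ 9) F r) \<le> (r\<^sup>2 / 8) * (c * exp (\<kappa> * r) / (\<kappa> * r))"
    by (intro mult_left_mono) auto
  also have "\<dots> = (r / 8) * (c * exp (\<kappa> * r) / \<kappa>)"
    using r0 \<kappa> by (simp add: power2_eq_square field_simps)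
  also have "\<dots> \<le> 1 * (c * exp (\<kappa> * r) / \<kappa>)"
    using r c \<kappa> by (intro mult_right_mono) auto
  finally show ?thesis by (simp add: green_def)
qed

lemma green_diff:
  assumes "continuous_on {0..1} F" "continuous_on {0..1} G" "r \<in> {0..1}"
  shows "green (\<lambda>s. F s - G s) r = green F r - green G r"
proof -
  have "wint (\<lambda>\<sigma>. \<sigma> - \<sigma> ^ 9) (\<lambda>s. F s - G s) r = wint (\<lambda>\<sigma>. \<sigma> - \<sigma> ^ 9) F r - wint (\<lambda>\<sigma>. \<sigma> - \<sigma> ^ 9) G r"
    unfolding wint_def scaleR_diff_right
    by (intro integral_diff wint_integrable assms continuous_intros)
  then show ?thesis by (simp add: green_def scaleR_diff_right)
qed

lemma green_nonneg:
  fixes F :: "real \<Rightarrow> real"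
  assumes "continuous_on {0..1} F" "\<And>s. s \<in> {0..1} \<Longrightarrow> F s \<ge> 0" "r \<in> {0..1}"
  shows "green F r \<ge> 0"
proof -
  have "wint (\<lambda>\<sigma>. \<sigma> - \<sigma> ^ 9) F r \<ge> 0" unfolding wint_def
  proof (rule integral_nonneg)
    show "(\<lambda>\<sigma>. (\<sigma> - \<sigma> ^ 9) *\<^sub>R F (r * \<sigma>)) integrable_on {0..1}"
      by (intro wint_integrable continuous_intros assms)
    fix \<sigma> :: real assume s: "\<sigma> \<in> {0..1}"
    then have "\<sigma> ^ 9 \<le> \<sigma>" using power_decreasing[of 1 9 \<sigma>] by auto
    moreover have "F (r * \<sigma>) \<ge> 0" using s assms(3) by (intro assms(2)) (auto intro: mult_le_one)
    ultimately show "0 \<le> (\<sigma> - \<sigma> ^ 9) *\<^sub>R F (r * \<sigma>)" by simp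
  qed
  then show ?thesis by (simp add: green_def)
qed

lemma wint_power_scale:
  fixes F :: "real \<Rightarrow> real"
  assumes "continuous_on {0..1} F" "0 < r" "r \<le> 1"
  shows "wint (\<lambda>\<sigma>. \<sigma> ^ n) F r = integral {0..r} (\<lambda>s. s ^ n * F s) / r ^ Suc n"
proof -
  have "continuous_on {0..r} (\<lambda>s. s ^ n * F s)"
    using assms by (intro continuous_intros continuous_on_subset[OF assms(1)]) auto
  then have "((\<lambda>s. s ^ n * F s) has_integral integral {0..r} (\<lambda>s. s ^ n * F s)) (cbox 0 r)"
    using integrable_continuous_interval integrable_integral by fastforce
  from has_integral_affinity'[OF this assms(2), of 0]
  have "((\<lambda>x. (r * x) ^ n * F (r * x)) has_integral (integral {0..r} (\<lambda>s. s ^ n * F s) / r)) {0..1}"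
    using assms by (simp add: divide_inverse mult.commute)
  then have "((\<lambda>x. r ^ n * (x ^ n * F (r * x))) has_integral (integral {0..r} (\<lambda>s. s ^ n * F s) / r)) {0..1}"
    by (simp add: power_mult_distrib mult.assoc)
  from integral_unique[OF this]
  have "r ^ n * wint (\<lambda>\<sigma>. \<sigma> ^ n) F r = integral {0..r} (\<lambda>s. s ^ n * F s) / r"
    by (simp add: wint_def)
  then show ?thesis using assms by (simp add: field_simps)
qed

lemma integral_power_deriv:
  fixes F :: "real \<Rightarrow> real"
  assumes "continuous_on {0..1} F" "r \<in> {0..1}"
  shows "((\<lambda>r. integral {0..r} (\<lambda>s. s ^ n * F s)) has_real_derivative r ^ n * F r) (at r within {0..1})"
  using assms by (intro integral_has_real_derivative continuous_intros) auto

text \<open>For r > 0 the kernel splits into the moments \<open>I 1\<close> and \<open>I 9\<close>,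
  which are differentiated directly. At 0 the division by powers of x fails, but both functions have
  the form \<open>x * h x\<close> with \<open>h\<close> continuous, and such a product has
  derivative \<open>h 0\<close> there.\<close>

lemma green_deriv:
  fixes F :: "real \<Rightarrow> real"
  assumes F: "continuous_on {0..1} F" and r: "r \<in> {0..1}"
  shows "(green F has_real_derivative r * wint (\<lambda>\<sigma>. \<sigma> ^ 9) F r) (at r within {0..1})"
    and "((\<lambda>r. r * wint (\<lambda>\<sigma>. \<sigma> ^ 9) F r) has_real_derivative F r - 9 * wint (\<lambda>\<sigma>. \<sigma> ^ 9) F r) (at r within {0..1})"
proof -
  define I where "I n r = integral {0..r} (\<lambda>s. s ^ n * F s)" for n :: nat and r
  have I: "(I n has_real_derivative r ^ n * F r) (at r within {0..1})" for n
    unfolding I_def[abs_def] by (rule integral_power_deriv[OF F r])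
  note m = wint_power_scale[OF F, folded I_def]
  have gr: "green F x = (I 1 x - I 9 x / x ^ 8) / 8" if "0 < x" "x \<le> 1" for x
  proof -
    have "wint (\<lambda>\<sigma>. \<sigma> - \<sigma> ^ 9) F x = wint (\<lambda>\<sigma>. \<sigma> ^ 1) F x - wint (\<lambda>\<sigma>. \<sigma> ^ 9) F x"
      unfolding wint_def power_one_right scaleR_diff_left
      using that F by (intro integral_diff wint_integrable continuous_intros) auto
    also have "\<dots> = I 1 x / x ^ Suc 1 - I 9 x / x ^ Suc 9"
      using that by (simp only: m)
    also have "x ^ Suc 9 = x\<^sup>2 * x ^ 8" by (simp flip: power_add)
    also have "x ^ Suc 1 = x\<^sup>2" by (simp add: power2_eq_square)
    finally have "wint (\<lambda>\<sigma>. \<sigma> - \<sigma> ^ 9) F x = I 1 x / x\<^sup>2 - I 9 x / (x\<^sup>2 * x ^ 8)" .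
    then have "green F x = x\<^sup>2 * (I 1 x / x\<^sup>2 - I 9 x / (x\<^sup>2 * x ^ 8)) / 8" by (simp add: green_def)
    also have "x\<^sup>2 * (I 1 x / x\<^sup>2 - I 9 x / (x\<^sup>2 * x ^ 8)) = I 1 x - I 9 x / x ^ 8"
      using that by (simp add: right_diff_distrib del: power_add flip: power_add) (simp add: field_simps eval_nat_numeral)
    finally show ?thesis .
  qed
  have d: "r > 0 \<Longrightarrow> (green F has_real_derivative r * wint (\<lambda>\<sigma>. \<sigma> ^ 9) F r) (at r within {0..1})"
  proof -
    assume r0: "r > 0"
    have "((\<lambda>x. (I 1 x - I 9 x / x ^ 8) / 8) has_real_derivative r * wint (\<lambda>\<sigma>. \<sigma> ^ 9) F r) (at r within {0..1})"
      using r0 r by (auto intro!: derivative_eq_intros I simp: m) (simp add: field_simps eval_nat_numeral)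
    then show ?thesis
      by (rule has_field_derivative_transform_within[of _ _ _ _ r]) (use r0 r in \<open>auto simp: gr dist_real_def\<close>)
  qed
  have wc: "continuous_on {0..1} (wint (\<lambda>\<sigma>. \<sigma> ^ n) F)" "continuous_on {0..1} (wint (\<lambda>\<sigma>. \<sigma> - \<sigma> ^ 9) F)" for n
    by (intro wint_cont F continuous_intros)+
  have prod0: "((\<lambda>x. x * h x) has_real_derivative h 0) (at 0 within {0..1})" if "continuous_on {0..1} h" for h :: "real \<Rightarrow> real"
  proof -
    have "(h \<longlongrightarrow> h 0) (at 0 within {0..1})" using that by (simp add: continuous_on_def)
    moreover have "\<forall>\<^sub>F x in at 0 within {0..1}. h x = (x * h x - 0 * h 0) / (x - 0)"
      by (auto simp: eventually_at_filter)
    ultimately show ?thesis unfolding has_field_derivative_iff by (rule Lim_transform_eventually)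
  qed
  show "(green F has_real_derivative r * wint (\<lambda>\<sigma>. \<sigma> ^ 9) F r) (at r within {0..1})"
  proof (cases "r = 0")
    case True
    have "((\<lambda>x. x * (x / 8 * wint (\<lambda>\<sigma>. \<sigma> - \<sigma> ^ 9) F x)) has_real_derivative 0 / 8 * wint (\<lambda>\<sigma>. \<sigma> - \<sigma> ^ 9) F 0) (at 0 within {0..1})"
      by (intro prod0 continuous_intros wc) auto
    then show ?thesis using True by (simp add: green_def[abs_def] power2_eq_square mult.assoc)
  qed (use d r in auto)
  show "((\<lambda>r. r * wint (\<lambda>\<sigma>. \<sigma> ^ 9) F r) has_real_derivative F r - 9 * wint (\<lambda>\<sigma>. \<sigma> ^ 9) F r) (at r within {0..1})"
  proof (cases "r = 0")
    case True
    \<comment> \<open>Since the ninth moment of 1 is 1/10, the claimed value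
      \<open>F 0 - 9 * (F 0 / 10)\<close> agrees with the derivative \<open>F 0 / 10\<close> of the
      product.\<close>
    have "((\<lambda>\<sigma>. \<sigma> ^ 10 / 10) has_real_derivative x ^ 9) (at x within {0..1})" for x :: real
      by (rule DERIV_cong[OF DERIV_cdivide[OF DERIV_pow]]) simp
    then have "((\<lambda>\<sigma>::real. \<sigma> ^ 9) has_integral (1 ^ 10 / 10 - 0 ^ 10 / 10)) {0..1}"
      by (intro fundamental_theorem_of_calculus) (auto simp flip: has_real_derivative_iff_has_vector_derivative)
    then have "integral {0..1} (\<lambda>\<sigma>::real. \<sigma> ^ 9) = 1 / 10" using integral_unique[of "\<lambda>\<sigma>::real. \<sigma> ^ 9"] by simp
    then have "wint (\<lambda>\<sigma>. \<sigma> ^ 9) F 0 = F 0 / 10" by (simp add: wint_def)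
    then have "F 0 - 9 * wint (\<lambda>\<sigma>. \<sigma> ^ 9) F 0 = wint (\<lambda>\<sigma>. \<sigma> ^ 9) F 0" by simp
    then show ?thesis using prod0[OF wc(1)[of 9]] True by (simp only:)
  next
    case False
    then have r0: "r > 0" using r by simp
    have "((\<lambda>x. I 9 x / x ^ 9) has_real_derivative F r - 9 * wint (\<lambda>\<sigma>. \<sigma> ^ 9) F r) (at r within {0..1})"
      using r0 r by (auto intro!: derivative_eq_intros I simp: m) (simp add: field_simps eval_nat_numeral)
    moreover have "I 9 x / x ^ 9 = x * wint (\<lambda>\<sigma>. \<sigma> ^ 9) F x" if "0 < x" "x \<le> 1" for x
      using that by (simp add: m field_simps flip: power_Suc power_add)
    ultimately show ?thesis
      by (elim has_field_derivative_transform_within[of _ _ _ _ r])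
         (use r0 r in \<open>auto simp: dist_real_def\<close>)
  qed
qed

lemma integral_equation_imp_ivp:
  fixes a v :: "real \<Rightarrow> real"
  assumes a: "continuous_on {0..1} a" and v: "continuous_on {0..1} v"
    and eq: "\<And>r. r \<in> {0..1} \<Longrightarrow> v r = \<beta> - green (\<lambda>s. a s * exp (v s)) r"
  shows "solves_radial_ivp 10 a \<beta> v"
proof -
  define F where "F = (\<lambda>s. a s * exp (v s))"
  have F: "continuous_on {0..1} F" unfolding F_def by (intro continuous_intros a v)
  define M where "M = wint (\<lambda>\<sigma>. \<sigma> ^ 9) F"
  have M: "continuous_on {0..1} M" unfolding M_def by (intro wint_cont F continuous_intros)
  show ?thesis unfolding solves_radial_ivp_def
  proof (rule exI[of _ "\<lambda>r. - (r * M r)"], rule exI[of _ "\<lambda>r. - (F r - 9 * M r)"], intro conjI ballI)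
    fix r :: real assume r: "r \<in> {0..1}"
    have "((\<lambda>r. \<beta> - green F r) has_real_derivative - (r * M r)) (at r within {0..1})"
      using green_deriv(1)[OF F r] unfolding M_def by (auto intro!: derivative_eq_intros)
    then show "(v has_real_derivative - (r * M r)) (at r within {0..1})"
      by (rule has_field_derivative_transform_within[of _ _ _ _ 1]) (use r eq in \<open>auto simp: F_def\<close>)
    show "((\<lambda>r. - (r * M r)) has_real_derivative - (F r - 9 * M r)) (at r within {0..1})"
      unfolding M_def by (rule DERIV_minus[OF green_deriv(2)[OF F r]])
  next
    show "continuous_on {0..1} (\<lambda>r. - (F r - 9 * M r))" by (intro continuous_intros F M)
    show "v 0 = \<beta>" using eq[of 0] by (simp add: green_def)
  qed (auto simp: F_def)
qed

lemma exp_diff_le: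
  fixes x y b :: real
  assumes "x \<le> b" "y \<le> b" shows "\<bar>exp x - exp y\<bar> \<le> exp b * \<bar>x - y\<bar>"
proof -
  have *: "exp v - exp u \<le> exp b * (v - u)" if "u \<le> v" "v \<le> b" for u v
  proof -
    have "1 + (u - v) \<le> exp (u - v)" by (rule exp_ge_add_one_self)
    then have "exp v * (1 + (u - v)) \<le> exp v * exp (u - v)" by (intro mult_left_mono) auto
    then have "exp v - exp u \<le> exp v * (v - u)" by (simp add: exp_diff algebra_simps)
    also have "\<dots> \<le> exp b * (v - u)" using that by (intro mult_right_mono) auto
    finally show ?thesis .
  qed
  show ?thesis using *[of x y] *[of y x] assms by (cases "x \<le> y") auto
qed

text \<open>The exponential is cut off at \<beta>, which makes it Lipschitz. As \<open>green\<close>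
  preserves nonnegativity, the fixed point stays below \<beta>, the cutoff is inactive and the
  original equation holds.\<close>

lemma integral_equation_exists:
  fixes a :: "real \<Rightarrow> real"
  assumes a: "continuous_on {0..1} a" "\<And>r. r \<in> {0..1} \<Longrightarrow> a r \<ge> 0"
  obtains v where "continuous_on {0..1} v" "\<And>r. r \<in> {0..1} \<Longrightarrow> v r = \<beta> - green (\<lambda>s. a s * exp (v s)) r"
proof -
  obtain M where M: "M > 0" "\<And>r. r \<in> {0..1} \<Longrightarrow> a r \<le> M"
  proof -
    have "bounded (a ` {0..1})" by (intro compact_imp_bounded compact_continuous_image a) auto
    then obtain B where "\<forall>r\<in>{0..1}. norm (a r) \<le> B" unfolding bounded_iff by auto
    then show ?thesis by (intro that[of "max B 1"]) (force simp: le_max_iff_disj abs_le_iff)+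
  qed
  define \<kappa> where "\<kappa> = 2 * M * exp \<beta>"
  have \<kappa>: "\<kappa> > 0" using M by (simp add: \<kappa>_def)
  define T where "T u r = \<beta> - green (\<lambda>s. a s * exp (min (u s) \<beta>)) r" for u r
  have Fc: "continuous_on {0..1} (\<lambda>s. a s * exp (min (u s) \<beta>))" if "continuous_on {0..1} u" for u
    by (intro continuous_intros a that)
  have comp: "compact {0..1::real}" by simp
  have "continuous_on {0..1} (T (\<lambda>_. 0))" unfolding T_def by (intro continuous_intros green_cont Fc)
  then have "bounded (T (\<lambda>_. 0) ` {0..1})" by (intro compact_imp_bounded compact_continuous_image) auto
  then obtain B where "\<forall>x\<in>T (\<lambda>_. 0) ` {0..1}. norm x \<le> B" unfolding bounded_iff by blast
  then have B: "\<And>r. r \<in> {0..1} \<Longrightarrow> norm (T (\<lambda>_. 0) r) \<le> B" by blast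
  obtain u where u: "u \<in> {u. continuous_on {0..1} u}" "\<And>x. x \<in> {0..1} \<Longrightarrow> T u x = u x"
  proof (rule weighted_fixpoint[of "\<lambda>_. 0" "{u. continuous_on {0..1} u}" T "{0..1}" "\<lambda>r. exp (\<kappa> * r)" "max B 0"])
    fix u :: "real \<Rightarrow> real" assume "u \<in> {u. continuous_on {0..1} u}"
    then show "T u \<in> {u. continuous_on {0..1} u}" unfolding T_def
      by (auto intro!: continuous_intros green_cont)
         (intro continuous_intros a)
  next
    fix u w :: "real \<Rightarrow> real" and c x :: real
    assume u: "u \<in> {u. continuous_on {0..1} u}" and w: "w \<in> {u. continuous_on {0..1} u}"
      and le: "\<And>y. y \<in> {0..1} \<Longrightarrow> norm (u y - w y) \<le> c * exp (\<kappa> * y)" and x: "x \<in> {0..1}"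
    have "T u x - T w x = green (\<lambda>s. a s * exp (min (w s) \<beta>) - a s * exp (min (u s) \<beta>)) x"
      unfolding T_def using u w x by (subst green_diff) (auto intro!: Fc)
    also have "norm \<dots> \<le> (M * exp \<beta> * c) * exp (\<kappa> * x) / \<kappa>"
    proof (rule norm_green_le[OF _ x \<kappa>])
      show "continuous_on {0..1} (\<lambda>s. a s * exp (min (w s) \<beta>) - a s * exp (min (u s) \<beta>))"
        using u w by (auto intro!: continuous_on_diff Fc)
      fix s :: real assume s: "s \<in> {0..1}"
      have "norm (a s * exp (min (w s) \<beta>) - a s * exp (min (u s) \<beta>)) = a s * \<bar>exp (min (w s) \<beta>) - exp (min (u s) \<beta>)\<bar>"
        using a(2)[OF s] by (simp add: abs_mult flip: right_diff_distrib)
      also have "\<dots> \<le> M * (exp \<beta> * \<bar>min (w s) \<beta> - min (u s) \<beta>\<bar>)"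
        using M(1) M(2)[OF s] a(2)[OF s] by (intro mult_mono exp_diff_le) auto
      also have "\<dots> \<le> M * (exp \<beta> * (c * exp (\<kappa> * s)))"
        using le[OF s] M(1) by (intro mult_left_mono) auto
      finally show "norm (a s * exp (min (w s) \<beta>) - a s * exp (min (u s) \<beta>)) \<le> M * exp \<beta> * c * exp (\<kappa> * s)"
        by (simp add: mult.assoc)
    qed
    also have "\<dots> = c / 2 * exp (\<kappa> * x)" using M(1) by (simp add: \<kappa>_def)
    finally show "norm (T u x - T w x) \<le> c / 2 * exp (\<kappa> * x)" .
  next
    fix x :: real assume x: "x \<in> {0..1}"
    have "norm (T (\<lambda>_. 0) x - 0) \<le> max B 0 * 1" using B[OF x] by auto
    also have "\<dots> \<le> max B 0 * exp (\<kappa> * x)" using \<kappa> x by (intro mult_left_mono) auto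
    finally show "norm (T (\<lambda>_. 0) x - 0) \<le> max B 0 * exp (\<kappa> * x)" .
  next
    fix U :: "nat \<Rightarrow> real \<Rightarrow> real" and u
    assume U: "\<And>n. U n \<in> {u. continuous_on {0..1} u}"
      and le: "\<And>n x. x \<in> {0..1} \<Longrightarrow> norm (U n x - u x) \<le> 2 * max B 0 * (1/2) ^ n * exp (\<kappa> * x)"
    have "uniform_limit {0..1} U u sequentially"
      by (rule geometric_uniform_limit[where B = "exp \<kappa>", OF le]) (use \<kappa> in auto)
    then show "u \<in> {u. continuous_on {0..1} u}"
      using U uniform_limit_theorem[of "{0..1}" U sequentially u] by simp
  qed (auto)
  have "u r \<le> \<beta>" if r: "r \<in> {0..1}" for r
  proof -
    have "green (\<lambda>s. a s * exp (min (u s) \<beta>)) r \<ge> 0"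
      using u(1) a(2) r by (intro green_nonneg Fc) auto
    then show ?thesis using u(2)[OF r] by (simp add: T_def)
  qed
  then have m: "min (u s) \<beta> = u s" if "s \<in> {0..1}" for s using that by (simp add: min_def)
  have "u r = \<beta> - green (\<lambda>s. a s * exp (u s)) r" if r: "r \<in> {0..1}" for r
  proof -
    have "wint w (\<lambda>s. a s * exp (min (u s) \<beta>)) r = wint w (\<lambda>s. a s * exp (u s)) r" for w
      unfolding wint_def using r by (intro integral_cong) (simp add: m mult_le_one)
    then show ?thesis using u(2)[OF r] by (simp add: T_def green_def)
  qed
  then show ?thesis using that u(1) by blast
qed

lemma radial_ivp_exists:
  assumes "continuous_on {0..1} a" "\<And>r. r \<in> {0..1} \<Longrightarrow> a r \<ge> 0"
  shows "\<exists>v. solves_radial_ivp 10 a \<beta> v"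
  using integral_equation_exists[OF assms] integral_equation_imp_ivp[OF assms(1)] by metis

lemma radial_sol_solves:
  assumes "continuous_on {0..1} a" "\<And>r. r \<in> {0..1} \<Longrightarrow> a r \<ge> 0"
  shows "solves_radial_ivp 10 a \<beta> (radial_sol 10 a \<beta>)"
  unfolding radial_sol_def by (rule someI_ex[OF radial_ivp_exists[OF assms]])

section \<open>Upper bound, Lipschitz dependence and uniqueness for the initial value
  problem\<close>

lemma real_derivative_at_interior:
  assumes "\<And>r. r \<in> {0..1} \<Longrightarrow> (f has_real_derivative f' r) (at r within {0..1})" "0 < r" "r < (1::real)"
  shows "(f has_real_derivative f' r) (at r)"
  using assms(1)[of r] assms(2,3) at_within_interior[of r "{0..1}"] by simp

lemma solves_radial_ivpE:
  assumes "solves_radial_ivp 10 a \<beta> v"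
  obtains v1 v2 where
    "\<And>r. r\<in>{0..1} \<Longrightarrow> (v has_real_derivative v1 r) (at r within {0..1})"
    "\<And>r. r\<in>{0..1} \<Longrightarrow> (v1 has_real_derivative v2 r) (at r within {0..1})"
    "\<And>r. r\<in>{0<..1} \<Longrightarrow> - (v2 r + 9 / r * v1 r) = a r * exp (v r)" "v 0 = \<beta>" "v1 0 = 0"
proof -
  obtain v1 v2 where *: "\<forall>r\<in>{0..1}. (v has_real_derivative v1 r) (at r within {0..1}) \<and>
        (v1 has_real_derivative v2 r) (at r within {0..1})"
      "\<forall>r\<in>{0<..1}. - (v2 r + (real 10 - 1) / r * v1 r) = a r * exp (v r)" "v 0 = \<beta>" "v1 0 = 0"
    using assms unfolding solves_radial_ivp_def by blast
  show ?thesis by (rule that[of v1 v2]) (use * in auto)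
qed

text \<open>\<open>r^9 v'\<close> starts at 0 and is nonincreasing, its derivative being
  \<open>- r^9 a e^v\<close>.\<close>

lemma radial_ivp_le:
  assumes a: "\<And>r. r \<in> {0..1} \<Longrightarrow> a r \<ge> 0" and v: "solves_radial_ivp 10 a \<beta> v" and r: "r \<in> {0..1}"
  shows "v r \<le> \<beta>"
proof -
  obtain v1 v2 where
    d: "\<And>r. r\<in>{0..1} \<Longrightarrow> (v has_real_derivative v1 r) (at r within {0..1})"
       "\<And>r. r\<in>{0..1} \<Longrightarrow> (v1 has_real_derivative v2 r) (at r within {0..1})"
    and eq: "\<And>r. r\<in>{0<..1} \<Longrightarrow> - (v2 r + 9 / r * v1 r) = a r * exp (v r)" and i: "v 0 = \<beta>" "v1 0 = 0"
    using v by (rule solves_radial_ivpE) (rule that)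
  have c: "continuous_on {0..x} v" "continuous_on {0..x} v1" if "x \<le> 1" for x
    using that by (auto intro!: continuous_on_subset[OF DERIV_continuous_on[OF d(1)]] continuous_on_subset[OF DERIV_continuous_on[OF d(2)]])
  have "v1 x \<le> 0" if x: "0 < x" "x \<le> 1" for x
  proof -
    have "x ^ 9 * v1 x \<le> 0 ^ 9 * v1 0"
    proof (rule DERIV_nonpos_imp_decreasing_open[of 0 x "\<lambda>x. x ^ 9 * v1 x"])
      fix y assume y: "0 < y" "y < x"
      have "((\<lambda>x. x ^ 9 * v1 x) has_real_derivative - (y ^ 9 * (a y * exp (v y)))) (at y)"
        using y x eq[of y, symmetric] by (auto intro!: derivative_eq_intros real_derivative_at_interior[OF d(2)]) (simp add: field_simps eval_nat_numeral)
      then show "\<exists>z. ((\<lambda>x. x ^ 9 * v1 x) has_real_derivative z) (at y) \<and> z \<le> 0"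
        using a[of y] y x by (intro exI conjI) auto
    qed (use x c in \<open>auto intro!: continuous_intros\<close>)
    then show ?thesis using x by (simp add: mult_le_0_iff)
  qed
  then have "v r \<le> v 0"
    using r by (intro DERIV_nonpos_imp_decreasing_open[of 0 r v] c)
      (auto intro!: exI conjI real_derivative_at_interior[OF d(1)])
  then show ?thesis by (simp add: i)
qed

text \<open>The singular coefficient \<open>9 / r\<close> acts as damping: it contributes
  \<open>- 18 / r * (d1)^2\<close> to the derivative of the energy and is dropped. The rest is
  Gronwall with the Lipschitz constant of \<open>exp\<close> below \<open>B\<close>. The case
  \<beta> = \<gamma> is uniqueness; the general case later makes a deformation of solutions
  continuous.\<close>

lemma radial_ivp_diff_le:
  assumes a: "\<And>r. r \<in> {0..1} \<Longrightarrow> a r \<ge> 0" "\<And>r. r \<in> {0..1} \<Longrightarrow> a r \<le> M"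
    and v: "solves_radial_ivp 10 a \<beta> v" and w: "solves_radial_ivp 10 a \<gamma> w"
    and B: "\<beta> \<le> B" "\<gamma> \<le> B" and r: "r \<in> {0..1}"
  shows "\<bar>v r - w r\<bar> \<le> \<bar>\<beta> - \<gamma>\<bar> * exp ((1 + M * exp B) / 2)"
proof -
  note v0 = v and w0 = w
  obtain v1 v2 where
    v: "\<And>r. r\<in>{0..1} \<Longrightarrow> (v has_real_derivative v1 r) (at r within {0..1})"
       "\<And>r. r\<in>{0..1} \<Longrightarrow> (v1 has_real_derivative v2 r) (at r within {0..1})"
    and veq: "\<And>r. r\<in>{0<..1} \<Longrightarrow> - (v2 r + 9 / r * v1 r) = a r * exp (v r)" "v 0 = \<beta>" "v1 0 = 0"
    using v by (rule solves_radial_ivpE) (rule that)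
  have vle: "v r \<le> B" if "r \<in> {0..1}" for r using radial_ivp_le[OF a(1) v0 that] B by simp
  obtain w1 w2 where
    w: "\<And>r. r\<in>{0..1} \<Longrightarrow> (w has_real_derivative w1 r) (at r within {0..1})"
       "\<And>r. r\<in>{0..1} \<Longrightarrow> (w1 has_real_derivative w2 r) (at r within {0..1})"
    and weq: "\<And>r. r\<in>{0<..1} \<Longrightarrow> - (w2 r + 9 / r * w1 r) = a r * exp (w r)" "w 0 = \<gamma>" "w1 0 = 0"
    using w by (rule solves_radial_ivpE) (rule that)
  have wle: "w r \<le> B" if "r \<in> {0..1}" for r using radial_ivp_le[OF a(1) w0 that] B by simp
  define k where "k = 1 + M * exp B"
  define d where "d = (\<lambda>r. v r - w r)"
  define d1 where "d1 = (\<lambda>r. v1 r - w1 r)"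
  define E where "E = (\<lambda>r. (d r)\<^sup>2 + (d1 r)\<^sup>2)"
  have M0: "M \<ge> 0" using a[of 0] by simp
  have k: "k \<ge> 0" using M0 by (simp add: k_def)
  have dd: "(d has_real_derivative d1 r) (at r within {0..1})" "(d1 has_real_derivative v2 r - w2 r) (at r within {0..1})" if "r \<in> {0..1}" for r
    unfolding d_def d1_def using that by (auto intro!: derivative_eq_intros v w)
  have c: "continuous_on {0..r} d" "continuous_on {0..r} d1"
    using r by (auto intro!: continuous_on_subset[OF DERIV_continuous_on[OF dd(1)]] continuous_on_subset[OF DERIV_continuous_on[OF dd(2)]])
  have "E r * exp (- k * r) \<le> E 0 * exp (- k * 0)"
  proof (rule DERIV_nonpos_imp_decreasing_open[of 0 r "\<lambda>r. E r * exp (- k * r)"])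
    fix y assume y: "0 < y" "y < r"
    then have y1: "0 < y" "y < 1" "y \<in> {0..1}" "y \<in> {0<..1}" using r by auto
    define e where "e = a y * (exp (v y) - exp (w y))"
    have d2: "v2 y - w2 y = - 9 / y * d1 y - e"
      using veq(1)[OF y1(4)] weq(1)[OF y1(4)] by (simp add: e_def d1_def algebra_simps diff_divide_distrib)
    have "(E has_real_derivative 2 * d y * d1 y + 2 * d1 y * (v2 y - w2 y)) (at y)"
      unfolding E_def
      by (auto intro!: derivative_eq_intros real_derivative_at_interior[OF dd(1)] real_derivative_at_interior[OF dd(2)] y1(1,2))
    then have D: "((\<lambda>r. E r * exp (- k * r)) has_real_derivative
       (2 * d y * d1 y + 2 * d1 y * (v2 y - w2 y) - k * E y) * exp (- k * y)) (at y)"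
      by (auto intro!: derivative_eq_intros simp: algebra_simps)
    have "\<bar>e\<bar> \<le> M * (exp B * \<bar>d y\<bar>)"
      unfolding e_def abs_mult d_def using a[OF y1(3)] M0 by (intro mult_mono exp_diff_le vle wle y1(3)) auto
    then have "2 * \<bar>d1 y\<bar> * (\<bar>d y\<bar> + \<bar>e\<bar>) \<le> 2 * \<bar>d1 y\<bar> * (k * \<bar>d y\<bar>)"
      by (intro mult_left_mono) (auto simp: k_def algebra_simps)
    also have "\<dots> = k * (2 * \<bar>d y\<bar> * \<bar>d1 y\<bar>)" by simp
    also have "\<dots> \<le> k * E y"
      using sum_squares_bound[of "\<bar>d y\<bar>" "\<bar>d1 y\<bar>"] k by (intro mult_left_mono) (auto simp: E_def)
    finally have 1: "2 * \<bar>d1 y\<bar> * (\<bar>d y\<bar> + \<bar>e\<bar>) \<le> k * E y" .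
    have "2 * d y * d1 y + 2 * d1 y * (v2 y - w2 y) = 2 * (d1 y * (d y - e)) - 18 / y * (d1 y)\<^sup>2"
      by (simp add: d2 algebra_simps power2_eq_square)
    also have "\<dots> \<le> 2 * (d1 y * (d y - e))" using y1(1) by simp
    also have "\<dots> \<le> 2 * \<bar>d1 y * (d y - e)\<bar>" by linarith
    also have "\<dots> \<le> 2 * \<bar>d1 y\<bar> * (\<bar>d y\<bar> + \<bar>e\<bar>)"
      unfolding abs_mult mult.assoc by (intro mult_left_mono) auto
    finally have "2 * d y * d1 y + 2 * d1 y * (v2 y - w2 y) - k * E y \<le> 0" using 1 by linarith
    then show "\<exists>z. ((\<lambda>r. E r * exp (- k * r)) has_real_derivative z) (at y) \<and> z \<le> 0"
      using D by (intro exI conjI) (auto simp: mult_le_0_iff)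
  qed (use r c in \<open>auto intro!: continuous_intros simp: E_def\<close>)
  then have "E r \<le> E 0 * exp (k * r)" by (simp add: exp_minus field_simps)
  also have "E 0 = (\<beta> - \<gamma>)\<^sup>2" by (simp add: E_def d_def d1_def veq weq)
  also have "(\<beta> - \<gamma>)\<^sup>2 * exp (k * r) \<le> (\<beta> - \<gamma>)\<^sup>2 * exp k"
    using r k by (intro mult_left_mono) (auto simp: mult_left_le)
  also have "\<dots> = (\<bar>\<beta> - \<gamma>\<bar> * exp (k / 2))\<^sup>2"
    by (simp add: power_mult_distrib power2_eq_square[of "exp _"] flip: exp_add)
  finally have "\<bar>d r\<bar>\<^sup>2 \<le> (\<bar>\<beta> - \<gamma>\<bar> * exp (k / 2))\<^sup>2" by (simp add: E_def) (smt (verit) zero_le_power2)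
  then have "\<bar>d r\<bar> \<le> \<bar>\<beta> - \<gamma>\<bar> * exp (k / 2)" by (rule power2_le_imp_le) auto
  then show ?thesis by (simp add: d_def k_def)
qed

lemma radial_ivp_unique:
  assumes "\<And>r. r \<in> {0..1} \<Longrightarrow> a r \<ge> 0" "continuous_on {0..1} a"
    and "solves_radial_ivp 10 a \<beta> v" "solves_radial_ivp 10 a \<beta> w" "r \<in> {0..1}"
  shows "v r = w r"
proof -
  have "bounded (a ` {0..1})" by (intro compact_imp_bounded compact_continuous_image assms) auto
  then obtain M where "\<forall>x\<in>a ` {0..1}. norm x \<le> M" unfolding bounded_iff by blast
  then have M: "a r \<le> M" if "r \<in> {0..1}" for r using that by force
  show ?thesis
    using radial_ivp_diff_le[OF assms(1) M assms(3,4) order.refl order.refl assms(5)] by simp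
qed

section \<open>Holomorphic dependence on the initial value\<close>

lemma holomorphic_on_integral:
  fixes f :: "complex \<Rightarrow> real \<Rightarrow> complex"
  assumes U: "open U" and c: "continuous_on (U \<times> {0..1}) (\<lambda>(z, s). f z s)"
    and h: "\<And>s. s \<in> {0..1} \<Longrightarrow> (\<lambda>z. f z s) holomorphic_on U"
  shows "(\<lambda>z. integral {0..1} (f z)) holomorphic_on U"
proof -
  \<comment> \<open>Riemann sums are finite combinations of the holomorphic slices and converge
    locally uniformly, by uniform continuity on \<open>cball x d \<times> {0..1}\<close>;
    \<open>Suc n\<close> avoids an empty subdivision.\<close>
  define g where "g n z = (\<Sum>k<Suc n. f z (real k / real (Suc n)) / of_nat (Suc n))" for n z
  have fz: "continuous_on {0..1} (f z)" if "z \<in> U" for z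
  proof -
    have "continuous_on {0..1} (\<lambda>s. (\<lambda>(z, s). f z s) (z, s))"
      by (rule continuous_on_compose2[OF c]) (use that in \<open>auto intro!: continuous_intros\<close>)
    then show ?thesis by simp
  qed
  show ?thesis
  proof (rule holomorphic_uniform_sequence[OF U])
    show "g n holomorphic_on U" for n
      unfolding g_def by (intro holomorphic_intros h) (auto simp: divide_le_eq)
    fix x assume "x \<in> U"
    then obtain d where d: "d > 0" "cball x d \<subseteq> U" using U open_contains_cball by blast
    have "uniformly_continuous_on (cball x d \<times> {0..1}) (\<lambda>(z, s). f z s)"
      by (intro compact_uniformly_continuous continuous_on_subset[OF c] compact_Times) (use d in auto)
    have "uniform_limit (cball x d) g (\<lambda>z. integral {0..1} (f z)) sequentially"
    proof (rule uniform_limitI)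
      fix e :: real assume e: "e > 0"
      then obtain \<delta> where \<delta>: "\<delta> > 0"
        "\<And>z s z' s'. \<lbrakk>(z, s) \<in> cball x d \<times> {0..1}; (z', s') \<in> cball x d \<times> {0..1}; dist (z', s') (z, s) < \<delta>\<rbrakk>
           \<Longrightarrow> dist (f z' s') (f z s) < e / 2"
        using \<open>uniformly_continuous_on _ _\<close> unfolding uniformly_continuous_on_def
        by (metis (mono_tags, lifting) case_prod_conv half_gt_zero)
      obtain N :: nat where N: "1 / \<delta> < real N" using reals_Archimedean2 by blast
      have main: "dist (g n z) (integral {0..1} (f z)) < e" if n: "n \<ge> N" and z: "z \<in> cball x d" for n z
      proof -
        define m where "m = Suc n"
        have m: "real m > 0" "1 / real m < \<delta>"
        proof -
          have "1 / \<delta> < real m" using N n by (simp add: m_def)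
          then show "real m > 0" "1 / real m < \<delta>" using \<delta>(1) by (auto simp: field_simps m_def)
        qed
        have zU: "z \<in> U" using z d by auto
        have int: "f z integrable_on {a..b}" if "0 \<le> a" "b \<le> 1" for a b
          using that by (intro integrable_continuous_interval continuous_on_subset[OF fz[OF zU]]) auto
        have split: "integral {0..real j / real m} (f z) = (\<Sum>k<j. integral {real k / real m..real (Suc k) / real m} (f z))" if "j \<le> m" for j
          using that
        proof (induction j)
          case (Suc j)
          have "integral {0..real j / real m} (f z) + integral {real j / real m..real (Suc j) / real m} (f z) = integral {0..real (Suc j) / real m} (f z)"
            using Suc m by (intro Henstock_Kurzweil_Integration.integral_combine int) (auto simp: divide_right_mono divide_le_eq)
          then show ?case using Suc by simp
        qed simp
        have piece: "norm (f z (real k / real m) / of_nat m - integral {real k / real m..real (Suc k) / real m} (f z)) \<le> e / 2 * (1 / real m)" if k: "k < m" for k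
        proof -
          let ?a = "real k / real m" and ?b = "real (Suc k) / real m"
          have ab: "0 \<le> ?a" "?a \<le> ?b" "?b \<le> 1" "?b - ?a = 1 / real m"
            using m k by (auto simp: field_simps)
          have "norm (integral {?a..?b} (\<lambda>s. f z s - f z ?a)) \<le> e / 2 * (?b - ?a)"
          proof (rule integral_bound)
            show "continuous_on {?a..?b} (\<lambda>s. f z s - f z ?a)"
              using ab by (intro continuous_intros continuous_on_subset[OF fz[OF zU]]) auto
            fix s assume s: "s \<in> {?a..?b}"
            have "dist (f z s) (f z ?a) < e / 2"
            proof (rule \<delta>(2))
              have "s - ?a \<le> 1 / real m" using s ab by simp
              then show "dist (z, s) (z, ?a) < \<delta>" using s m by (simp add: dist_Pair_Pair dist_real_def)
            next
              have "0 \<le> s" "s \<le> 1" using s ab(1,3) unfolding atLeastAtMost_iff by linarith+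
              then show "(z, s) \<in> cball x d \<times> {0..1}" using z by simp
              show "(z, ?a) \<in> cball x d \<times> {0..1}" using z ab(1,2,3) unfolding mem_Times_iff atLeastAtMost_iff fst_conv snd_conv by linarith
            qed
            then show "norm (f z s - f z ?a) \<le> e / 2" by (simp add: dist_norm)
          qed (use ab in auto)
          also have "integral {?a..?b} (\<lambda>s. f z s - f z ?a) = integral {?a..?b} (f z) - f z ?a / of_nat m"
            using ab by (subst integral_diff) (auto intro!: int simp: scaleR_conv_of_real)
          finally show ?thesis using ab(4) by (simp add: norm_minus_commute)
        qed
        have "integral {0..1} (f z) = (\<Sum>k<m. integral {real k / real m..real (Suc k) / real m} (f z))"
          using split[of m] m by simp
        then have "dist (g n z) (integral {0..1} (f z)) = norm (\<Sum>k<m. f z (real k / real m) / of_nat m - integral {real k / real m..real (Suc k) / real m} (f z))"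
          by (simp add: dist_norm g_def m_def sum_subtractf del: of_nat_Suc sum.lessThan_Suc)
        also have "\<dots> \<le> (\<Sum>k<m. e / 2 * (1 / real m))"
          by (intro sum_norm_le piece) auto
        also have "\<dots> = e / 2" using m by simp
        finally show ?thesis using e by simp
      qed
      show "\<forall>\<^sub>F n in sequentially. \<forall>z\<in>cball x d. dist (g n z) (integral {0..1} (f z)) < e"
        using eventually_ge_at_top[of N] by eventually_elim (use main in blast)
    qed
    then show "\<exists>d>0. cball x d \<subseteq> U \<and> uniform_limit (cball x d) g (\<lambda>z. integral {0..1} (f z)) sequentially"
      using d by blast
  qed
qed

lemma green_holomorphic:
  fixes f :: "complex \<Rightarrow> real \<Rightarrow> complex"
  assumes "open U" and c: "continuous_on (U \<times> {0..1}) (\<lambda>(z, s). f z s)"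
    and h: "\<And>s. s \<in> {0..1} \<Longrightarrow> (\<lambda>z. f z s) holomorphic_on U"
    and r: "r \<in> {0..1}"
  shows "(\<lambda>z. green (f z) r) holomorphic_on U"
proof -
  have "(\<lambda>z. integral {0..1} (\<lambda>\<sigma>. (\<sigma> - \<sigma> ^ 9) *\<^sub>R f z (r * \<sigma>))) holomorphic_on U"
  proof (rule holomorphic_on_integral[OF assms(1)])
    have "continuous_on (U \<times> {0..1}) (\<lambda>p. (\<lambda>(z, s). f z s) (fst p, r * snd p))"
      by (rule continuous_on_compose2[OF c]) (use r in \<open>auto intro!: continuous_intros mult_le_one\<close>)
    then show "continuous_on (U \<times> {0..1}) (\<lambda>(z, \<sigma>). (\<sigma> - \<sigma> ^ 9) *\<^sub>R f z (r * \<sigma>))"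
      unfolding split_beta by (auto intro!: continuous_intros)
    show "(\<lambda>z. (s - s ^ 9) *\<^sub>R f z (r * s)) holomorphic_on U" if "s \<in> {0..1}" for s
      unfolding scaleR_conv_of_real using that r by (intro holomorphic_intros h) (auto intro: mult_le_one)
  qed
  then show ?thesis unfolding green_def wint_def scaleR_conv_of_real by (intro holomorphic_intros)
qed

lemma norm_exp_diff_le:
  fixes u w :: complex
  assumes "norm u \<le> 1" "norm w \<le> 1"
  shows "norm (exp u - exp w) \<le> exp 1 * norm (u - w)"
proof (rule field_differentiable_bound[of "cball 0 1" exp exp "exp 1"])
  show "norm (exp z) \<le> exp 1" if "z \<in> cball 0 1" for z :: complex
    using that norm_exp[of z] order_trans by fastforce
qed (use assms in \<open>auto intro!: derivative_eq_intros\<close>)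

lemma green_of_real:
  assumes "continuous_on {0..1} F" "r \<in> {0..1}"
  shows "green (\<lambda>s. complex_of_real (F s)) r = of_real (green F r)"
proof -
  have "((\<lambda>\<sigma>. (\<sigma> - \<sigma> ^ 9) *\<^sub>R F (r * \<sigma>)) has_integral wint (\<lambda>\<sigma>. \<sigma> - \<sigma> ^ 9) F r) {0..1}"
    unfolding wint_def by (intro integrable_integral wint_integrable assms continuous_intros)
  from has_integral_linear[OF this bounded_linear_of_real]
  have "((\<lambda>\<sigma>. (\<sigma> - \<sigma> ^ 9) *\<^sub>R complex_of_real (F (r * \<sigma>))) has_integral of_real (wint (\<lambda>\<sigma>. \<sigma> - \<sigma> ^ 9) F r)) {0..1}"
    by (simp add: o_def scaleR_conv_of_real)
  then show ?thesis unfolding green_def wint_def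
    by (simp add: integral_unique scaleR_conv_of_real)
qed

text \<open>Picard iteration for \<open>v(\<cdot>, \<beta> + z) - v(\<cdot>, \<beta>)\<close> with complex \<open>z\<close> near 0.\<close>

lemma radial_sol_analytic:
  fixes a :: "real \<Rightarrow> real"
  assumes a: "continuous_on {0..1} a" "\<And>r. r \<in> {0..1} \<Longrightarrow> a r \<ge> 0"
  obtains \<rho> F where "\<rho> > 0" "F holomorphic_on ball 0 \<rho>"
    "\<And>x. \<bar>x\<bar> < \<rho> \<Longrightarrow> F (of_real x) = of_real (radial_sol 10 a (\<beta> + x) 1)"
proof -
  obtain v where v: "continuous_on {0..1} v" "\<And>r. r \<in> {0..1} \<Longrightarrow> v r = \<beta> - green (\<lambda>s. a s * exp (v s)) r"
    by (rule integral_equation_exists[OF a, of \<beta>]) (assumption | rule that)+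
  define g where "g = (\<lambda>s. a s * exp (v s))"
  have g: "continuous_on {0..1} g" unfolding g_def by (intro continuous_intros a v)
  obtain M where M: "M > 0" "\<And>r. r \<in> {0..1} \<Longrightarrow> \<bar>g r\<bar> \<le> M"
  proof -
    have "bounded (g ` {0..1})" by (intro compact_imp_bounded compact_continuous_image g) auto
    then obtain B where "\<forall>r\<in>{0..1}. norm (g r) \<le> B" unfolding bounded_iff by auto
    then show ?thesis by (intro that[of "max B 1"]) (force simp: le_max_iff_disj)+
  qed
  define \<kappa> where "\<kappa> = 2 * M * exp 1"
  have \<kappa>: "\<kappa> > 0" using M by (simp add: \<kappa>_def)
  \<comment> \<open>With \<open>2 * \<rho> * exp \<kappa> = 1\<close> the iterates stay in the
    closed unit disc, where \<open>exp\<close> has Lipschitz constant \<open>exp 1\<close>. This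
    replaces the cutoff of the real case, which is not holomorphic.\<close>
  define \<rho> where "\<rho> = 1 / (2 * exp \<kappa>)"
  have \<rho>: "\<rho> > 0" "2 * \<rho> * exp \<kappa> = 1" by (simp_all add: \<rho>_def)
  define S where "S = ball (0::complex) \<rho> \<times> {0..1::real}"
  define \<omega> where "\<omega> = (\<lambda>p::complex \<times> real. exp (\<kappa> * snd p))"
  \<comment> \<open>Subtracting the equation of \<open>v\<close> from that of \<open>v + u\<close>
    leaves \<open>exp u - 1\<close> against \<open>g = a e^v\<close>, and the shift of the initial
    value becomes the constant \<open>fst p\<close>.\<close>
  define T where "T = (\<lambda>u (p::complex \<times> real). fst p - green (\<lambda>s. of_real (g s) * (exp (u (fst p, s)) - 1)) (snd p))"
  \<comment> \<open>Reality on real parameters is carried along, so that for real z the limit can be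
    identified with the actual solution by uniqueness.\<close>
  define \<F> where "\<F> = {u :: complex \<times> real \<Rightarrow> complex. continuous_on S u \<and> (\<forall>r\<in>{0..1}. (\<lambda>z. u (z, r)) holomorphic_on ball 0 \<rho>) \<and>
     (\<forall>p\<in>S. norm (u p) \<le> 2 * \<rho> * \<omega> p) \<and> (\<forall>p\<in>S. fst p \<in> \<real> \<longrightarrow> u p \<in> \<real>)}"
  have small: "norm (u p) \<le> 1" if "u \<in> \<F>" "p \<in> S" for u p
  proof -
    have "norm (u p) \<le> 2 * \<rho> * \<omega> p" using that by (auto simp: \<F>_def)
    also have "\<dots> \<le> 2 * \<rho> * exp \<kappa>" using that \<kappa> \<rho> by (intro mult_left_mono) (auto simp: S_def \<omega>_def)
    finally show ?thesis using \<rho> by simp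
  qed
  have Fc: "continuous_on S (\<lambda>(z, s). of_real (g s) * (exp (u (z, s)) - 1))" if "u \<in> \<F>" for u
  proof -
    have "continuous_on S u" using that by (simp add: \<F>_def)
    then show ?thesis unfolding split_beta prod.collapse
      by (intro continuous_intros continuous_on_compose2[OF g]) (auto simp: S_def)
  qed
  have Fcz: "continuous_on {0..1} (\<lambda>s. of_real (g s) * (exp (u (z, s)) - 1))" if "u \<in> \<F>" "z \<in> ball 0 \<rho>" for u z
  proof -
    have "continuous_on {0..1} (\<lambda>s. (\<lambda>(z, s). of_real (g s) * (exp (u (z, s)) - 1)) (z, s))"
      by (rule continuous_on_compose2[OF Fc[OF that(1)]]) (use that in \<open>auto intro!: continuous_intros simp: S_def\<close>)
    then show ?thesis by simp
  qed
  have real_form: "\<exists>ur. continuous_on {0..1} ur \<and> (\<forall>s\<in>{0..1}. u (of_real x, s) = of_real (ur s)) \<and>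
      (\<forall>r\<in>{0..1}. green (\<lambda>s. of_real (g s) * (exp (u (of_real x, s)) - 1)) r = of_real (green (\<lambda>s. g s * (exp (ur s) - 1)) r))"
    if u: "u \<in> \<F>" and x: "of_real x \<in> ball (0::complex) \<rho>" for u x
  proof (intro exI conjI ballI)
    define ur where "ur = (\<lambda>s. Re (u (of_real x, s)))"
    have "continuous_on {0..1} (\<lambda>s. u (of_real x, s))"
      by (rule continuous_on_compose2[of S u]) (use u x in \<open>auto intro!: continuous_intros simp: S_def \<F>_def\<close>)
    then show ur: "continuous_on {0..1} ur" unfolding ur_def by (intro continuous_intros)
    show eq: "u (of_real x, s) = of_real (ur s)" if "s \<in> {0..1}" for s
    proof -
      have "u (of_real x, s) \<in> \<real>" using u x that by (auto simp: \<F>_def S_def)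
      then show ?thesis by (simp add: ur_def)
    qed
    show "green (\<lambda>s. of_real (g s) * (exp (u (of_real x, s)) - 1)) r = of_real (green (\<lambda>s. g s * (exp (ur s) - 1)) r)"
      if r: "r \<in> {0..1}" for r
    proof -
      have "green (\<lambda>s. of_real (g s) * (exp (u (of_real x, s)) - 1)) r = green (\<lambda>s. complex_of_real (g s * (exp (ur s) - 1))) r"
        unfolding green_def wint_def using r
        by (intro arg_cong2[of _ _ _ _ scaleR] integral_cong refl) (simp add: eq mult_le_one flip: exp_of_real)
      also have "\<dots> = of_real (green (\<lambda>s. g s * (exp (ur s) - 1)) r)"
        by (intro green_of_real continuous_intros g ur r)
      finally show ?thesis .
    qed
  qed
  obtain u where u: "u \<in> \<F>" "\<And>p. p \<in> S \<Longrightarrow> T u p = u p"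
  proof (rule weighted_fixpoint[of "\<lambda>_. 0" \<F> T S \<omega> \<rho>])
    show "(\<lambda>_. 0) \<in> \<F>" using \<rho> by (auto simp: \<F>_def \<omega>_def)
  next
    fix u assume u: "u \<in> \<F>"
    have "continuous_on {0..1} (\<lambda>\<sigma>::real. \<sigma> - \<sigma> ^ 9)" by (intro continuous_intros)
    from wint_param_cont[OF this Fc[OF u, unfolded S_def]]
    have gc: "continuous_on S (\<lambda>(z, r). green (\<lambda>s. of_real (g s) * (exp (u (z, s)) - 1)) r)"
      unfolding green_def split_beta S_def by (intro continuous_intros) auto
    have 1: "continuous_on S (T u)" unfolding T_def using gc by (auto intro!: continuous_intros simp: split_beta)
    have 2: "(\<lambda>z. T u (z, r)) holomorphic_on ball 0 \<rho>" if r: "r \<in> {0..1}" for r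
    proof -
      have "(\<lambda>z. green (\<lambda>s. of_real (g s) * (exp (u (z, s)) - 1)) r) holomorphic_on ball 0 \<rho>"
      proof (rule green_holomorphic[OF _ _ _ r])
      show "continuous_on (ball 0 \<rho> \<times> {0..1}) (\<lambda>(z, s). of_real (g s) * (exp (u (z, s)) - 1))"
        using Fc[OF u] by (simp add: S_def)
      show "(\<lambda>z. of_real (g s) * (exp (u (z, s)) - 1)) holomorphic_on ball 0 \<rho>" if "s \<in> {0..1}" for s
        using u that by (intro holomorphic_intros) (auto simp: \<F>_def)
      qed auto
      then show ?thesis unfolding T_def fst_conv snd_conv by (intro holomorphic_intros)
    qed
    have 3: "norm (T u p) \<le> 2 * \<rho> * \<omega> p" if p: "p \<in> S" for p
    proof -
      obtain z r where zr: "p = (z, r)" "z \<in> ball 0 \<rho>" "r \<in> {0..1}" using p by (auto simp: S_def)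
      have "norm (green (\<lambda>s. of_real (g s) * (exp (u (z, s)) - 1)) r) \<le> (M * (exp 1 * (2 * \<rho>))) * exp (\<kappa> * r) / \<kappa>"
      proof (rule norm_green_le[OF Fcz[OF u zr(2)] zr(3) \<kappa>])
        fix s :: real assume s: "s \<in> {0..1}"
        have zs: "(z, s) \<in> S" using zr s by (auto simp: S_def)
        have "norm (of_real (g s) * (exp (u (z, s)) - exp 0)) \<le> M * (exp 1 * norm (u (z, s) - 0))"
          unfolding norm_mult using M s by (intro mult_mono norm_exp_diff_le small[OF u zs]) auto
        also have "\<dots> \<le> M * (exp 1 * (2 * \<rho> * exp (\<kappa> * s)))"
          using M(1) u zs by (intro mult_left_mono) (auto simp: \<F>_def \<omega>_def)
        finally show "norm (of_real (g s) * (exp (u (z, s)) - 1)) \<le> (M * (exp 1 * (2 * \<rho>))) * exp (\<kappa> * s)"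
          by (simp add: mult.assoc)
      qed
      also have "\<dots> = \<rho> * exp (\<kappa> * r)" using M(1) by (simp add: \<kappa>_def)
      finally have "norm (T u p) \<le> norm z + \<rho> * exp (\<kappa> * r)"
        unfolding T_def zr by (intro order_trans[OF norm_triangle_ineq4]) auto
      moreover have "norm z \<le> \<rho> * exp (\<kappa> * r)"
      proof -
        have "norm z \<le> \<rho> * 1" using zr by simp
        also have "\<dots> \<le> \<rho> * exp (\<kappa> * r)" using \<rho>(1) \<kappa> zr by (intro mult_left_mono) auto
        finally show ?thesis .
      qed
      ultimately show ?thesis by (simp add: \<omega>_def zr)
    qed
    have 4: "T u p \<in> \<real>" if p: "p \<in> S" "fst p \<in> \<real>" for p
    proof -
      obtain x r where xr: "p = (of_real x, r)" "of_real x \<in> ball (0::complex) \<rho>" "r \<in> {0..1}"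
        using p by (auto simp: S_def elim!: Reals_cases)
      show ?thesis using real_form[OF u xr(2)] xr(3) unfolding T_def xr(1) by (auto intro!: Reals_diff)
    qed
    show "T u \<in> \<F>" using 1 2 3 4 by (simp add: \<F>_def)
  next
    fix u w :: "complex \<times> real \<Rightarrow> complex" and c :: real and p
    assume u: "u \<in> \<F>" and w: "w \<in> \<F>"
      and le: "\<And>y. y \<in> S \<Longrightarrow> norm (u y - w y) \<le> c * \<omega> y" and p: "p \<in> S"
    obtain z r where zr: "p = (z, r)" "z \<in> ball 0 \<rho>" "r \<in> {0..1}" using p by (auto simp: S_def)
    have "T u p - T w p = green (\<lambda>s. of_real (g s) * (exp (w (z, s)) - 1) - of_real (g s) * (exp (u (z, s)) - 1)) r"
      unfolding T_def zr fst_conv snd_conv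
      by (simp add: green_diff[OF Fcz[OF w zr(2)] Fcz[OF u zr(2)] zr(3)])
    also have "norm \<dots> \<le> (M * (exp 1 * c)) * exp (\<kappa> * r) / \<kappa>"
    proof (rule norm_green_le[OF _ zr(3) \<kappa>])
      show "continuous_on {0..1} (\<lambda>s. of_real (g s) * (exp (w (z, s)) - 1) - of_real (g s) * (exp (u (z, s)) - 1))"
        by (intro continuous_on_diff Fcz u w zr)
      fix s :: real assume s: "s \<in> {0..1}"
      have zs: "(z, s) \<in> S" using zr s by (auto simp: S_def)
      have "norm (of_real (g s) * (exp (w (z, s)) - exp (u (z, s)))) \<le> M * (exp 1 * norm (w (z, s) - u (z, s)))"
        unfolding norm_mult using M s by (intro mult_mono norm_exp_diff_le small[OF u zs] small[OF w zs]) auto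
      also have "\<dots> \<le> M * (exp 1 * (c * exp (\<kappa> * s)))"
        using M(1) le[OF zs] by (intro mult_left_mono) (auto simp: \<omega>_def norm_minus_commute)
      finally show "norm (of_real (g s) * (exp (w (z, s)) - 1) - of_real (g s) * (exp (u (z, s)) - 1)) \<le> (M * (exp 1 * c)) * exp (\<kappa> * s)"
        by (simp add: mult.assoc right_diff_distrib)
    qed
    also have "\<dots> = c / 2 * \<omega> p" using M(1) by (simp add: \<kappa>_def \<omega>_def zr)
    finally show "norm (T u p - T w p) \<le> c / 2 * \<omega> p" .
  next
    fix p assume p: "p \<in> S"
    then have "norm (fst p) \<le> \<rho> * 1" by (auto simp: S_def)
    also have "\<dots> \<le> \<rho> * \<omega> p" using \<rho>(1) \<kappa> p by (intro mult_left_mono) (auto simp: \<omega>_def S_def)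
    finally show "norm (T (\<lambda>_. 0) p - 0) \<le> \<rho> * \<omega> p" by (simp add: T_def green_def wint_def)
  next
    fix U :: "nat \<Rightarrow> complex \<times> real \<Rightarrow> complex" and u
    assume U: "\<And>n. U n \<in> \<F>" and le: "\<And>n p. p \<in> S \<Longrightarrow> norm (U n p - u p) \<le> 2 * \<rho> * (1/2) ^ n * \<omega> p"
    have ul: "uniform_limit S U u sequentially"
      by (rule geometric_uniform_limit[where B = "exp \<kappa>", OF le]) (use \<kappa> \<rho> in \<open>auto simp: S_def \<omega>_def\<close>)
    have lim: "(\<lambda>n. U n p) \<longlonglongrightarrow> u p" if "p \<in> S" for p
      using tendsto_uniform_limitI[OF ul that] .
    have "continuous_on S u"
      using U by (intro uniform_limit_theorem[OF _ ul]) (auto simp: \<F>_def)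
    moreover have "(\<lambda>z. u (z, r)) holomorphic_on ball 0 \<rho>" if r: "r \<in> {0..1}" for r
    proof (rule holomorphic_uniform_sequence[of _ "\<lambda>n z. U n (z, r)"])
      show "(\<lambda>z. U n (z, r)) holomorphic_on ball 0 \<rho>" for n using U[of n] r by (auto simp: \<F>_def)
      fix x assume "x \<in> ball (0::complex) \<rho>"
      then obtain d where d: "d > 0" "cball x d \<subseteq> ball 0 \<rho>" using open_contains_cball open_ball by blast
      have "uniform_limit (cball x d) (\<lambda>n z. U n (z, r)) (\<lambda>z. u (z, r)) sequentially"
      proof (rule uniform_limitI)
        fix e :: real assume "e > 0"
        then have "\<forall>\<^sub>F n in sequentially. \<forall>p\<in>S. dist (U n p) (u p) < e"
          using ul uniform_limitD by blast
        then show "\<forall>\<^sub>F n in sequentially. \<forall>z\<in>cball x d. dist (U n (z, r)) (u (z, r)) < e"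
          by eventually_elim (use d r in \<open>auto simp: S_def\<close>)
      qed
      then show "\<exists>d>0. cball x d \<subseteq> ball 0 \<rho> \<and> uniform_limit (cball x d) (\<lambda>n z. U n (z, r)) (\<lambda>z. u (z, r)) sequentially"
        using d by blast
    qed auto
    moreover have "norm (u p) \<le> 2 * \<rho> * \<omega> p" if "p \<in> S" for p
      by (rule tendsto_upperbound[OF tendsto_norm[OF lim[OF that]]]) (use U that in \<open>auto simp: \<F>_def\<close>)
    moreover have "u p \<in> \<real>" if "p \<in> S" "fst p \<in> \<real>" for p
      by (rule Lim_in_closed_set[OF closed_complex_Reals _ _ lim[OF that(1)]]) (use U that in \<open>auto simp: \<F>_def\<close>)
    ultimately show "u \<in> \<F>" by (simp add: \<F>_def)
  qed (use \<rho> in \<open>auto simp: \<omega>_def intro: that\<close>)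
  define F where "F = (\<lambda>z. of_real (v 1) + u (z, 1))"
  have "F holomorphic_on ball 0 \<rho>"
    unfolding F_def using u(1) by (intro holomorphic_intros) (auto simp: \<F>_def)
  moreover have "F (of_real x) = of_real (radial_sol 10 a (\<beta> + x) 1)" if x: "\<bar>x\<bar> < \<rho>" for x
  proof -
    have xb: "of_real x \<in> ball (0::complex) \<rho>" using x by simp
    obtain ur where ur: "continuous_on {0..1} ur" "\<And>s. s \<in> {0..1} \<Longrightarrow> u (of_real x, s) = of_real (ur s)"
      "\<And>r. r \<in> {0..1} \<Longrightarrow> green (\<lambda>s. of_real (g s) * (exp (u (of_real x, s)) - 1)) r = of_real (green (\<lambda>s. g s * (exp (ur s) - 1)) r)"
      using real_form[OF u(1) xb] by blast
    have eq: "ur r = x - green (\<lambda>s. g s * (exp (ur s) - 1)) r" if r: "r \<in> {0..1}" for r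
    proof -
      have "(of_real x, r) \<in> S" using xb r by (simp add: S_def)
      then have "complex_of_real (ur r) = of_real (x - green (\<lambda>s. g s * (exp (ur s) - 1)) r)"
        using u(2)[of "(of_real x, r)"] r by (simp add: T_def ur)
      then show ?thesis by (simp only: of_real_eq_iff)
    qed
    have "solves_radial_ivp 10 a (\<beta> + x) (\<lambda>r. v r + ur r)"
    proof (rule integral_equation_imp_ivp[OF a(1)])
      show "continuous_on {0..1} (\<lambda>r. v r + ur r)" by (intro continuous_intros v ur)
      fix r :: real assume r: "r \<in> {0..1}"
      have "green (\<lambda>s. g s * (exp (ur s) - 1)) r = green (\<lambda>s. a s * exp (v s + ur s) - g s) r"
        by (simp add: g_def exp_add algebra_simps)
      also have "\<dots> = green (\<lambda>s. a s * exp (v s + ur s)) r - green g r"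
        by (intro green_diff continuous_intros a v ur g r)
      finally show "v r + ur r = \<beta> + x - green (\<lambda>s. a s * exp (v s + ur s)) r"
        using eq[OF r] v(2)[OF r] by (simp add: g_def)
    qed
    then have "radial_sol 10 a (\<beta> + x) 1 = v 1 + ur 1"
      using radial_ivp_unique[OF a(2) a(1) radial_sol_solves[OF a]] by simp
    then show ?thesis using ur(2)[of 1] by (simp add: F_def)
  qed
  ultimately show ?thesis using that \<rho>(1) by blast
qed

section \<open>Logarithmic coordinates\<close>

definition psi :: "real \<Rightarrow> real" where "psi t = bj (H_disc * exp (2 * t))"
definition psi1 :: "real \<Rightarrow> real" where "psi1 t = 2 * (H_disc * exp (2 * t)) * bj1 (H_disc * exp (2 * t))"

lemma H_disc_pos: "H_disc > 0"
  by (simp add: H_disc_eq bj_zero)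

text \<open>In \<open>s = H e^(2t)\<close> Bessel's equation becomes
  \<open>psi'' = - H e^(2t) psi\<close>, the scaled linearization at the explicit singular solution
  for \<open>a_H\<close>. H is the value for which the first zero of \<open>psi\<close> falls on
  \<open>t = 0\<close>, the boundary of the ball.\<close>

lemma psi_deriv: "hderiv psi psi1"
  and psi1_deriv: "hderiv psi1 (\<lambda>t. - (H_disc * exp (2 * t)) * psi t)"
proof -
  define s where "s = (\<lambda>t. H_disc * exp (2 * t))"
  have s: "(s has_real_derivative 2 * s t) (at t within {..0})" for t
    unfolding s_def by (auto intro!: derivative_eq_intros)
  show "hderiv psi psi1"
  proof (rule hderivI)
    fix t :: real
    show "(psi has_real_derivative psi1 t) (at t within {..0})"
      unfolding psi_def[abs_def] psi1_def s_def[symmetric]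
      by (rule DERIV_cong[OF DERIV_chain2[OF bj_deriv, OF s[of t], unfolded s_def]]) (simp add: s_def)
  qed
  show "hderiv psi1 (\<lambda>t. - (H_disc * exp (2 * t)) * psi t)"
  proof (rule hderivI)
    fix t :: real
    have d: "((\<lambda>t. bj1 (s t)) has_real_derivative bj2 (s t) * (2 * s t)) (at t within {..0})"
      by (rule DERIV_chain2[OF bj1_deriv s])
    have "((\<lambda>t. 2 * s t * bj1 (s t)) has_real_derivative 2 * (2 * s t) * bj1 (s t) + bj2 (s t) * (2 * s t) * (2 * s t)) (at t within {..0})"
      by (intro DERIV_mult DERIV_cmult s d)
    moreover have "2 * (2 * s t) * bj1 (s t) + bj2 (s t) * (2 * s t) * (2 * s t) = - s t * bj (s t)"
    proof -
      have "2 * (2 * s t) * bj1 (s t) + bj2 (s t) * (2 * s t) * (2 * s t) + s t * bj (s t)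
        = 4 * s t * (s t * bj2 (s t) + bj1 (s t) + bj (s t) / 4)" by (simp add: algebra_simps)
      then show ?thesis by (simp add: bj_ode)
    qed
    ultimately show "(psi1 has_real_derivative - (H_disc * exp (2 * t)) * psi t) (at t within {..0})"
      by (simp add: psi1_def[abs_def] psi_def s_def)
  qed
qed

lemma psi_pos: "t < 0 \<Longrightarrow> psi t > 0"
  unfolding psi_def H_disc_eq using bj_zero(1) by (intro bj_zero(3)) auto

lemma psi_0: "psi 0 = 0"
  by (simp add: psi_def H_disc_eq bj_zero)

lemma psi_lim: "(psi \<longlongrightarrow> 1) at_bot" "(psi1 \<longlongrightarrow> 0) at_bot"
proof -
  have e: "((\<lambda>t::real. H_disc * exp (2 * t)) \<longlongrightarrow> 0) at_bot" by real_asymp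
  have "((\<lambda>t. bj (H_disc * exp (2 * t))) \<longlongrightarrow> bj 0) at_bot"
    by (rule isCont_tendsto_compose[OF DERIV_isCont[OF bj_deriv] e])
  then show "(psi \<longlongrightarrow> 1) at_bot" by (simp add: psi_def[abs_def])
  have "((\<lambda>t. bj1 (H_disc * exp (2 * t))) \<longlongrightarrow> bj1 0) at_bot"
    by (rule isCont_tendsto_compose[OF DERIV_isCont[OF bj1_deriv] e])
  from tendsto_mult[OF tendsto_mult[OF tendsto_const[of 2] e] this]
  show "(psi1 \<longlongrightarrow> 0) at_bot" by (simp add: psi1_def[abs_def])
qed

lemma exp_at_bot_within01:
  assumes "continuous_on {0..1} f"
  shows "((\<lambda>t. f (exp t)) \<longlongrightarrow> f (0::real)) at_bot"
proof -
  have "(f \<longlongrightarrow> f 0) (at 0 within {0..1})" using assms by (simp add: continuous_on_def)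
  moreover have "filterlim exp (at 0 within {0..1}) (at_bot :: real filter)"
  proof -
    have "\<forall>\<^sub>F t in at_bot. exp t \<in> {0..1::real} \<and> exp t \<noteq> 0"
      using eventually_le_at_bot[of "0::real"] by eventually_elim auto
    then show ?thesis unfolding filterlim_at using exp_at_bot by auto
  qed
  ultimately show ?thesis by (rule filterlim_compose)
qed

text \<open>The initial value problem in the variable \<open>t = log r\<close>, with \<open>A t = a (exp t)\<close>.\<close>

definition logsol :: "(real \<Rightarrow> real) \<Rightarrow> real \<Rightarrow> (real \<Rightarrow> real) \<Rightarrow> (real \<Rightarrow> real) \<Rightarrow> bool"
  where "logsol A \<beta> x x1 \<longleftrightarrow> hderiv x x1 \<and> hderiv x1 (\<lambda>t. - 8 * x1 t - exp (2 * t) * A t * exp (x t)) \<and>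
    (x \<longlongrightarrow> \<beta>) at_bot \<and> (x1 \<longlongrightarrow> 0) at_bot"

lemma radial_ivp_logsol:
  assumes "solves_radial_ivp 10 a \<beta> v"
  obtains x1 where "logsol (\<lambda>t. a (exp t)) \<beta> (\<lambda>t. v (exp t)) x1"
proof -
  obtain v1 v2 where d: "\<And>r. r\<in>{0..1} \<Longrightarrow> (v has_real_derivative v1 r) (at r within {0..1})"
    "\<And>r. r\<in>{0..1} \<Longrightarrow> (v1 has_real_derivative v2 r) (at r within {0..1})"
    "\<And>r. r\<in>{0<..1} \<Longrightarrow> - (v2 r + 9 / r * v1 r) = a r * exp (v r)" "v 0 = \<beta>" "v1 0 = 0"
    using assms by (rule solves_radial_ivpE) (rule that)
  have chain: "((\<lambda>t. f (exp t)) has_real_derivative f' (exp t) * exp t) (at t within {..0})"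
    if f: "\<And>r. r\<in>{0..1} \<Longrightarrow> (f has_real_derivative f' r) (at r within {0..1})" and t: "t \<le> 0" for f f' t
  proof -
    have "(f has_real_derivative f' (exp t)) (at (exp t) within exp ` {..0})"
      using t by (intro DERIV_subset[OF f]) auto
    from DERIV_image_chain[OF this, of "exp t"] show ?thesis
      by (simp add: o_def DERIV_exp has_field_derivative_at_within)
  qed
  have lim: "((\<lambda>t. f (exp t)) \<longlongrightarrow> f 0) at_bot"
    if f: "\<And>r. r\<in>{0..1} \<Longrightarrow> (f has_real_derivative f' r) (at r within {0..1})" for f f'
  proof -
    have "continuous_on {0..1} f" by (rule DERIV_continuous_on[OF f])
    then show ?thesis by (rule exp_at_bot_within01)
  qed
  define x1 where "x1 = (\<lambda>t. v1 (exp t) * exp t)"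
  have "logsol (\<lambda>t. a (exp t)) \<beta> (\<lambda>t. v (exp t)) x1"
    unfolding logsol_def
  proof (intro conjI)
    show "hderiv (\<lambda>t. v (exp t)) x1" unfolding x1_def by (intro hderivI chain d)
    show "hderiv x1 (\<lambda>t. - 8 * x1 t - exp (2 * t) * a (exp t) * exp (v (exp t)))"
    proof (rule hderivI)
      fix t :: real assume t: "t \<le> 0"
      have "(x1 has_real_derivative v2 (exp t) * exp t * exp t + exp t * v1 (exp t)) (at t within {..0})"
        unfolding x1_def using t by (intro DERIV_mult chain d) (auto intro!: derivative_eq_intros)
      moreover have "v2 (exp t) * exp t * exp t + exp t * v1 (exp t) = - 8 * x1 t - exp (2 * t) * a (exp t) * exp (v (exp t))"
      proof -
        have "v2 (exp t) = - 9 / exp t * v1 (exp t) - a (exp t) * exp (v (exp t))"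
          using d(3)[of "exp t"] t by (simp add: algebra_simps)
        moreover have "exp (2 * t) = exp t * exp t" by (simp flip: exp_add)
        ultimately show ?thesis by (simp only: x1_def) (simp add: field_simps)
      qed
      ultimately show "(x1 has_real_derivative - 8 * x1 t - exp (2 * t) * a (exp t) * exp (v (exp t))) (at t within {..0})"
        by simp
    qed
    show "((\<lambda>t. v (exp t)) \<longlongrightarrow> \<beta>) at_bot" using lim[OF d(1)] d(4) by simp
    have "((\<lambda>t. v1 (exp t) * exp t) \<longlongrightarrow> v1 0 * 0) at_bot"
      by (intro tendsto_mult lim[OF d(2)] exp_at_bot)
    then show "(x1 \<longlongrightarrow> 0) at_bot" by (simp add: x1_def)
  qed
  then show ?thesis using that by blast
qed

lemma logsolD:
  assumes "logsol A \<beta> x x1"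
  shows "hderiv x x1" "hderiv x1 (\<lambda>t. - 8 * x1 t - exp (2 * t) * A t * exp (x t))"
    "(x \<longlongrightarrow> \<beta>) at_bot" "(x1 \<longlongrightarrow> 0) at_bot"
  using assms by (auto simp: logsol_def)

lemma exp4_tendsto_0:
  assumes "(f \<longlongrightarrow> (l::real)) at_bot"
  shows "((\<lambda>t. exp (4 * t) * f t) \<longlongrightarrow> 0) at_bot"
proof -
  have "((\<lambda>t::real. exp (4 * t)) \<longlongrightarrow> 0) at_bot" by real_asymp
  from tendsto_mult[OF this assms] show ?thesis by simp
qed

lemma exp8_tendsto_0:
  assumes "(f \<longlongrightarrow> (l::real)) at_bot"
  shows "((\<lambda>t. exp (8 * t) * f t) \<longlongrightarrow> 0) at_bot"
proof -
  have "((\<lambda>t::real. exp (8 * t)) \<longlongrightarrow> 0) at_bot" by real_asymp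
  from tendsto_mult[OF this assms] show ?thesis by simp
qed

lemma logsol_decreasing:
  assumes x: "logsol A \<beta> x x1" and A: "\<And>t. t \<le> 0 \<Longrightarrow> A t \<ge> 0" and t: "t \<le> 0"
  shows "x1 t \<le> 0" "x t \<le> \<beta>"
proof -
  have x1: "x1 t \<le> 0" if "t \<le> 0" for t
  proof -
    have h: "hderiv (\<lambda>t. - (exp (8 * t) * x1 t)) (\<lambda>t. exp (8 * t) * (exp (2 * t) * A t * exp (x t)))"
      by (rule hderiv_cong[OF hderiv_minus[OF hderiv_mult[OF hderiv_exp logsolD(2)[OF x]]]])
         (simp add: algebra_simps)
    have l: "((\<lambda>t. - (exp (8 * t) * x1 t)) \<longlongrightarrow> - 0) at_bot"
      by (intro tendsto_minus exp8_tendsto_0[OF logsolD(4)[OF x]])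
    have "- 0 \<le> - (exp (8 * t) * x1 t)"
      by (rule hderiv_mono_from_bot[OF h order.refl _ l that]) (auto simp: A)
    then show ?thesis by (simp add: mult_le_0_iff)
  qed
  then show "x1 t \<le> 0" using t by blast
  have "- \<beta> \<le> - x t"
    by (rule hderiv_mono_from_bot[OF hderiv_minus[OF logsolD(1)[OF x]] order.refl _ tendsto_minus[OF logsolD(3)[OF x]] t])
       (use x1 in auto)
  then show "x t \<le> \<beta>" by simp
qed

section \<open>Differences of two solutions\<close>

definition dquot :: "real \<Rightarrow> real \<Rightarrow> real"
  where "dquot x y = (if x = y then exp x else (exp y - exp x) / (y - x))"

text \<open>True on the diagonal as well. It turns the difference of two nonlinear equations into a
  linear one with an explicit potential, in place of an unknown intermediate value.\<close>

lemma dquot_mult: "dquot x y * (y - x) = exp y - exp x"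
  by (simp add: dquot_def)

lemma dquot_commute: "dquot x y = dquot y x"
  using minus_divide_divide[of "exp y - exp x" "y - x"] by (simp add: dquot_def)

lemma dquot_bounds: "x \<le> y \<Longrightarrow> exp x \<le> dquot x y" "x \<le> y \<Longrightarrow> dquot x y \<le> exp y"
  and dquot_pos: "dquot x y > 0"
proof -
  show lo: "exp x \<le> dquot x y" if "x \<le> y" for x y
  proof (cases "x = y")
    case False
    have "exp x * (1 + (y - x)) \<le> exp x * exp (y - x)"
      by (intro mult_left_mono exp_ge_add_one_self) auto
    then have "exp x * (y - x) \<le> exp y - exp x" by (simp add: algebra_simps flip: exp_add)
    then show ?thesis using False that by (simp add: dquot_def pos_le_divide_eq)
  qed (simp add: dquot_def)
  show "dquot x y \<le> exp y" if "x \<le> y"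
    using exp_diff_le[of y y x] that by (cases "x = y") (auto simp: dquot_def pos_divide_le_eq)
  show "dquot x y > 0"
    using lo[of x y] lo[of y x] exp_gt_zero[of x] exp_gt_zero[of y]
    unfolding dquot_commute[of y x] by (cases "x \<le> y") linarith+
qed

text \<open>The trapezoid bound for the mean of a convex function. The bound by \<open>exp y\<close>
  leaves no gap when \<open>y\<close> is close to the singular solution; the average stays well
  below \<open>exp y\<close> as soon as \<open>exp x\<close> is comparatively small.\<close>

lemma dquot_le_average:
  assumes "x \<le> y"
  shows "dquot x y \<le> (exp x + exp y) / 2"
proof (cases "x = y")
  case False
  define g where "g h = h * (1 + exp h) - 2 * (exp h - 1)" for h :: real
  have "g 0 \<le> g (y - x)"
  proof (rule DERIV_nonneg_imp_nondecreasing[of 0 "y - x" g])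
    fix h :: real assume "0 \<le> h"
    have "(g has_real_derivative 1 - exp h + h * exp h) (at h)"
      unfolding g_def by (auto intro!: derivative_eq_intros simp: algebra_simps)
    moreover have "1 - exp h + h * exp h \<ge> 0"
    proof -
      have "exp h * (1 + (- h)) \<le> exp h * exp (- h)" by (intro mult_left_mono exp_ge_add_one_self) auto
      then show ?thesis by (simp add: algebra_simps flip: exp_add)
    qed
    ultimately show "\<exists>z. (g has_real_derivative z) (at h) \<and> 0 \<le> z" by blast
  qed (use assms in simp)
  then have "0 \<le> exp x * ((y - x) * (1 + exp (y - x)) - 2 * (exp (y - x) - 1))" by (simp add: g_def)
  also have "\<dots> = (y - x) * (exp x + exp x * exp (y - x)) - 2 * (exp x * exp (y - x) - exp x)"
    by (simp add: algebra_simps)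
  also have "exp x * exp (y - x) = exp y" by (simp flip: exp_add)
  finally have "2 * (exp y - exp x) \<le> (y - x) * (exp x + exp y)" by simp
  then show ?thesis using False assms by (simp add: dquot_def pos_divide_le_eq algebra_simps)
qed (simp add: dquot_def)

text \<open>The factor \<open>exp (4 * t)\<close> removes the first-order term from
  \<open>d'' + 8 d' + Q d = 0\<close>; the potential that remains is \<open>Q - 16\<close>, here
  \<open>diff_potential\<close>.\<close>

definition scaled_diff :: "(real \<Rightarrow> real) \<Rightarrow> (real \<Rightarrow> real) \<Rightarrow> real \<Rightarrow> real"
  where "scaled_diff x y t = exp (4 * t) * (y t - x t)"
definition scaled_diff1 :: "(real \<Rightarrow> real) \<Rightarrow> (real \<Rightarrow> real) \<Rightarrow> (real \<Rightarrow> real) \<Rightarrow> (real \<Rightarrow> real) \<Rightarrow> real \<Rightarrow> real"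
  where "scaled_diff1 x x1 y y1 t = exp (4 * t) * (y1 t - x1 t + 4 * (y t - x t))"
definition diff_potential :: "(real \<Rightarrow> real) \<Rightarrow> (real \<Rightarrow> real) \<Rightarrow> (real \<Rightarrow> real) \<Rightarrow> real \<Rightarrow> real"
  where "diff_potential A x y t = exp (2 * t) * A t * dquot (x t) (y t) - 16"

lemma scaled_diff:
  assumes x: "logsol A \<beta> x x1" and y: "logsol A \<gamma> y y1"
  shows "hderiv (scaled_diff x y) (scaled_diff1 x x1 y y1)"
    "hderiv (scaled_diff1 x x1 y y1) (\<lambda>t. - diff_potential A x y t * scaled_diff x y t)"
    "(scaled_diff x y \<longlongrightarrow> 0) at_bot" "(scaled_diff1 x x1 y y1 \<longlongrightarrow> 0) at_bot"
    "\<beta> < \<gamma> \<Longrightarrow> \<forall>\<^sub>F t in at_bot. scaled_diff x y t > 0"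
proof -
  note x = logsolD[OF x] and y = logsolD[OF y]
  show "hderiv (scaled_diff x y) (scaled_diff1 x x1 y y1)"
    unfolding scaled_diff_def[abs_def]
    by (rule hderiv_cong[OF hderiv_mult[OF hderiv_exp hderiv_diff[OF y(1) x(1)]]])
       (simp add: scaled_diff1_def algebra_simps)
  show "hderiv (scaled_diff1 x x1 y y1) (\<lambda>t. - diff_potential A x y t * scaled_diff x y t)"
    unfolding scaled_diff1_def[abs_def]
  proof (rule hderiv_cong[OF hderiv_mult[OF hderiv_exp hderiv_add[OF hderiv_diff[OF y(2) x(2)] hderiv_cmult[OF hderiv_diff[OF y(1) x(1)]]]]])
    fix t :: real
    have "diff_potential A x y t * scaled_diff x y t
      = exp (4 * t) * (exp (2 * t) * A t * (dquot (x t) (y t) * (y t - x t)) - 16 * (y t - x t))"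
      unfolding diff_potential_def scaled_diff_def by (simp add: left_diff_distrib right_diff_distrib mult_ac)
    then show "4 * exp (4 * t) * (y1 t - x1 t + 4 * (y t - x t)) +
        (- 8 * y1 t - exp (2 * t) * A t * exp (y t) - (- 8 * x1 t - exp (2 * t) * A t * exp (x t)) + 4 * (y1 t - x1 t)) * exp (4 * t)
       = - diff_potential A x y t * scaled_diff x y t"
      unfolding dquot_mult by (simp add: algebra_simps)
  qed
  show "(scaled_diff x y \<longlongrightarrow> 0) at_bot"
    unfolding scaled_diff_def[abs_def] by (rule exp4_tendsto_0[OF tendsto_diff[OF y(3) x(3)]])
  show "(scaled_diff1 x x1 y y1 \<longlongrightarrow> 0) at_bot"
    unfolding scaled_diff1_def[abs_def]
    by (rule exp4_tendsto_0[OF tendsto_add[OF tendsto_diff[OF y(4) x(4)] tendsto_mult[OF tendsto_const tendsto_diff[OF y(3) x(3)]]]])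
  assume "\<beta> < \<gamma>"
  then have "\<forall>\<^sub>F t in at_bot. y t - x t > 0"
    by (intro order_tendstoD[OF tendsto_diff[OF y(3) x(3)]]) simp
  then show "\<forall>\<^sub>F t in at_bot. scaled_diff x y t > 0"
    by eventually_elim (simp add: scaled_diff_def)
qed

text \<open>As long as the solutions are ordered, \<open>exp (8 * t) * (x1 t - y1 t)\<close>
  increases from 0. At \<open>t = 0\<close> the second conclusion says that \<open>bif_alpha\<close>
  increases with the initial value.\<close>

lemma logsol_diff_decreasing:
  assumes x: "logsol A \<beta> x x1" and y: "logsol A \<gamma> y y1" and A: "\<And>t. t \<le> 0 \<Longrightarrow> A t > 0"
    and T: "t \<le> T" "T \<le> 0" and pos: "\<And>s. s < T \<Longrightarrow> x s < y s"
  shows "y1 t - x1 t < 0" "y t - x t < \<gamma> - \<beta>"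
proof -
  note xx = logsolD[OF x] and yy = logsolD[OF y]
  have d1: "y1 t - x1 t < 0" if "t \<le> T" for t
  proof -
    have h: "hderiv (\<lambda>t. exp (8 * t) * (x1 t - y1 t)) (\<lambda>t. exp (8 * t) * (exp (2 * t) * A t * (exp (y t) - exp (x t))))"
      by (rule hderiv_cong[OF hderiv_mult[OF hderiv_exp hderiv_diff[OF xx(2) yy(2)]]])
         (simp add: algebra_simps)
    have l: "((\<lambda>t. exp (8 * t) * (x1 t - y1 t)) \<longlongrightarrow> 0) at_bot"
      by (rule exp8_tendsto_0[OF tendsto_diff[OF xx(4) yy(4)]])
    have "0 < exp (8 * t) * (x1 t - y1 t)"
    proof (rule hderiv_strict_mono_from_bot[OF h T(2) _ l that])
      fix s assume "s < T"
      then show "0 < exp (8 * s) * (exp (2 * s) * A s * (exp (y s) - exp (x s)))"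
        using pos[of s] A[of s] T(2) by simp
    qed
    then show ?thesis by (simp add: zero_less_mult_iff)
  qed
  then show "y1 t - x1 t < 0" using T by blast
  have "((\<lambda>t. x t - y t) \<longlongrightarrow> \<beta> - \<gamma>) at_bot" by (intro tendsto_diff xx yy)
  from hderiv_strict_mono_from_bot[OF hderiv_diff[OF xx(1) yy(1)] T(2) _ this T(1)]
  have "\<beta> - \<gamma> < x t - y t" using d1 by force
  then show "y t - x t < \<gamma> - \<beta>" by simp
qed

text \<open>\<open>W\<close> is the logarithm of the quotient of the two sides, and
  \<open>V = W - ln b\<close> is the distance to the explicit singular solution for
  \<open>a_H\<close>. At a first point z with \<open>W z = 0\<close>, monotonicity of
  \<open>b\<close> gives \<open>V - V z \<le> W < 0\<close> to the left. Strict convexity drives the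
  Wronskian of the scaled \<open>V - V z\<close> with \<open>psi\<close>, so that \<open>V\<close>
  has negative slope at z, against \<open>V < V z\<close> just before.\<close>

lemma type_II_potential_bound:
  assumes x: "logsol A \<beta> x x1"
    and A: "\<And>t. t \<le> 0 \<Longrightarrow> A t = b t * ((1 + H_disc * exp (2 * t) / 16) * exp (H_disc * exp (2 * t) / 20))"
    and b: "\<And>t. t \<le> 0 \<Longrightarrow> b t > 0" "continuous_on {..0} b" "(b \<longlongrightarrow> 1) at_bot"
      "\<And>s t. s \<le> t \<Longrightarrow> t \<le> 0 \<Longrightarrow> b t \<le> b s"
    and t: "t \<le> 0"
  shows "exp (2 * t) * A t * exp (x t) < 16 + H_disc * exp (2 * t)"
proof -
  let ?H = H_disc
  note xx = logsolD[OF x]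
  define V where "V = (\<lambda>t. x t + 2 * t - ln 16 + ?H * exp (2 * t) / 20)"
  define V1 where "V1 = (\<lambda>t. x1 t + 2 + ?H * exp (2 * t) / 10)"
  define W where "W = (\<lambda>t. V t + ln (b t))"
  have eW: "exp (2 * t) * A t * exp (x t) = (16 + ?H * exp (2 * t)) * exp (W t)" if "t \<le> 0" for t
  proof -
    have "exp (W t) = exp (x t) * exp (2 * t) / 16 * exp (?H * exp (2 * t) / 20) * b t"
      using b(1)[OF that] by (simp add: W_def V_def exp_add exp_diff)
    then show ?thesis by (simp add: A[OF that] field_simps)
  qed
  have Vd: "hderiv V V1" unfolding V_def V1_def
    by (rule hderivI) (auto intro!: derivative_eq_intros hderivD[OF xx(1)])
  have Wc: "continuous_on {..0} W" unfolding W_def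
    by (intro continuous_intros hderiv_cont[OF Vd] b(2)) (use b(1) in \<open>auto simp: less_imp_neq\<close>, force)
  have "((\<lambda>t. x t + ?H * exp (2 * t) / 20 + ln (b t)) \<longlongrightarrow> \<beta> + 0 + ln 1) at_bot"
    by (intro tendsto_intros b(3) xx) (real_asymp, simp)
  then have "\<forall>\<^sub>F t in at_bot. x t + ?H * exp (2 * t) / 20 + ln (b t) < \<beta> + 1"
    by (rule order_tendstoD) simp
  moreover have "\<forall>\<^sub>F t in at_bot. 2 * t - ln 16 + (\<beta> + 1) < 0" by real_asymp
  ultimately have "\<forall>\<^sub>F t in at_bot. W t < 0"
    by eventually_elim (simp add: W_def V_def)
  then have ev: "\<forall>\<^sub>F t in at_bot. - W t > 0" by eventually_elim simp
  have "W t < 0"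
  proof (rule ccontr)
    assume "\<not> W t < 0"
    then obtain z where z: "z \<le> t" "- W z = 0" "\<And>s. s < z \<Longrightarrow> - W s > 0"
      using first_zero[OF continuous_on_minus[OF Wc] ev t] by auto
    then have z0: "z \<le> 0" using t by simp
    \<comment> \<open>\<open>c = - ln (b z)\<close>: the logarithm of \<open>b\<close> is frozen at
      the touching point, so that \<open>b\<close> enters only through its monotonicity.\<close>
    define c where "c = V z"
    have Vc: "V s - c \<le> W s" if "s \<le> z" for s
    proof -
      have "ln (b z) \<le> ln (b s)" using b(1)[of z] b(1)[of s] b(4)[of s z] that z0 by simp
      then show ?thesis using z(2) by (simp add: c_def W_def)
    qed
    define F where "F = (\<lambda>t. exp (4 * t) * (V t - c))"
    define F1 where "F1 = (\<lambda>t. exp (4 * t) * (V1 t + 4 * (V t - c)))"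
    have V1d: "hderiv V1 (\<lambda>t. - 8 * x1 t - exp (2 * t) * A t * exp (x t) + ?H * exp (2 * t) / 5)"
      unfolding V1_def by (rule hderivI) (auto intro!: derivative_eq_intros hderivD[OF xx(2)])
    have Fd: "hderiv F F1" unfolding F_def
      by (rule hderiv_cong[OF hderiv_mult[OF hderiv_exp hderiv_diff[OF Vd hderiv_const]]])
         (simp add: F1_def algebra_simps)
    have F1d: "hderiv F1 (\<lambda>t. exp (4 * t) * ((16 + ?H * exp (2 * t)) * (1 - exp (W t)) + 16 * (V t - c)))"
      unfolding F1_def
    proof (rule hderiv_cong[OF hderiv_mult[OF hderiv_exp hderiv_add[OF V1d hderiv_cmult[OF hderiv_diff[OF Vd hderiv_const]]]]])
      fix t :: real assume "t \<le> 0"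
      show "4 * exp (4 * t) * (V1 t + 4 * (V t - c)) + (- 8 * x1 t - exp (2 * t) * A t * exp (x t) + ?H * exp (2 * t) / 5 + 4 * (V1 t - 0)) * exp (4 * t)
        = exp (4 * t) * ((16 + ?H * exp (2 * t)) * (1 - exp (W t)) + 16 * (V t - c))"
        unfolding eW[OF \<open>t \<le> 0\<close>] by (simp add: V1_def algebra_simps)
    qed
    define w where "w = (\<lambda>t. F t * psi1 t - psi t * F1 t)"
    have wd: "hderiv w (\<lambda>t. psi t * exp (4 * t) * ((16 + ?H * exp (2 * t)) * (exp (W t) - 1 - (V t - c))))"
      unfolding w_def
      by (rule hderiv_cong[OF hderiv_diff[OF hderiv_mult[OF Fd psi1_deriv] hderiv_mult[OF psi_deriv F1d]]])
         (simp add: F_def algebra_simps)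
    have wl: "(w \<longlongrightarrow> 0) at_bot"
    proof -
      have e: "((\<lambda>t. exp (4 * t) * (x t - ln 16 - c)) \<longlongrightarrow> 0) at_bot"
        by (rule exp4_tendsto_0[OF tendsto_diff[OF tendsto_diff[OF xx(3) tendsto_const] tendsto_const]])
      have "((\<lambda>t. exp (4 * t) * (2 * t + ?H * exp (2 * t) / 20)) \<longlongrightarrow> 0) at_bot" by real_asymp
      from tendsto_add[OF e this] have F0: "(F \<longlongrightarrow> 0) at_bot" by (simp add: F_def V_def algebra_simps)
      have "((\<lambda>t. x1 t + 2 + ?H * exp (2 * t) / 10) \<longlongrightarrow> 0 + 2 + 0) at_bot"
        by (intro tendsto_intros xx) real_asymp
      from tendsto_add[OF exp4_tendsto_0[OF this] tendsto_mult[OF tendsto_const[of 4] F0]]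
      have F10: "(F1 \<longlongrightarrow> 0) at_bot" by (simp add: F1_def F_def V1_def algebra_simps)
      have "(w \<longlongrightarrow> 0 * 0 - 1 * 0) at_bot" unfolding w_def by (intro tendsto_intros F0 F10 psi_lim)
      then show ?thesis by simp
    qed
    have "0 < w z"
    proof (rule hderiv_strict_mono_from_bot[OF wd z0 _ wl order.refl])
      fix s assume s: "s < z"
      have "V s - c \<le> W s" "W s < 0" using Vc[of s] z(3)[of s] s by auto
      moreover have "1 + W s < exp (W s)" using \<open>W s < 0\<close> exp_minus_greater[of "- W s"] by simp
      ultimately have "exp (W s) - 1 - (V s - c) > 0" by linarith
      then show "0 < psi s * exp (4 * s) * ((16 + ?H * exp (2 * s)) * (exp (W s) - 1 - (V s - c)))"
        using psi_pos[of s] s z0 H_disc_pos by (intro mult_pos_pos) (auto intro: add_pos_pos)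
    qed
    moreover have "F z = 0" by (simp add: F_def c_def)
    \<comment> \<open>For z = 0 this already contradicts \<open>psi 0 = 0\<close>; the boundary
      point is excluded as a touching point together with the others.\<close>
    ultimately have "psi z * F1 z < 0" by (simp add: w_def)
    moreover have "psi z \<ge> 0" using psi_pos[of z] psi_0 z0 by (cases "z = 0") auto
    ultimately have "V1 z < 0" by (simp add: F1_def c_def mult_less_0_iff zero_less_mult_iff)
    from has_real_derivative_neg_dec_left[OF hderivD[OF Vd z0] this]
    obtain d where "d > 0" "\<And>h. 0 < h \<Longrightarrow> z - h \<le> 0 \<Longrightarrow> h < d \<Longrightarrow> V z < V (z - h)" by auto
    from this(2)[of "d/2"] this(1) z0 have "V z < V (z - d / 2)" by simp
    then show False using Vc[of "z - d / 2"] z(3)[of "z - d/2"] \<open>d > 0\<close> by (simp add: c_def)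
  qed
  moreover have "16 + ?H * exp (2 * t) > 0" using H_disc_pos by (intro add_pos_pos mult_pos_pos) auto
  ultimately have "(16 + ?H * exp (2 * t)) * exp (W t) < (16 + ?H * exp (2 * t)) * 1"
    by (intro mult_strict_left_mono) auto
  then show ?thesis unfolding eW[OF t] by simp
qed

text \<open>Both bounds together keep the potential of the difference below that of
  \<open>psi\<close>, whatever the order of the two solutions, and Sturm comparison gives positivity
  for t < 0.\<close>

lemma type_II_ordered:
  assumes x: "logsol A \<beta> x x1" and y: "logsol A \<gamma> y y1" and "\<beta> < \<gamma>" and A: "\<And>t. t \<le> 0 \<Longrightarrow> A t > 0"
    and xb: "\<And>t. t \<le> 0 \<Longrightarrow> exp (2 * t) * A t * exp (x t) < 16 + H_disc * exp (2 * t)"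
    and yb: "\<And>t. t \<le> 0 \<Longrightarrow> exp (2 * t) * A t * exp (y t) < 16 + H_disc * exp (2 * t)"
  shows "t \<le> 0 \<Longrightarrow> x t < y t"
proof -
  let ?D = "scaled_diff x y" and ?D1 = "scaled_diff1 x x1 y y1" and ?P = "diff_potential A x y"
  note D = scaled_diff[OF x y]
  have P: "?P t < H_disc * exp (2 * t)" if "t \<le> 0" for t
  proof -
    have "dquot (x t) (y t) \<le> exp (max (x t) (y t))"
      using dquot_bounds(2)[of "x t" "y t"] dquot_bounds(2)[of "y t" "x t"] dquot_commute[of "x t" "y t"]
      by (cases "x t \<le> y t") (auto simp: max_def)
    then have "exp (2 * t) * A t * dquot (x t) (y t) \<le> exp (2 * t) * A t * exp (max (x t) (y t))"
      using A[OF that] by (intro mult_left_mono) auto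
    also have "\<dots> < 16 + H_disc * exp (2 * t)" using xb[OF that] yb[OF that] by (simp add: max_def)
    finally show ?thesis by (simp add: diff_potential_def)
  qed
  define w where "w = (\<lambda>t. psi t * ?D1 t - ?D t * psi1 t)"
  have wl: "(w \<longlongrightarrow> 0) at_bot"
  proof -
    have "(w \<longlongrightarrow> 1 * 0 - 0 * 0) at_bot" unfolding w_def by (intro tendsto_intros D psi_lim)
    then show ?thesis by simp
  qed
  have Dpos: "?D t > 0" if "t < 0" for t
  proof (rule sturm_positivity(1)[OF D(1,2) psi_deriv psi1_deriv order.refl D(5) psi_pos wl[unfolded w_def] _ that])
    fix s :: real assume s: "s < 0" "0 < ?D s"
    have "?D s * psi s * (H_disc * exp (2 * s)) \<ge> ?D s * psi s * ?P s"
      using s psi_pos[of s] P[of s] by (intro mult_left_mono) auto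
    then show "?D s * (- (H_disc * exp (2 * s)) * psi s) \<le> psi s * (- ?P s * ?D s)"
      by (simp add: algebra_simps)
  qed (use \<open>\<beta> < \<gamma>\<close> in auto)
  have wd: "hderiv w (\<lambda>t. psi t * ?D t * (H_disc * exp (2 * t) - ?P t))"
    unfolding w_def
    by (rule hderiv_cong[OF hderiv_diff[OF hderiv_mult[OF psi_deriv D(2)] hderiv_mult[OF D(1) psi1_deriv]]])
       (simp add: algebra_simps)
  \<comment> \<open>At the endpoint \<open>psi\<close> vanishes and the comparison is silent. Strict
    growth of the Wronskian excludes that the difference vanishes there, and continuity supplies the
    sign.\<close>
  have "0 < w 0"
    by (rule hderiv_strict_mono_from_bot[OF wd order.refl _ wl order.refl])
       (use Dpos psi_pos P in \<open>auto intro!: mult_pos_pos\<close>)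
  then have "?D 0 \<noteq> 0" by (auto simp: w_def psi_0)
  moreover have "?D 0 \<ge> 0"
  proof -
    have "(?D \<longlongrightarrow> ?D 0) (at_left 0)"
      using DERIV_isCont hderivD[OF D(1), of 0] by (metis DERIV_continuous at_within_Iic_at_left continuous_within order.refl)
    then show ?thesis
      by (rule tendsto_lowerbound) (auto simp: eventually_at_left[of "-1"] intro!: exI[of _ "-1"] less_imp_le Dpos)
  qed
  ultimately have "?D t > 0" if "t \<le> 0" using Dpos that by (cases "t = 0") auto
  then show "t \<le> 0 \<Longrightarrow> x t < y t" by (simp add: scaled_diff_def zero_less_mult_iff)
qed

text \<open>The curve consists of the points \<open>(exp (f \<beta>), \<beta> - f \<beta>)\<close>.
  The hypothesis \<open>le\<close> pushes \<open>f\<close> to -infinity, the bound \<open>K\<close>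
  makes its supremum finite, and \<open>lip\<close> makes \<alpha> increase with \<lambda>.\<close>

lemma type_II_of_increasing:
  fixes N :: nat and a :: "real \<Rightarrow> real"
  defines "f \<equiv> \<lambda>\<beta>. radial_sol N a \<beta> 1"
  assumes mono: "\<And>\<beta> \<gamma>. \<beta> < \<gamma> \<Longrightarrow> f \<beta> < f \<gamma>" and lip: "\<And>\<beta> \<gamma>. \<beta> < \<gamma> \<Longrightarrow> f \<gamma> - f \<beta> < \<gamma> - \<beta>"
    and le: "\<And>\<beta>. f \<beta> \<le> \<beta>" and bd: "\<And>\<beta>. f \<beta> \<le> K"
  shows "type_II N a"
proof -
  have bdd: "bdd_above (range f)" using bd by (auto intro!: bdd_aboveI)
  define S where "S = Sup (range f)"
  have lt: "f \<beta> < S" for \<beta>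
  proof -
    have "f \<beta> < f (\<beta> + 1)" by (rule mono) simp
    also have "\<dots> \<le> S" unfolding S_def by (rule cSup_upper[OF _ bdd]) simp
    finally show ?thesis .
  qed
  have ex: "\<exists>\<beta>. f \<beta> > y" if "y < S" for y
    using less_cSupD[of "range f" y] that by (auto simp: S_def)
  have lip': "\<bar>f \<gamma> - f \<beta>\<bar> \<le> \<bar>\<gamma> - \<beta>\<bar>" for \<beta> \<gamma>
    using mono[of \<beta> \<gamma>] mono[of \<gamma> \<beta>] lip[of \<beta> \<gamma>] lip[of \<gamma> \<beta>]
    by (cases \<beta> \<gamma> rule: linorder_cases) auto
  have cont: "continuous_on X f" for X
    by (rule continuous_on_subset[OF lipschitz_on_continuous_on[of 1 UNIV]])
       (auto intro!: lipschitz_onI simp: dist_real_def lip')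
  have onto: "\<exists>\<beta>. f \<beta> = y" if "y < S" for y
  proof -
    obtain \<gamma> where \<gamma>: "f \<gamma> > y" using ex \<open>y < S\<close> by blast
    \<comment> \<open>The value \<open>y\<close> itself serves as the lower point for the
      intermediate value theorem.\<close>
    have "f y \<le> y" by (rule le)
    moreover have "y \<le> \<gamma>" using le[of \<gamma>] \<gamma> by linarith
    ultimately show ?thesis using IVT'[of f y y \<gamma>] \<gamma> cont by auto
  qed
  have inj: "f \<beta> = f \<gamma> \<Longrightarrow> \<beta> = \<gamma>" for \<beta> \<gamma> using mono[of \<beta> \<gamma>] mono[of \<gamma> \<beta>] by (cases \<beta> \<gamma> rule: linorder_cases) auto
  define g where "g = (\<lambda>y. SOME \<beta>. f \<beta> = y)"
  have fg: "f (g y) = y" if "y < S" for y unfolding g_def by (rule someI_ex[OF onto[OF that]])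
  have gf: "g (f \<beta>) = \<beta>" for \<beta> using inj fg[OF lt] by blast
  have lam: "bif_lambda N a \<beta> = exp (f \<beta>)" "bif_alpha N a \<beta> = \<beta> - f \<beta>" for \<beta>
    by (simp_all add: bif_lambda_def bif_alpha_def f_def)
  define \<alpha> where "\<alpha> = (\<lambda>l. g (ln l) - ln l)"
  show ?thesis unfolding type_II_def
  proof (intro exI[of _ "exp S"] exI[of _ \<alpha>] conjI)
    have ln_lt: "ln l < S" if "0 < l" "l < exp S" for l
      using that by (metis exp_gt_zero ln_exp ln_less_cancel_iff)
    show "strict_mono_on {0<..<exp S} \<alpha>"
    proof (rule strict_mono_onI)
      fix l m assume l: "l \<in> {0<..<exp S}" and m: "m \<in> {0<..<exp S}" and "l < m"
      then have "f (g (ln l)) < f (g (ln m))" using fg ln_lt by simp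
      then have "g (ln l) < g (ln m)" using mono[of "g (ln m)" "g (ln l)"]
        by (metis less_asym linorder_neqE_linordered_idom order_less_irrefl)
      from lip[OF this] show "\<alpha> l < \<alpha> m" using fg ln_lt l m by (simp add: \<alpha>_def)
    qed
    show "bifurcation_curve N a = {(l, \<alpha> l) | l. 0 < l \<and> l < exp S}"
    proof safe
      fix l \<alpha>' assume "(l, \<alpha>') \<in> bifurcation_curve N a"
      then obtain \<beta> where "l = exp (f \<beta>)" "\<alpha>' = \<beta> - f \<beta>" by (auto simp: bifurcation_curve_def lam)
      then show "\<exists>l'. (l, \<alpha>') = (l', \<alpha> l') \<and> 0 < l' \<and> l' < exp S"
        by (auto simp: \<alpha>_def gf lt)
    next
      fix l :: real assume "0 < l" "l < exp S"
      then show "(l, \<alpha> l) \<in> bifurcation_curve N a"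
        by (auto simp: bifurcation_curve_def lam \<alpha>_def fg ln_lt intro!: exI[of _ "g (ln l)"])
    qed
    show "filterlim \<alpha> at_top (at_left (exp S))"
      unfolding filterlim_at_top
    proof
      fix Z :: real
      \<comment> \<open>As \<open>ln l < S\<close>, an initial value of at least
        \<open>Z + S\<close> gives \<open>\<alpha> l \<ge> Z\<close>.\<close>
      define \<beta> where "\<beta> = Z + S"
      have "Z \<le> \<alpha> l" if l: "exp (f \<beta>) < l" "l < exp S" for l
      proof -
        have l0: "0 < l" using l(1) exp_gt_zero[of "f \<beta>"] by linarith
        have "f \<beta> < ln l" using l l0 by (metis exp_less_cancel_iff exp_ln)
        then have "f \<beta> < f (g (ln l))" using fg ln_lt l l0 by simp
        then have "\<beta> \<le> g (ln l)" using mono[of "g (ln l)" \<beta>] by (cases "\<beta> \<le> g (ln l)") auto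
        then show ?thesis using ln_lt[OF l0 l(2)] by (simp add: \<alpha>_def \<beta>_def)
      qed
      then show "\<forall>\<^sub>F l in at_left (exp S). Z \<le> \<alpha> l"
        using lt[of \<beta>] by (auto simp: eventually_at_left[of "exp (f \<beta>)"])
    qed
  qed simp
qed

section \<open>Type II\<close>

text \<open>What the argument takes from the regularity of the weight on the ball. The quadratic
  bound makes \<open>a (exp t) - a 0\<close> of order \<open>exp (2 * t)\<close>, integrable at
  -infinity against powers of t.\<close>

definition regular_weight :: "(real \<Rightarrow> real) \<Rightarrow> bool"
  where "regular_weight a \<longleftrightarrow> continuous_on {0..1} a \<and> (\<forall>r. 0 < r \<and> r < 1 \<longrightarrow> a differentiable (at r)) \<and>
    (\<exists>C\<ge>0. \<forall>r\<in>{0..1}. \<bar>a r - a 0\<bar> \<le> C * r\<^sup>2)"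

text \<open>On a line through the centre a radial function is even, so its first derivative vanishes
  at the centre; two applications of the mean value theorem with a bounded second derivative give
  the quadratic bound.\<close>

lemma C2_radial_regular_weight:
  fixes a :: "real \<Rightarrow> real"
  assumes "C2_on_closure (\<lambda>x :: 'a::euclidean_space. a (norm x)) (ball 0 1)"
  shows "regular_weight a"
proof -
  define f where "f = (\<lambda>x::'a. a (norm x))"
  obtain D D2 where D: "has_derivs2 f D D2 (ball 0 1)" and c: "continuous_on (cball 0 1) f" "continuous_on (cball 0 1) D2"
    using assms unfolding C2_on_closure_def f_def by auto
  obtain e :: 'a where e: "norm e = 1" using vector_choose_size[of 1] by auto
  define g where "g = (\<lambda>r. f (r *\<^sub>R e))"
  define g1 where "g1 = (\<lambda>r. blinfun_apply (D (r *\<^sub>R e)) e)"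
  define g2 where "g2 = (\<lambda>r. blinfun_apply (blinfun_apply (D2 (r *\<^sub>R e)) e) e)"
  have ga: "g r = a \<bar>r\<bar>" for r by (simp add: g_def f_def e)
  have lin: "((\<lambda>t. t *\<^sub>R e) has_derivative (\<lambda>s. s *\<^sub>R e)) (at t)" for t
    by (auto intro!: derivative_eq_intros)
  have g: "(g has_real_derivative g1 r) (at r)" and g1: "(g1 has_real_derivative g2 r) (at r)" if "\<bar>r\<bar> < 1" for r
  proof -
    have rb: "r *\<^sub>R e \<in> ball 0 1" using that e by simp
    have 1: "(f has_derivative blinfun_apply (D (r *\<^sub>R e))) (at (r *\<^sub>R e))"
      and 2: "(D has_derivative blinfun_apply (D2 (r *\<^sub>R e))) (at (r *\<^sub>R e))"
      using D rb by (auto simp: has_derivs2_def)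
    from has_derivative_compose[OF lin 1] show "(g has_real_derivative g1 r) (at r)"
      unfolding g_def g1_def has_field_derivative_def
      by (rule has_derivative_eq_rhs) (auto simp: blinfun.scaleR_right)
    from has_derivative_compose[OF lin 2]
    have "((\<lambda>t. blinfun_apply (D (t *\<^sub>R e)) e) has_derivative (\<lambda>s. blinfun_apply (blinfun_apply (D2 (r *\<^sub>R e)) (s *\<^sub>R e)) e)) (at r)"
      by (auto intro!: derivative_eq_intros)
    then show "(g1 has_real_derivative g2 r) (at r)"
      unfolding g1_def g2_def has_field_derivative_def
      by (rule has_derivative_eq_rhs) (auto simp: blinfun.scaleR_right blinfun.scaleR_left)
  qed
  have gc: "continuous_on {0..1} g" unfolding g_def
    by (intro continuous_on_compose2[OF c(1)] continuous_intros) (auto simp: e)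
  have ac: "continuous_on {0..1} a"
    by (rule continuous_on_cong[THEN iffD1, OF refl _ gc]) (auto simp: ga)
  have ad: "a differentiable (at r)" if "0 < r" "r < 1" for r
  proof -
    have "(a has_real_derivative g1 r) (at r)"
      by (rule has_field_derivative_transform_within_open[OF g[of r] open_greaterThanLessThan[of 0 1]])
         (use that in \<open>auto simp: ga\<close>)
    then show ?thesis using real_differentiable_def by blast
  qed
  have "g1 0 = 0"
  proof -
    have "((\<lambda>r. g (- r)) has_real_derivative - g1 0) (at 0)"
      by (rule DERIV_cong[OF DERIV_chain2[of g "g1 0" uminus 0 "-1"]])
         (use g[of 0] in \<open>auto intro!: derivative_eq_intros\<close>)
    then have "(g has_real_derivative - g1 0) (at 0)" by (simp add: ga[abs_def])
    from DERIV_unique[OF g[of 0] this] show ?thesis by simp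
  qed
  obtain K where K: "K \<ge> 0" "\<And>r. 0 \<le> r \<Longrightarrow> r < 1 \<Longrightarrow> \<bar>g2 r\<bar> \<le> K"
  proof -
    have "continuous_on {0..1} g2" unfolding g2_def
      by (intro continuous_intros continuous_on_compose2[OF c(2)]) (auto simp: e)
    then have "bounded (g2 ` {0..1})" by (intro compact_imp_bounded compact_continuous_image) auto
    then obtain B where "\<forall>r\<in>{0..1}. norm (g2 r) \<le> B" unfolding bounded_iff by auto
    then show ?thesis by (intro that[of "max B 0"]) (force simp: le_max_iff_disj)+
  qed
  have g1b: "\<bar>g1 r\<bar> \<le> K * r" if r: "0 \<le> r" "r < 1" for r
  proof (cases "r = 0")
    case False
    obtain z where "0 < z" "z < r" "g1 r - g1 0 = (r - 0) * g2 z"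
      using MVT2[of 0 r g1 g2] g1 r False by force
    then show ?thesis using K(2)[of z] r \<open>g1 0 = 0\<close> by (simp add: abs_mult mult.commute mult_left_mono)
  qed (simp add: \<open>g1 0 = 0\<close>)
  have gb: "\<bar>g r - g 0\<bar> \<le> K * r\<^sup>2" if r: "0 \<le> r" "r < 1" for r
  proof (cases "r = 0")
    case False
    obtain z where z: "0 < z" "z < r" "g r - g 0 = (r - 0) * g1 z"
      using MVT2[of 0 r g g1] g r False by force
    have "\<bar>g1 z\<bar> \<le> K * r"
      using g1b[of z] z r K(1) by (smt (verit) mult_left_mono)
    then show ?thesis using z r mult_left_mono[of "\<bar>g1 z\<bar>" "K * r" r] by (simp add: abs_mult power2_eq_square mult_ac)
  qed simp
  \<comment> \<open>The mean value argument covers r < 1; at r = 1 the enlarged constant makes the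
    bound trivial.\<close>
  have "\<bar>a r - a 0\<bar> \<le> (K + \<bar>a 1 - a 0\<bar>) * r\<^sup>2" if "r \<in> {0..1}" for r
  proof (cases "r = 1")
    case False
    then have "\<bar>a r - a 0\<bar> \<le> K * r\<^sup>2" using gb[of r] that by (simp add: ga)
    also have "\<dots> \<le> (K + \<bar>a 1 - a 0\<bar>) * r\<^sup>2" by (intro mult_right_mono) auto
    finally show ?thesis .
  qed (use K in auto)
  then show ?thesis unfolding regular_weight_def using ac ad K(1)
    by (auto intro!: exI[of _ "K + \<bar>a 1 - a 0\<bar>"])
qed

lemma a_fam_H: "a_fam 10 H_disc r = (1 + H_disc * r\<^sup>2 / 16) * exp (H_disc * r\<^sup>2 / 20)"
  by (simp add: a_fam_def)

lemma a_fam_H_ge: "a_fam 10 H_disc r \<ge> 1"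
proof -
  have "1 * 1 \<le> (1 + H_disc * r\<^sup>2 / 16) * exp (H_disc * r\<^sup>2 / 20)"
    using H_disc_pos by (intro mult_mono) auto
  then show ?thesis by (simp add: a_fam_H)
qed

lemma a_fam_H_deriv: "\<exists>D. (a_fam 10 H_disc has_real_derivative D) (at r)"
  unfolding a_fam_H[abs_def] by (rule exI) (rule derivative_eq_intros refl | simp)+

lemma a_fam_H_cont: "continuous_on S (a_fam 10 H_disc)"
  using a_fam_H_deriv by (meson DERIV_isCont continuous_at_imp_continuous_on)

lemma ratio_deriv:
  assumes "regular_weight a" "0 < r" "r < 1"
  shows "((\<lambda>s. a s / a_fam 10 H_disc s) has_real_derivative deriv01 (\<lambda>s. a s / a_fam 10 H_disc s) r) (at r)"
proof -
  obtain D E where "(a has_real_derivative D) (at r)" "(a_fam 10 H_disc has_real_derivative E) (at r)"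
    using assms a_fam_H_deriv unfolding regular_weight_def real_differentiable_def by blast
  moreover have "a_fam 10 H_disc r \<noteq> 0" using a_fam_H_ge[of r] by linarith
  ultimately obtain F where F: "((\<lambda>s. a s / a_fam 10 H_disc s) has_real_derivative F) (at r)"
    using DERIV_divide by blast
  then have "((\<lambda>s. a s / a_fam 10 H_disc s) has_vector_derivative F) (at r)"
    by (simp add: has_real_derivative_iff_has_vector_derivative)
  then have "deriv01 (\<lambda>s. a s / a_fam 10 H_disc s) r = F"
    unfolding deriv01_def using assms at_within_interior[of r "{0..1}"] by (simp add: vector_derivative_at)
  then show ?thesis using F by simp
qed

lemma ratio_cont: "regular_weight a \<Longrightarrow> continuous_on {0..1} (\<lambda>s. a s / a_fam 10 H_disc s)"
  using a_fam_H_ge by (auto simp: regular_weight_def intro!: continuous_intros a_fam_H_cont) (smt (verit))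

lemma type_II_case:
  assumes a: "regular_weight a" "\<And>r. r \<in> {0..1} \<Longrightarrow> a r > 0" "a 0 = 1"
    and b: "\<And>r. r \<in> {0<..1} \<Longrightarrow> deriv01 (\<lambda>s. a s / a_fam 10 H_disc s) r \<le> 0"
  shows "type_II 10 a"
proof -
  define q where "q = (\<lambda>s. a s / a_fam 10 H_disc s)"
  have qc: "continuous_on {0..1} q" unfolding q_def by (rule ratio_cont[OF a(1)])
  have qmono: "q s \<le> q r" if "0 \<le> r" "r \<le> s" "s \<le> 1" for r s
  proof (cases "r = s")
    case False
    show ?thesis
    proof (rule DERIV_nonpos_imp_decreasing_open[of r s q])
      fix x assume "r < x" "x < s"
      then show "\<exists>y. (q has_real_derivative y) (at x) \<and> y \<le> 0"
        using ratio_deriv[OF a(1), of x] b[of x] that unfolding q_def by (intro exI conjI) auto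
    qed (use that in \<open>auto intro: continuous_on_subset[OF qc]\<close>)
  qed simp
  have qpos: "q r > 0" if "r \<in> {0..1}" for r
    using a(2)[OF that] a_fam_H_ge[of r] unfolding q_def by (intro divide_pos_pos) auto
  have ac: "continuous_on {0..1} a" using a(1) by (simp add: regular_weight_def)
  have a0: "a r \<ge> 0" if "r \<in> {0..1}" for r using a(2)[OF that] by simp
  define A where "A = (\<lambda>t::real. a (exp t))"
  have Apos: "A t > 0" if "t \<le> 0" for t using a(2)[of "exp t"] that by (simp add: A_def)
  define f where "f = (\<lambda>\<beta>. radial_sol 10 a \<beta>)"
  have sol: "\<exists>x1. logsol A \<beta> (\<lambda>t. f \<beta> (exp t)) x1" for \<beta>
    unfolding A_def f_def using radial_ivp_logsol[OF radial_sol_solves[OF ac a0]] by metis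
  have bound: "exp (2 * t) * A t * exp (f \<beta> (exp t)) < 16 + H_disc * exp (2 * t)" if t: "t \<le> 0" for \<beta> t
  proof -
    obtain x1 where x1: "logsol A \<beta> (\<lambda>t. f \<beta> (exp t)) x1" using sol by blast
    show ?thesis
    proof (rule type_II_potential_bound[OF x1, where b = "\<lambda>t. q (exp t)"])
      fix t :: real assume "t \<le> 0"
      show "A t = q (exp t) * ((1 + H_disc * exp (2 * t) / 16) * exp (H_disc * exp (2 * t) / 20))"
      proof -
        have "A t = q (exp t) * a_fam 10 H_disc (exp t)"
          using a_fam_H_ge[of "exp t"] by (simp add: A_def q_def)
        then show ?thesis by (simp add: a_fam_H exp_double)
      qed
    next
      show "continuous_on {..0} (\<lambda>t. q (exp t))"
        by (intro continuous_on_compose2[OF qc] continuous_intros) auto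
      show "((\<lambda>t. q (exp t)) \<longlongrightarrow> 1) at_bot"
        using exp_at_bot_within01[OF qc] a(3) by (simp add: q_def a_fam_def)
      show "q (exp t) \<le> q (exp s)" if "s \<le> t" "t \<le> 0" for s t using that by (intro qmono) auto
    qed (use t in \<open>auto intro!: qpos\<close>)
  qed
  have ordered: "f \<beta> (exp t) < f \<gamma> (exp t)" if "\<beta> < \<gamma>" "t \<le> 0" for \<beta> \<gamma> t
  proof -
    obtain x1 y1 where "logsol A \<beta> (\<lambda>t. f \<beta> (exp t)) x1" "logsol A \<gamma> (\<lambda>t. f \<gamma> (exp t)) y1" using sol by blast
    from type_II_ordered[OF this that(1) Apos bound bound that(2)] show ?thesis .
  qed
  show ?thesis
  proof (rule type_II_of_increasing)
    fix \<beta> \<gamma> :: real assume "\<beta> < \<gamma>"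
    show "radial_sol 10 a \<beta> 1 < radial_sol 10 a \<gamma> 1"
      using ordered[OF \<open>\<beta> < \<gamma>\<close>, of 0] by (simp add: f_def)
    obtain x1 y1 where xy: "logsol A \<beta> (\<lambda>t. f \<beta> (exp t)) x1" "logsol A \<gamma> (\<lambda>t. f \<gamma> (exp t)) y1" using sol by blast
    have "f \<gamma> (exp 0) - f \<beta> (exp 0) < \<gamma> - \<beta>"
      by (rule logsol_diff_decreasing(2)[OF xy Apos order.refl order.refl ordered[OF \<open>\<beta> < \<gamma>\<close>]]) auto
    then show "radial_sol 10 a \<gamma> 1 - radial_sol 10 a \<beta> 1 < \<gamma> - \<beta>" by (simp add: f_def)
  next
    fix \<beta> :: real
    show "radial_sol 10 a \<beta> 1 \<le> \<beta>" by (rule radial_ivp_le[OF a0 radial_sol_solves[OF ac a0]]) auto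
    \<comment> \<open>The threshold at r = 1 bounds \<lambda> uniformly in \<beta>, so the curve
      blows up at a finite value of \<lambda>.\<close>
    have "a 1 * exp (f \<beta> 1) < 16 + H_disc" using bound[of 0 \<beta>] by (simp add: A_def)
    then have "exp (f \<beta> 1) < (16 + H_disc) / a 1" using a(2)[of 1] by (simp add: pos_less_divide_eq mult.commute)
    then have "f \<beta> 1 \<le> ln ((16 + H_disc) / a 1)"
      using a(2)[of 1] H_disc_pos by (subst ln_ge_iff) auto
    then show "radial_sol 10 a \<beta> 1 \<le> ln ((16 + H_disc) / a 1)" by (simp add: f_def)
  qed
qed

section \<open>Linear equations on the half line\<close>

lemma at_within_Iic_eq: "t \<le> (0::real) \<Longrightarrow> a < t \<Longrightarrow> at t within {a..0} = at t within {..0}"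
  by (rule at_within_nhd[of t "{a<..}"]) auto

lemma continuous_on_Iic:
  assumes "\<And>a. a \<le> 0 \<Longrightarrow> continuous_on {a..0::real} f"
  shows "continuous_on {..0} f"
  unfolding continuous_on_eq_continuous_within
proof
  fix t :: real assume "t \<in> {..0}"
  then have "continuous (at t within {t - 1..0}) f"
    using assms[of "t - 1"] by (auto simp: continuous_on_eq_continuous_within)
  then show "continuous (at t within {..0}) f" using at_within_Iic_eq[of t "t - 1"] \<open>t \<in> {..0}\<close> by simp
qed

lemma hderiv_limit:
  assumes f: "\<And>n::nat. hderiv (f n) (f' n)"
    and u: "\<And>T e. T \<le> 0 \<Longrightarrow> e > 0 \<Longrightarrow> \<forall>\<^sub>F n in sequentially. \<forall>t\<in>{T..0}. \<bar>f' n t - g' t\<bar> \<le> e"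
    and l: "\<And>t. t \<le> 0 \<Longrightarrow> (\<lambda>n. f n t) \<longlonglongrightarrow> g t"
  shows "hderiv g g'"
proof (rule hderivI)
  fix t :: real assume t: "t \<le> 0"
  define S where "S = {t - 1..0}"
  have "\<exists>h. \<forall>x\<in>S. (\<lambda>n. f n x) \<longlonglongrightarrow> h x \<and> (h has_derivative (\<lambda>y. g' x * y)) (at x within S)"
  proof (rule has_derivative_sequence[of S f "\<lambda>n x y. f' n x * y" "\<lambda>x y. g' x * y" 0 "g 0"])
    show "(f n has_derivative (\<lambda>y. f' n x * y)) (at x within S)" if "x \<in> S" for n x
      using hderivD[OF f, of x n] that t unfolding has_field_derivative_def S_def
      by (auto intro: has_derivative_subset)
    show "\<forall>\<^sub>F n in sequentially. \<forall>x\<in>S. \<forall>h. norm (f' n x * h - g' x * h) \<le> e * norm h" if "e > 0" for e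
      using u[of "t - 1" e] t that unfolding S_def
      by (auto elim!: eventually_mono simp: abs_mult intro!: mult_right_mono simp flip: left_diff_distrib)
  qed (use t l in \<open>auto simp: S_def\<close>)
  then obtain h where h': "\<forall>x\<in>S. (\<lambda>n. f n x) \<longlonglongrightarrow> h x \<and> (h has_derivative (\<lambda>y. g' x * y)) (at x within S)"
    by blast
  have h: "\<And>x. x \<in> S \<Longrightarrow> (\<lambda>n. f n x) \<longlonglongrightarrow> h x" "(h has_real_derivative g' t) (at t within S)"
    using h' t unfolding has_field_derivative_def by (simp_all add: S_def)
  have "h x = g x" if "x \<in> S" for x
    using LIMSEQ_unique[OF h(1)[OF that] l[of x]] that by (simp add: S_def)
  then have "(g has_real_derivative g' t) (at t within S)"
    using has_field_derivative_transform_within[OF h(2) zero_less_one] t by (simp add: S_def)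
  then show "(g has_real_derivative g' t) (at t within {..0})"
    unfolding S_def using at_within_Iic_eq[of t "t - 1"] t by simp
qed

lemma hderiv_transfer: "hderiv f f' \<Longrightarrow> (\<And>t. t \<le> 0 \<Longrightarrow> f t = g t) \<Longrightarrow> hderiv g f'"
  unfolding hderiv_def by (auto intro: has_field_derivative_transform_within[OF _ zero_less_one])

lemma hderiv_integral:
  assumes "continuous_on {..0} f"
  shows "hderiv (\<lambda>t. integral {t..0} f) (\<lambda>t. - f t)"
proof (rule hderivI)
  fix t :: real assume t: "t \<le> 0"
  define a where "a = t - 1"
  have c: "continuous_on {a..0} f" by (rule continuous_on_subset[OF assms]) auto
  have "((\<lambda>s. integral {a..0} f - integral {a..s} f) has_real_derivative - f t) (at t within {a..0})"
    using integral_has_real_derivative[OF c, of t] t by (auto intro!: derivative_eq_intros simp: a_def)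
  moreover have "integral {a..0} f - integral {a..s} f = integral {s..0} f" if "s \<in> {a..0}" for s
    using Henstock_Kurzweil_Integration.integral_combine[of a s 0 f] that integrable_continuous_interval[OF c] by auto
  ultimately have "((\<lambda>s. integral {s..0} f) has_real_derivative - f t) (at t within {a..0})"
    by (elim has_field_derivative_transform_within[OF _ zero_less_one]) (use t in \<open>auto simp: a_def\<close>)
  then show "((\<lambda>s. integral {s..0} f) has_real_derivative - f t) (at t within {..0})"
    using at_within_Iic_eq[of t a] t by (simp add: a_def)
qed

text \<open>Picard iteration from \<open>t = 0\<close> to the left. The weight
  \<open>exp (- \<kappa> * t)\<close> allows for the growth of solutions, so the whole ray is
  treated at once; two integrations gain \<open>1 / \<kappa>^2\<close>, and
  \<open>\<kappa> = 2 * K + 1\<close> makes \<open>K / \<kappa>^2 \<le> 1/2\<close>.\<close>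

lemma linear_ode_exists:
  assumes p: "continuous_on {..0} p" and K: "\<And>t. t \<le> 0 \<Longrightarrow> \<bar>p t\<bar> \<le> K"
  obtains G G1 where "hderiv G G1" "hderiv G1 (\<lambda>t. - p t * G t)" "G 0 = 0" "G1 0 = 1"
proof -
  define \<kappa> where "\<kappa> = 2 * K + 1"
  have K0: "K \<ge> 0" using K[of 0] by simp
  then have \<kappa>: "\<kappa> \<ge> 1" "K / \<kappa>\<^sup>2 \<le> 1 / 2"
    by (auto simp: \<kappa>_def divide_le_eq power2_eq_square algebra_simps add_pos_nonneg intro: add_nonneg_nonneg)
  \<comment> \<open>The kernel \<open>s - t\<close> is split so that \<open>t\<close> occurs only as
    a factor and as a limit of integration, never under the integral that is to be
    differentiated.\<close>
  define T where "T = (\<lambda>u t. t - integral {t..0} (\<lambda>s. s * (p s * u s)) + t * integral {t..0} (\<lambda>s. p s * u s))"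
  have Td: "hderiv (T u) (\<lambda>t. 1 + integral {t..0} (\<lambda>s. p s * u s))" if u: "continuous_on {..0} u" for u
    unfolding T_def
    by (rule hderiv_cong[OF hderiv_add[OF hderiv_diff[OF hderiv_ident hderiv_integral] hderiv_mult[OF hderiv_ident hderiv_integral]]])
       (auto intro!: continuous_intros p u simp: algebra_simps)
  obtain G where G: "continuous_on {..0} G" "\<And>t. t \<le> 0 \<Longrightarrow> T G t = G t"
  proof (rule weighted_fixpoint[of "\<lambda>_. 0" "{u. continuous_on {..0} u}" T "{..0}" "\<lambda>t. exp (- \<kappa> * t)" 1])
    show "T u \<in> {u. continuous_on {..0} u}" if "u \<in> {u. continuous_on {..0} u}" for u
      using hderiv_cont[OF Td] that by auto
  next
    fix u w :: "real \<Rightarrow> real" and c t :: real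
    assume u: "u \<in> {u. continuous_on {..0} u}" and w: "w \<in> {u. continuous_on {..0} u}"
      and le: "\<And>y. y \<in> {..0} \<Longrightarrow> norm (u y - w y) \<le> c * exp (- \<kappa> * y)" and t: "t \<in> {..0}"
    have "norm (u 0 - w 0) \<le> c" using le[of 0] by simp
    then have c0: "c \<ge> 0" by (rule order_trans[OF norm_ge_zero])
    have int: "(\<lambda>s. h s * (p s * v s)) integrable_on {t..0}" if "continuous_on {..0} v" "continuous_on {..0} h" for v h
      by (rule integrable_continuous_interval, rule continuous_on_subset[of "{..0}"])
         (auto intro!: continuous_intros p that)
    have Tw: "T v t = t - integral {t..0} (\<lambda>s. (s - t) * (p s * v s))" if v: "continuous_on {..0} v" for v
    proof -
      have "integral {t..0} (\<lambda>s. (s - t) * (p s * v s)) = integral {t..0} (\<lambda>s. s * (p s * v s)) - integral {t..0} (\<lambda>s. t * (p s * v s))"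
        unfolding left_diff_distrib by (intro integral_diff int v continuous_intros)
      then show ?thesis by (simp add: T_def)
    qed
    have "norm (T u t - T w t) = norm (integral {t..0} (\<lambda>s. (s - t) * (p s * (u s - w s))))"
    proof -
      have "integral {t..0} (\<lambda>s. (s - t) * (p s * (u s - w s))) = integral {t..0} (\<lambda>s. (s - t) * (p s * u s)) - integral {t..0} (\<lambda>s. (s - t) * (p s * w s))"
        unfolding right_diff_distrib using u w by (intro integral_diff int continuous_intros) auto
      then show ?thesis using u w by (simp add: Tw)
    qed
    also have "\<dots> \<le> integral {t..0} (\<lambda>s. K * c * ((s - t) * exp (- \<kappa> * s)))"
    proof (rule integral_norm_bound_integral)
      show "(\<lambda>s. (s - t) * (p s * (u s - w s))) integrable_on {t..0}"
        using u w by (intro int continuous_intros) auto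
      show "(\<lambda>s. K * c * ((s - t) * exp (- \<kappa> * s))) integrable_on {t..0}"
        by (intro integrable_continuous_interval continuous_intros)
      fix s assume s: "s \<in> {t..0}"
      have "norm ((s - t) * (p s * (u s - w s))) = (s - t) * (\<bar>p s\<bar> * norm (u s - w s))" using s by (simp add: abs_mult)
      also have "\<dots> \<le> (s - t) * (K * (c * exp (- \<kappa> * s)))"
        using s K[of s] le[of s] K0 by (intro mult_left_mono mult_mono) auto
      finally show "norm ((s - t) * (p s * (u s - w s))) \<le> K * c * ((s - t) * exp (- \<kappa> * s))" by (simp add: mult_ac)
    qed
    also have "\<dots> = K * c * (t / \<kappa> - 1 / \<kappa>\<^sup>2 + exp (- \<kappa> * t) / \<kappa>\<^sup>2)"
    proof -
      define F where "F s = - ((s - t) * exp (- \<kappa> * s)) / \<kappa> - exp (- \<kappa> * s) / \<kappa>\<^sup>2" for s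
      have "((\<lambda>s. (s - t) * exp (- \<kappa> * s)) has_integral F 0 - F t) {t..0}"
      proof (rule fundamental_theorem_of_calculus)
        fix s assume "s \<in> {t..0}"
        have "(F has_real_derivative (s - t) * exp (- \<kappa> * s)) (at s within {t..0})"
          unfolding F_def using \<kappa>(1) by (auto intro!: derivative_eq_intros) (simp add: field_simps eval_nat_numeral)
        then show "(F has_vector_derivative (s - t) * exp (- \<kappa> * s)) (at s within {t..0})"
          by (simp add: has_real_derivative_iff_has_vector_derivative)
      qed (use t in auto)
      from integral_unique[OF this] show ?thesis by (simp add: F_def)
    qed
    also have "\<dots> \<le> K * c * (exp (- \<kappa> * t) / \<kappa>\<^sup>2)"
    proof (rule mult_left_mono)
      have "t / \<kappa> \<le> 0" "0 \<le> 1 / \<kappa>\<^sup>2" using t \<kappa>(1) by (auto simp: divide_nonpos_pos)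
      then show "t / \<kappa> - 1 / \<kappa>\<^sup>2 + exp (- \<kappa> * t) / \<kappa>\<^sup>2 \<le> exp (- \<kappa> * t) / \<kappa>\<^sup>2" by linarith
    qed (use K0 c0 in simp)
    also have "\<dots> = (K / \<kappa>\<^sup>2) * (c * exp (- \<kappa> * t))" by simp
    also have "\<dots> \<le> 1 / 2 * (c * exp (- \<kappa> * t))" using \<kappa>(2) c0 by (intro mult_right_mono) auto
    finally show "norm (T u t - T w t) \<le> c / 2 * exp (- \<kappa> * t)" by simp
  next
    fix t :: real assume t: "t \<in> {..0}"
    have "- t \<le> exp (- t)" using exp_ge_add_one_self[of "- t"] by linarith
    also have "\<dots> \<le> exp (- \<kappa> * t)" using t \<kappa>(1) mult_right_mono_neg[of 1 \<kappa> t] by simp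
    finally show "norm (T (\<lambda>_. 0) t - 0) \<le> 1 * exp (- \<kappa> * t)" using t by (simp add: T_def)
  next
    fix U :: "nat \<Rightarrow> real \<Rightarrow> real" and u
    assume U: "\<And>n. U n \<in> {u. continuous_on {..0} u}"
      and le: "\<And>n t. t \<in> {..0} \<Longrightarrow> norm (U n t - u t) \<le> 2 * 1 * (1/2) ^ n * exp (- \<kappa> * t)"
    have "continuous_on {a..0} u" if "a \<le> 0" for a
    proof (rule uniform_limit_theorem)
      show "uniform_limit {a..0} U u sequentially"
        by (rule geometric_uniform_limit[where B = "exp (- \<kappa> * a)" and C = 2 and \<omega> = "\<lambda>t. exp (- \<kappa> * t)"])
           (use le \<kappa> in \<open>auto simp: mult_left_mono\<close>)
      show "\<forall>\<^sub>F n in sequentially. continuous_on {a..0} (U n)"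
        using U by (auto intro!: always_eventually continuous_on_subset[of "{..0}" _ "{a..0}"])
    qed simp
    then show "u \<in> {u. continuous_on {..0} u}" using continuous_on_Iic by blast
  qed auto
  define G1 where "G1 = (\<lambda>t. 1 + integral {t..0} (\<lambda>s. p s * G s))"
  have "hderiv G1 (\<lambda>t. - p t * G t)" unfolding G1_def
    by (rule hderiv_cong[OF hderiv_add[OF hderiv_const hderiv_integral]]) (auto intro!: continuous_intros p G)
  moreover have "hderiv G G1" using hderiv_transfer[OF Td[OF G(1)] G(2)] by (simp add: G1_def)
  moreover have "G 0 = 0" using G(2)[of 0] by (simp add: T_def)
  moreover have "G1 0 = 1" by (simp add: G1_def)
  ultimately show ?thesis using that by blast
qed

text \<open>With \<open>a = G - t G1\<close> and \<open>b = G1\<close> one has \<open>G = a + t b\<close> and \<open>a\<^sup>2 + b\<^sup>2\<close> stays between positive constants,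
  because the potential is integrable against \<open>(1 + \<bar>t\<bar>)\<^sup>2\<close>.\<close>

lemma linear_ode_asymptotics:
  assumes G: "hderiv G G1" "hderiv G1 (\<lambda>t. - p t * G t)" and G0: "G1 0 \<noteq> 0"
    and p: "\<And>t. t \<le> 0 \<Longrightarrow> \<bar>p t\<bar> \<le> K * exp (2 * t)"
  obtains c N T where "c > 0" "N > 0" "T < 0" "\<And>t. t \<le> T \<Longrightarrow> \<bar>G t\<bar> \<ge> c"
    "\<And>t. t \<le> 0 \<Longrightarrow> \<bar>G t\<bar> \<le> N * (1 - t)" "\<And>t. t \<le> 0 \<Longrightarrow> \<bar>G1 t\<bar> \<le> N"
proof -
  have K0: "K \<ge> 0" using p[of 0] by simp
  define L where "L = 8 * K"
  define a where "a = (\<lambda>t. G t - t * G1 t)"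
  have a: "hderiv a (\<lambda>t. t * (p t * G t))" unfolding a_def
    by (rule hderiv_cong[OF hderiv_diff[OF G(1) hderiv_mult[OF hderiv_ident G(2)]]]) (simp add: algebra_simps)
  define E where "E = (\<lambda>t. (a t)\<^sup>2 + (G1 t)\<^sup>2)"
  define E1 where "E1 = (\<lambda>t. 2 * a t * (t * (p t * G t)) - 2 * G1 t * (p t * G t))"
  have E: "hderiv E E1" unfolding E_def power2_eq_square
    by (rule hderiv_cong[OF hderiv_add[OF hderiv_mult[OF a a] hderiv_mult[OF G(2) G(2)]]]) (simp add: E1_def algebra_simps)
  have Gab: "G t = a t + t * G1 t" for t by (simp add: a_def)
  have Enn: "E t \<ge> 0" for t by (simp add: E_def)
  have aE: "\<bar>a t\<bar> \<le> sqrt (E t)" "\<bar>G1 t\<bar> \<le> sqrt (E t)" for t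
    by (auto simp: E_def intro!: real_le_rsqrt)
  \<comment> \<open>The weight \<open>(1 - t)^2\<close> costs only a factor
    \<open>exp (- t)\<close>; of the decay \<open>exp (2 * t)\<close> of the potential the
    integrable rate \<open>exp t\<close> remains in \<open>E1b\<close>.\<close>
  have lin: "1 - t \<le> 2 * exp (- t / 2)" "(1 - t)\<^sup>2 \<le> 4 * exp (- t)" if "t \<le> 0" for t :: real
  proof -
    show 1: "1 - t \<le> 2 * exp (- t / 2)" using exp_ge_add_one_self[of "- t / 2"] by simp
    have "(1 - t)\<^sup>2 \<le> (2 * exp (- t / 2))\<^sup>2" using 1 that by (intro power_mono) auto
    also have "\<dots> = 4 * exp (- t)" by (simp add: power_mult_distrib exp_double[symmetric])
    finally show "(1 - t)\<^sup>2 \<le> 4 * exp (- t)" .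
  qed
  have Gs: "\<bar>G t\<bar> \<le> (1 - t) * sqrt (E t)" if "t \<le> 0" for t
  proof -
    have "\<bar>G t\<bar> \<le> \<bar>a t\<bar> + \<bar>t\<bar> * \<bar>G1 t\<bar>" unfolding Gab abs_mult[symmetric] by (rule abs_triangle_ineq)
    also have "\<dots> \<le> sqrt (E t) + \<bar>t\<bar> * sqrt (E t)" by (intro add_mono mult_left_mono aE) auto
    finally show ?thesis using that by (simp add: algebra_simps)
  qed
  have E1b: "\<bar>E1 t\<bar> \<le> L * exp t * E t" if t: "t \<le> 0" for t
  proof -
    have s: "sqrt (E t) * sqrt (E t) = E t" using Enn by simp
    have "E1 t = 2 * p t * (G t * (t * a t - G1 t))" by (simp add: E1_def algebra_simps)
    then have "\<bar>E1 t\<bar> = 2 * \<bar>p t\<bar> * (\<bar>G t\<bar> * \<bar>t * a t - G1 t\<bar>)" by (simp add: abs_mult)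
    also have "\<dots> \<le> 2 * (K * exp (2 * t)) * (((1 - t) * sqrt (E t)) * ((1 - t) * sqrt (E t)))"
    proof (intro mult_mono Gs t mult_left_mono p)
      have "\<bar>t * a t - G1 t\<bar> \<le> \<bar>t\<bar> * \<bar>a t\<bar> + \<bar>G1 t\<bar>" unfolding abs_mult[symmetric] by (rule abs_triangle_ineq4)
      also have "\<dots> \<le> \<bar>t\<bar> * sqrt (E t) + sqrt (E t)" by (intro add_mono mult_left_mono aE) auto
      finally show "\<bar>t * a t - G1 t\<bar> \<le> (1 - t) * sqrt (E t)" using t by (simp add: algebra_simps)
    qed (use t K0 Enn in auto)
    also have "\<dots> = 2 * K * exp (2 * t) * ((1 - t)\<^sup>2 * E t)" using s by (simp add: power2_eq_square mult_ac)
    also have "\<dots> \<le> 2 * K * exp (2 * t) * ((4 * exp (- t)) * E t)"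
      using lin(2)[OF t] K0 Enn by (intro mult_left_mono mult_right_mono) auto
    also have "\<dots> = L * (exp (2 * t) * exp (- t)) * E t" by (simp add: L_def)
    also have "exp (2 * t) * exp (- t) = exp t" by (simp flip: exp_add)
    finally show ?thesis .
  qed
  have ex: "hderiv (\<lambda>t. exp (m * exp (1 * t))) (\<lambda>t. m * exp t * exp (m * exp (1 * t)))" for m
    by (rule hderivI) (auto intro!: derivative_eq_intros)
  have upper: "E t \<le> E 0 * exp L" if t: "t \<le> 0" for t
  proof -
    have "E t * exp (L * exp (1 * t)) \<le> E 0 * exp (L * exp (1 * 0))"
    proof (rule hderiv_mono[OF hderiv_mult[OF E ex] t order.refl])
      fix s :: real assume s: "s < 0"
      have "0 \<le> (E1 s + L * exp s * E s) * exp (L * exp (1 * s))" using E1b[of s] s by (intro mult_nonneg_nonneg) auto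
      then show "0 \<le> E1 s * exp (L * exp (1 * s)) + L * exp s * exp (L * exp (1 * s)) * E s" by (simp add: algebra_simps)
    qed
    moreover have "E t * 1 \<le> E t * exp (L * exp (1 * t))" using Enn K0 by (intro mult_left_mono) (auto simp: L_def)
    ultimately show ?thesis by simp
  qed
  have lower: "E t \<ge> E 0 * exp (- L)" if t: "t \<le> 0" for t
  proof -
    have "- (E t * exp (- L * exp (1 * t))) \<le> - (E 0 * exp (- L * exp (1 * 0)))"
    proof (rule hderiv_mono[OF hderiv_minus[OF hderiv_mult[OF E ex]] t order.refl])
      fix s :: real assume s: "s < 0"
      have "0 \<le> (L * exp s * E s - E1 s) * exp (- L * exp (1 * s))" using E1b[of s] s by (intro mult_nonneg_nonneg) auto
      then show "0 \<le> - (E1 s * exp (- L * exp (1 * s)) + - L * exp s * exp (- L * exp (1 * s)) * E s)" by (simp add: algebra_simps)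
    qed
    moreover have "E t * exp (- L * exp (1 * t)) \<le> E t * 1" using Enn K0 by (intro mult_left_mono) (auto simp: L_def)
    ultimately show ?thesis by simp
  qed
  have E0: "E 0 > 0" using G0 by (simp add: E_def add_nonneg_pos)
  define N where "N = sqrt (E 0 * exp L)"
  have N: "N > 0" using E0 by (simp add: N_def)
  have sN: "sqrt (E t) \<le> N" if "t \<le> 0" for t unfolding N_def using upper[OF that] by (rule real_sqrt_le_mono)
  have GN: "\<bar>G t\<bar> \<le> N * (1 - t)" if "t \<le> 0" for t
    using order_trans[OF Gs[OF that] mult_left_mono[OF sN[OF that], of "1 - t"]] that by (simp add: mult.commute)
  have G1N: "\<bar>G1 t\<bar> \<le> N" if "t \<le> 0" for t using aE(2)[of t] sN[OF that] by linarith
  define k where "k = 2 * K * N"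
  have k0: "k \<ge> 0" using K0 N by (simp add: k_def)
  have pG: "\<bar>p t * G t\<bar> \<le> k * exp t" if t: "t \<le> 0" for t
  proof -
    have "\<bar>p t * G t\<bar> \<le> (K * exp (2 * t)) * (N * (1 - t))"
      unfolding abs_mult using p[OF t] GN[OF t] K0 by (intro mult_mono) auto
    also have "\<dots> \<le> (K * exp (2 * t)) * (N * (2 * exp (- t / 2)))"
      using lin(1)[OF t] K0 N by (intro mult_left_mono) auto
    also have "\<dots> = k * (exp (2 * t) * exp (- t / 2))" by (simp add: k_def)
    also have "\<dots> \<le> k * exp t" using k0 t by (intro mult_left_mono) (auto simp flip: exp_add)
    finally show ?thesis .
  qed
  have ekt: "hderiv (\<lambda>t. k * exp (1 * t)) (\<lambda>t. k * (1 * exp (1 * t)))" by (rule hderiv_cmult[OF hderiv_exp])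
  have G1v: "\<bar>G1 t - G1 s\<bar> \<le> k * exp t" if st: "s \<le> t" "t \<le> 0" for s t
  proof -
    have b: "- (p y * G y) + k * (1 * exp (1 * y)) \<ge> 0" "k * (1 * exp (1 * y)) - - (p y * G y) \<ge> 0" if "y < t" for y
      using pG[of y] that st by (simp_all add: abs_le_iff)
    have "G1 s + k * exp (1 * s) \<le> G1 t + k * exp (1 * t)"
      by (rule hderiv_mono[OF hderiv_add[OF G(2) ekt] st]) (use b in simp)
    moreover have "k * exp (1 * s) - G1 s \<le> k * exp (1 * t) - G1 t"
      by (rule hderiv_mono[OF hderiv_diff[OF ekt G(2)] st]) (use b in simp)
    moreover have "k * exp s \<ge> 0" using k0 by simp
    ultimately show ?thesis by (simp add: abs_le_iff)
  qed
  \<comment> \<open>\<open>G1\<close> has a limit at -infinity and is within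
    \<open>k * exp t\<close> of it. If some value exceeds this error, the limit is nonzero and
    \<open>G\<close> grows linearly; otherwise \<open>G1\<close> decays, and the lower bound for
    \<open>E\<close> has to come from \<open>a\<close>.\<close>
  have "\<exists>c T. c > 0 \<and> T < 0 \<and> (\<forall>t\<le>T. c \<le> \<bar>G t\<bar>)"
  proof (cases "\<exists>s\<le>0. \<bar>G1 s\<bar> > k * exp s")
    case True
    then obtain s where s: "s \<le> 0" "\<bar>G1 s\<bar> > k * exp s" by blast
    define d where "d = \<bar>G1 s\<bar> - k * exp s"
    have d: "d > 0" using s by (simp add: d_def)
    \<comment> \<open>Far enough to the left that \<open>\<bar>t * G1 t\<bar> \<ge> N + 1\<close>,
      which beats \<open>\<bar>a t\<bar> \<le> N\<close>.\<close>
    define T where "T = min s (- (N + 1) / d) - 1"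
    have "1 \<le> \<bar>G t\<bar>" if t: "t \<le> T" for t
    proof -
      have t0: "t \<le> s" "t \<le> 0" using t s by (auto simp: T_def)
      have "\<bar>G1 t\<bar> \<ge> d" using G1v[OF t0(1) s(1)] unfolding d_def by linarith
      moreover have "t \<le> - ((N + 1) / d)" using t unfolding T_def minus_divide_left by linarith
      then have "- t \<ge> (N + 1) / d" by simp
      ultimately have "(- t) * \<bar>G1 t\<bar> \<ge> (N + 1) / d * d" using d N t0 by (intro mult_mono) auto
      then have "\<bar>t * G1 t\<bar> \<ge> N + 1" using d t0 by (simp add: abs_mult)
      moreover have "\<bar>a t\<bar> \<le> N" using aE(1)[of t] sN[OF t0(2)] by linarith
      ultimately show ?thesis unfolding Gab by linarith
    qed
    then show ?thesis using s by (intro exI[of _ 1] exI[of _ T]) (auto simp: T_def)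
  next
    case False
    define e where "e = sqrt (E 0 * exp (- L))"
    have e: "e > 0" using E0 by (simp add: e_def)
    have "((\<lambda>t. k * ((1 - t) * exp t)) \<longlongrightarrow> 0) at_bot" by real_asymp
    then have "\<forall>\<^sub>F t in at_bot. k * ((1 - t) * exp t) < e / 4" using e by (intro order_tendstoD) auto
    then obtain T' where T': "\<And>t. t \<le> T' \<Longrightarrow> k * ((1 - t) * exp t) < e / 4" by (auto simp: eventually_at_bot_linorder)
    have "e / 4 \<le> \<bar>G t\<bar>" if t: "t \<le> min T' (-1)" for t
    proof -
      have t0: "t \<le> 0" "t \<le> T'" using t by auto
      have g1: "\<bar>G1 t\<bar> \<le> k * exp t" using False t0 by force
      have "(1 - t) * \<bar>G1 t\<bar> \<le> (1 - t) * (k * exp t)" using g1 t0 by (intro mult_left_mono) auto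
      also have "\<dots> = k * ((1 - t) * exp t)" by simp
      also have "\<dots> \<le> e / 4" using T'[OF t0(2)] by simp
      finally have s: "(1 - t) * \<bar>G1 t\<bar> \<le> e / 4" .
      have "\<bar>G1 t\<bar> \<le> (1 - t) * \<bar>G1 t\<bar>" "\<bar>t * G1 t\<bar> \<le> (1 - t) * \<bar>G1 t\<bar>"
        using t0 mult_right_mono[of 1 "1 - t" "\<bar>G1 t\<bar>"] by (auto simp: abs_mult left_diff_distrib)
      then have b: "\<bar>G1 t\<bar> \<le> e / 4" "\<bar>t * G1 t\<bar> \<le> e / 4" using s by linarith+
      have "e\<^sup>2 \<le> E t" using lower[OF t0(1)] E0 by (simp add: e_def)
      moreover have "(G1 t)\<^sup>2 \<le> (e / 4)\<^sup>2" using power_mono[OF b(1), of 2] by simp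
      ultimately have "(e / 2)\<^sup>2 \<le> (a t)\<^sup>2" unfolding E_def by (simp add: power_divide) (use zero_le_power2[of e] in linarith)
      then have "e / 2 \<le> \<bar>a t\<bar>" using e by (simp add: abs_le_square_iff[symmetric])
      then show ?thesis unfolding Gab using b(2) e by linarith
    qed
    then show ?thesis using e by (intro exI[of _ "e / 4"] exI[of _ "min T' (-1)"]) auto
  qed
  then show ?thesis using that N GN G1N by blast
qed

section \<open>The singular solution\<close>

text \<open>\<open>A t\<close> stands for \<open>a (exp t)\<close>. The lower bound holds because
  \<open>a / a_H\<close> increases from 1 and \<open>a_H \<ge> 1\<close>, the upper one by the
  quadratic bound at the centre. H enters only in \<open>not_all_ordered\<close>; what precedes
  concerns the approach to the singular solution.\<close>

locale radial_III =
  fixes A :: "real \<Rightarrow> real" and C :: real and x x1 :: "real \<Rightarrow> real \<Rightarrow> real"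
  assumes A_cont: "continuous_on {..0} A" and A_ge: "\<And>t. t \<le> 0 \<Longrightarrow> 1 \<le> A t"
    and A_le: "\<And>t. t \<le> 0 \<Longrightarrow> A t \<le> 1 + C * exp (2 * t)" and C: "C > 0"
    and sol: "\<And>\<beta>. logsol A \<beta> (x \<beta>) (x1 \<beta>)"
begin

text \<open>For \<open>a = 1\<close> the singular solution is \<open>log (16/r\<^sup>2)\<close>; \<open>X \<beta>\<close> is measured from it, and \<open>X1 \<beta>\<close> is its derivative.\<close>

definition X :: "real \<Rightarrow> real \<Rightarrow> real" where "X \<beta> t = x \<beta> t + 2 * t - ln 16"
definition X1 :: "real \<Rightarrow> real \<Rightarrow> real" where "X1 \<beta> t = x1 \<beta> t + 2"

section \<open>Bounds on regular solutions, uniform in the initial value\<close>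

lemma A_pos: "t \<le> 0 \<Longrightarrow> A t > 0" and A_le': "t \<le> 0 \<Longrightarrow> A t \<le> 1 + C"
proof -
  show "t \<le> 0 \<Longrightarrow> A t > 0" using A_ge[of t] by simp
  assume "t \<le> 0"
  then have "C * exp (2 * t) \<le> C * 1" using C by (intro mult_left_mono) auto
  then show "A t \<le> 1 + C" using A_le[OF \<open>t \<le> 0\<close>] by simp
qed

lemma exp_X: "16 * exp (X \<beta> t) = exp (2 * t) * exp (x \<beta> t)"
  by (simp add: X_def exp_add exp_diff)

lemma X_deriv: "hderiv (X \<beta>) (X1 \<beta>)"
  unfolding X_def X1_def by (rule hderivI) (auto intro!: derivative_eq_intros hderivD[OF logsolD(1)[OF sol]])

lemma X1_deriv: "hderiv (X1 \<beta>) (\<lambda>t. - 8 * X1 \<beta> t + 16 * (1 - A t * exp (X \<beta> t)))"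
proof (rule hderivI)
  fix t :: real assume "t \<le> 0"
  have "- 8 * X1 \<beta> t + 16 * (1 - A t * exp (X \<beta> t)) = - 8 * x1 \<beta> t - A t * (16 * exp (X \<beta> t))"
    by (simp add: X1_def algebra_simps)
  also have "\<dots> = - 8 * x1 \<beta> t - exp (2 * t) * A t * exp (x \<beta> t)" unfolding exp_X by simp
  finally show "(X1 \<beta> has_real_derivative - 8 * X1 \<beta> t + 16 * (1 - A t * exp (X \<beta> t))) (at t within {..0})"
    using hderivD[OF logsolD(2)[OF sol[of \<beta>]] \<open>t \<le> 0\<close>] unfolding X1_def by (auto intro!: derivative_eq_intros)
qed

text \<open>By \<open>A \<ge> 1\<close> and \<open>exp X \<ge> 1 + X\<close> the function
  \<open>exp (4 * t) * X\<close> is concave, and at -infinity both it and its slope tend to 0. So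
  regular solutions stay below \<open>log (16/r^2)\<close>.\<close>

lemma X_nonpos: assumes "t \<le> 0" shows "X \<beta> t \<le> 0"
proof -
  note xx = logsolD[OF sol[of \<beta>]]
  define Z where "Z = (\<lambda>t. - (exp (4 * t) * X \<beta> t))"
  define Z1 where "Z1 = (\<lambda>t. - (exp (4 * t) * (X1 \<beta> t + 4 * X \<beta> t)))"
  have Z: "hderiv Z Z1" unfolding Z_def
    by (rule hderiv_cong[OF hderiv_minus[OF hderiv_mult[OF hderiv_exp X_deriv]]]) (simp add: Z1_def algebra_simps)
  have Z1: "hderiv Z1 (\<lambda>t. 16 * exp (4 * t) * (A t * exp (X \<beta> t) - 1 - X \<beta> t))" unfolding Z1_def
    by (rule hderiv_cong[OF hderiv_minus[OF hderiv_mult[OF hderiv_exp hderiv_add[OF X1_deriv hderiv_cmult[OF X_deriv]]]]])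
       (simp add: algebra_simps)
  have Zl: "(Z \<longlongrightarrow> - 0) at_bot"
  proof -
    have e: "((\<lambda>t. exp (4 * t) * (x \<beta> t - ln 16)) \<longlongrightarrow> 0) at_bot"
      by (rule exp4_tendsto_0[OF tendsto_diff[OF xx(3) tendsto_const]])
    have "((\<lambda>t::real. exp (4 * t) * (2 * t)) \<longlongrightarrow> 0) at_bot" by real_asymp
    from tendsto_minus[OF tendsto_add[OF e this]] show ?thesis
      unfolding Z_def X_def by (simp add: algebra_simps)
  qed
  have Z1l: "(Z1 \<longlongrightarrow> 0) at_bot"
  proof -
    have "((\<lambda>t. X1 \<beta> t) \<longlongrightarrow> 0 + 2) at_bot" unfolding X1_def by (intro tendsto_intros xx)
    from tendsto_diff[OF tendsto_mult[OF tendsto_const[of 4] Zl] exp4_tendsto_0[OF this]]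
    moreover have "Z1 = (\<lambda>t. 4 * Z t - exp (4 * t) * X1 \<beta> t)"
      by (simp add: fun_eq_iff Z1_def Z_def algebra_simps)
    ultimately show ?thesis by simp
  qed
  have pos: "0 \<le> Z1 t" if "t \<le> 0" for t
  proof (rule hderiv_mono_from_bot[OF Z1 order.refl _ Z1l that])
    fix s :: real assume "s < 0"
    have "1 * exp (X \<beta> s) \<le> A s * exp (X \<beta> s)" using A_ge[of s] \<open>s < 0\<close> by (intro mult_right_mono) auto
    moreover have "1 + X \<beta> s \<le> exp (X \<beta> s)" by (rule exp_ge_add_one_self)
    ultimately have "0 \<le> A s * exp (X \<beta> s) - 1 - X \<beta> s" by linarith
    then show "0 \<le> 16 * exp (4 * s) * (A s * exp (X \<beta> s) - 1 - X \<beta> s)" by (intro mult_nonneg_nonneg) auto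
  qed
  have "- 0 \<le> Z t" by (rule hderiv_mono_from_bot[OF Z order.refl _ Zl assms]) (use pos in auto)
  then show ?thesis by (simp add: Z_def mult_le_0_iff)
qed

lemma AexpX_le: "t \<le> 0 \<Longrightarrow> A t * exp (X \<beta> t) \<le> 1 + C * exp (2 * t)"
  using mult_mono[of "A t" "1 + C * exp (2 * t)" "exp (X \<beta> t)" 1] A_le[of t] A_pos[of t] X_nonpos[of t \<beta>] C
  by (auto simp: add_nonneg_nonneg)

lemma X1_le: "t \<le> 0 \<Longrightarrow> X1 \<beta> t \<le> 2"
  using logsol_decreasing(1)[OF sol, of t \<beta>] A_pos by (force simp: X1_def less_imp_le)

lemma X1_ge: assumes "t \<le> 0" shows "X1 \<beta> t \<ge> - 2 * C * exp (2 * t)"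
proof -
  note xx = logsolD[OF sol[of \<beta>]]
  \<comment> \<open>With the integrating factor \<open>exp (8 * t)\<close> the source is at least
    \<open>- 16 * C * exp (10 * t)\<close>, whose antiderivative has the coefficient 16/10 =
    8/5.\<close>
  define Y where "Y = (\<lambda>t. exp (8 * t) * X1 \<beta> t + 8 / 5 * C * exp (10 * t))"
  have Y: "hderiv Y (\<lambda>t. exp (8 * t) * (16 * (1 + C * exp (2 * t) - A t * exp (X \<beta> t))))"
    unfolding Y_def
  proof (rule hderiv_cong[OF hderiv_add[OF hderiv_mult[OF hderiv_exp X1_deriv] hderiv_cmult[OF hderiv_exp]]])
    fix t :: real
    have "exp (10 * t) = exp (8 * t) * exp (2 * t)" by (simp flip: exp_add)
    then show "8 * exp (8 * t) * X1 \<beta> t + (- 8 * X1 \<beta> t + 16 * (1 - A t * exp (X \<beta> t))) * exp (8 * t) + 8 / 5 * C * (10 * exp (10 * t))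
      = exp (8 * t) * (16 * (1 + C * exp (2 * t) - A t * exp (X \<beta> t)))"
      by (simp add: algebra_simps)
  qed
  have X1l: "((\<lambda>t. X1 \<beta> t) \<longlongrightarrow> 0 + 2) at_bot" unfolding X1_def by (intro tendsto_intros xx)
  have "((\<lambda>t. 8 / 5 * C * exp (10 * t)) \<longlongrightarrow> 0) at_bot" by real_asymp
  from tendsto_add[OF exp8_tendsto_0[OF X1l] this] have Yl: "(Y \<longlongrightarrow> 0) at_bot" by (simp add: Y_def)
  have "0 \<le> Y t"
  proof (rule hderiv_mono_from_bot[OF Y order.refl _ Yl assms])
    fix s :: real assume "s < 0"
    then show "0 \<le> exp (8 * s) * (16 * (1 + C * exp (2 * s) - A s * exp (X \<beta> s)))"
      using AexpX_le[of s \<beta>] by (intro mult_nonneg_nonneg) auto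
  qed
  moreover have "exp (10 * t) = exp (8 * t) * exp (2 * t)" by (simp flip: exp_add)
  ultimately have "0 \<le> exp (8 * t) * (X1 \<beta> t + 8 / 5 * C * exp (2 * t))"
    by (simp add: Y_def algebra_simps)
  then have "X1 \<beta> t + 8 / 5 * C * exp (2 * t) \<ge> 0" by (simp add: zero_le_mult_iff)
  moreover have "8 / 5 * (C * exp (2 * t)) \<le> 2 * (C * exp (2 * t))" using C by (intro mult_right_mono) auto
  ultimately show ?thesis by simp
qed

lemma X_almost_mono: "s \<le> t \<Longrightarrow> t \<le> 0 \<Longrightarrow> X \<beta> s + C * exp (2 * s) \<le> X \<beta> t + C * exp (2 * t)"
proof (rule hderiv_mono[OF hderiv_add[OF X_deriv hderiv_cmult[OF hderiv_exp]]])
  fix y assume "y < t" "t \<le> 0"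
  then show "0 \<le> X1 \<beta> y + C * (2 * exp (2 * y))" using X1_ge[of y \<beta>] by simp
qed

lemma x_ge: assumes "t \<le> 0" shows "x \<beta> t \<ge> \<beta> - (1 + C) * exp (\<beta> + 2 * t) / 20"
proof -
  note xx = logsolD[OF sol[of \<beta>]]
  define k where "k = (1 + C) * exp \<beta>"
  have k: "k \<ge> 0" using C by (simp add: k_def)
  have x1_ge: "x1 \<beta> t \<ge> - k * exp (2 * t) / 10" if "t \<le> 0" for t
  proof -
    define Y where "Y = (\<lambda>t. exp (8 * t) * x1 \<beta> t + k / 10 * exp (10 * t))"
    have Y: "hderiv Y (\<lambda>t. exp (8 * t) * (exp (2 * t) * (k - A t * exp (x \<beta> t))))"
      unfolding Y_def
    proof (rule hderiv_cong[OF hderiv_add[OF hderiv_mult[OF hderiv_exp xx(2)] hderiv_cmult[OF hderiv_exp]]])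
      fix t :: real
      have "exp (10 * t) = exp (8 * t) * exp (2 * t)" by (simp flip: exp_add)
      then show "8 * exp (8 * t) * x1 \<beta> t + (- 8 * x1 \<beta> t - exp (2 * t) * A t * exp (x \<beta> t)) * exp (8 * t) + k / 10 * (10 * exp (10 * t))
        = exp (8 * t) * (exp (2 * t) * (k - A t * exp (x \<beta> t)))"
        by (simp add: algebra_simps)
    qed
    have "((\<lambda>t. k / 10 * exp (10 * t)) \<longlongrightarrow> 0) at_bot" by real_asymp
    from tendsto_add[OF exp8_tendsto_0[OF xx(4)] this] have Yl: "(Y \<longlongrightarrow> 0) at_bot" by (simp add: Y_def)
    have "0 \<le> Y t"
    proof (rule hderiv_mono_from_bot[OF Y order.refl _ Yl that])
      fix s :: real assume s: "s < 0"
      have "A s * exp (x \<beta> s) \<le> k" unfolding k_def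
        using s A_le'[of s] A_pos logsol_decreasing(2)[OF sol, of s \<beta>] C
        by (intro mult_mono) (auto simp: less_imp_le)
      then show "0 \<le> exp (8 * s) * (exp (2 * s) * (k - A s * exp (x \<beta> s)))" by simp
    qed
    moreover have "exp (10 * t) = exp (8 * t) * exp (2 * t)" by (simp flip: exp_add)
    ultimately have "0 \<le> exp (8 * t) * (x1 \<beta> t + k / 10 * exp (2 * t))"
      by (simp add: Y_def algebra_simps)
    then show ?thesis by (simp add: zero_le_mult_iff)
  qed
  have h: "hderiv (\<lambda>t. x \<beta> t + k / 20 * exp (2 * t)) (\<lambda>t. x1 \<beta> t + k / 20 * (2 * exp (2 * t)))"
    by (intro hderiv_add hderiv_cmult hderiv_exp xx)
  have l: "((\<lambda>t. x \<beta> t + k / 20 * exp (2 * t)) \<longlongrightarrow> \<beta> + 0) at_bot"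
    by (intro tendsto_add xx) real_asymp
  have "\<beta> + 0 \<le> x \<beta> t + k / 20 * exp (2 * t)"
  proof (rule hderiv_mono_from_bot[OF h order.refl _ l assms])
    fix s :: real assume "s < 0"
    then show "0 \<le> x1 \<beta> s + k / 20 * (2 * exp (2 * s))" using x1_ge[of s] by simp
  qed
  then show ?thesis by (simp add: k_def exp_add algebra_simps)
qed

definition M :: real where "M = (1 + C) / 20 + ln 16 + C"

text \<open>At \<open>t = - \<beta> / 2\<close>, where \<open>exp \<beta> * r^2 = 1\<close>, the
  regular solution is still within a constant of \<beta>. This is the scale at which it meets the
  singular profile; almost monotonicity carries the bound to the right.\<close>

lemma X_lower: assumes "- \<beta> / 2 \<le> t" "t \<le> 0" shows "X \<beta> t \<ge> - M"
proof -
  define s where "s = - \<beta> / 2"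
  have s: "s \<le> t" "s \<le> 0" "\<beta> + 2 * s = 0" using assms by (auto simp: s_def)
  have "X \<beta> s \<ge> - (1 + C) / 20 - ln 16" 
  proof -
    have "x \<beta> s \<ge> \<beta> - (1 + C) / 20" using x_ge[OF s(2), of \<beta>] unfolding s(3) by simp
    moreover have "2 * s = - \<beta>" using s(3) by simp
    ultimately show ?thesis unfolding X_def by (simp add: field_simps)
  qed
  moreover have "X \<beta> s + C * exp (2 * s) \<le> X \<beta> t + C * exp (2 * t)" by (rule X_almost_mono[OF s(1) assms(2)])
  moreover have "C * exp (2 * s) \<ge> 0" "C * exp (2 * t) \<le> C * 1" using C assms(2) by (auto intro!: mult_left_mono)
  ultimately show ?thesis unfolding M_def by linarith
qed

text \<open>From \<open>- \<beta> / 2\<close> on, \<open>X1 + 8 * X\<close> stays between constants,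
  yet it grows at rate at least \<open>2 * \<epsilon>\<close> where X is below
  \<open>- \<epsilon> / 2\<close>. So the waiting time \<open>k\<close> is bounded uniformly in
  \<beta>.\<close>

lemma X_small:
  assumes \<epsilon>: "0 < \<epsilon>" "\<epsilon> \<le> 1"
  obtains k T where "k > 0" "T < 0" "\<And>\<beta> t. - \<beta> / 2 + k \<le> t \<Longrightarrow> t \<le> T \<Longrightarrow> X \<beta> t \<ge> - \<epsilon>"
proof -
  have "((\<lambda>t. C * exp (2 * t)) \<longlongrightarrow> 0) at_bot" by real_asymp
  then have "\<forall>\<^sub>F t in at_bot. C * exp (2 * t) < \<epsilon> / 8" using \<epsilon> by (intro order_tendstoD) auto
  then obtain T' where T': "\<And>t. t \<le> T' \<Longrightarrow> C * exp (2 * t) < \<epsilon> / 8" by (auto simp: eventually_at_bot_linorder)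
  define T where "T = min T' (-1)"
  define k where "k = (2 + 2 * C + 8 * M) / (2 * \<epsilon>) + 1"
  have M: "M > 0" using C by (auto simp: M_def intro!: add_pos_pos)
  have k: "k > 0" using \<epsilon> C M by (auto simp: k_def intro!: add_pos_pos)
  have "X \<beta> t \<ge> - \<epsilon>" if t: "- \<beta> / 2 + k \<le> t" "t \<le> T" for \<beta> t
  proof (rule ccontr)
    assume neg: "\<not> X \<beta> t \<ge> - \<epsilon>"
    define s where "s = - \<beta> / 2"
    have st: "s < t" "t < 0" using t k by (auto simp: s_def T_def)
    define \<Phi> where "\<Phi> = (\<lambda>t. X1 \<beta> t + 8 * X \<beta> t)"
    have \<Phi>d: "hderiv \<Phi> (\<lambda>t. 16 * (1 - A t * exp (X \<beta> t)))" unfolding \<Phi>_def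
      by (rule hderiv_cong[OF hderiv_add[OF X1_deriv hderiv_cmult[OF X_deriv]]]) simp
    obtain y where y: "s < y" "y < t" "\<Phi> t - \<Phi> s = (t - s) * (16 * (1 - A y * exp (X \<beta> y)))"
      by (rule hderiv_mvt[OF \<Phi>d st(1)]) (use st in auto)
    have Cy: "C * exp (2 * y) < \<epsilon> / 8" "C * exp (2 * t) < \<epsilon> / 8" "C * exp (2 * y) > 0"
      using T' y t C by (auto simp: T_def)
    \<comment> \<open>Almost monotonicity read backwards: a value below \<open>- \<epsilon>\<close>
      at t keeps all earlier values below \<open>- \<epsilon> / 2\<close>.\<close>
    have "X \<beta> y \<le> - (\<epsilon> / 2)" using X_almost_mono[of y t \<beta>] y st neg Cy by simp
    then have "exp (X \<beta> y) \<le> exp (- (\<epsilon> / 2))" by simp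
    also have "\<dots> \<le> 1 / (1 + \<epsilon> / 2)"
      using exp_ge_add_one_self[of "\<epsilon> / 2"] \<epsilon> by (simp add: exp_minus inverse_eq_divide frac_le)
    finally have "A y * exp (X \<beta> y) \<le> (1 + \<epsilon> / 8) * (1 / (1 + \<epsilon> / 2))"
      using A_le[of y] A_pos[of y] y st Cy \<epsilon> by (intro mult_mono) auto
    also have "\<dots> \<le> 1 - \<epsilon> / 8"
    proof -
      have "(1 - \<epsilon> / 8) * (1 + \<epsilon> / 2) = 1 + 3 / 8 * \<epsilon> - \<epsilon> * \<epsilon> / 16" by (simp add: field_simps)
      moreover have "\<epsilon> * \<epsilon> \<le> \<epsilon> * 1" using \<epsilon> by (intro mult_left_mono) auto
      ultimately have "1 + \<epsilon> / 8 \<le> (1 - \<epsilon> / 8) * (1 + \<epsilon> / 2)" using \<epsilon> by linarith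
      then show ?thesis using \<epsilon> by (simp add: divide_le_eq)
    qed
    finally have "(t - s) * (2 * \<epsilon>) \<le> \<Phi> t - \<Phi> s" unfolding y(3) using st by (intro mult_left_mono) auto
    moreover have "\<Phi> t \<le> 2" using X1_le[of t \<beta>] X_nonpos[of t \<beta>] st by (simp add: \<Phi>_def)
    moreover have "\<Phi> s \<ge> - 2 * C - 8 * M"
    proof -
      have "C * exp (2 * s) \<le> C * 1" using C st by (intro mult_left_mono) auto
      then show ?thesis using X1_ge[of s \<beta>] X_lower[of \<beta> s] st by (simp add: \<Phi>_def s_def)
    qed
    ultimately have "(t - s) * (2 * \<epsilon>) \<le> 2 + 2 * C + 8 * M" by linarith
    then have "t - s \<le> (2 + 2 * C + 8 * M) / (2 * \<epsilon>)" using \<epsilon> by (simp add: pos_le_divide_eq)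
    then show False using t by (simp add: k_def s_def)
  qed
  then show ?thesis using that[of k T] k by (simp add: T_def)
qed

section \<open>Differences of regular solutions: early order and exponential decay\<close>

definition D :: "real \<Rightarrow> real \<Rightarrow> real \<Rightarrow> real" where "D \<beta> \<gamma> = scaled_diff (x \<beta>) (x \<gamma>)"
definition D1 :: "real \<Rightarrow> real \<Rightarrow> real \<Rightarrow> real" where "D1 \<beta> \<gamma> = scaled_diff1 (x \<beta>) (x1 \<beta>) (x \<gamma>) (x1 \<gamma>)"
definition P :: "real \<Rightarrow> real \<Rightarrow> real \<Rightarrow> real" where "P \<beta> \<gamma> = diff_potential A (x \<beta>) (x \<gamma>)"

lemma D_deriv: "hderiv (D \<beta> \<gamma>) (D1 \<beta> \<gamma>)" "hderiv (D1 \<beta> \<gamma>) (\<lambda>t. - P \<beta> \<gamma> t * D \<beta> \<gamma> t)"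
  and D_lim: "(D \<beta> \<gamma> \<longlongrightarrow> 0) at_bot" "(D1 \<beta> \<gamma> \<longlongrightarrow> 0) at_bot"
  and D_ev: "\<beta> < \<gamma> \<Longrightarrow> \<forall>\<^sub>F t in at_bot. D \<beta> \<gamma> t > 0"
  unfolding D_def D1_def P_def using scaled_diff[OF sol sol] by auto

lemma D_eq: "D \<beta> \<gamma> t = exp (4 * t) * (X \<gamma> t - X \<beta> t)"
  and D1_eq: "D1 \<beta> \<gamma> t = exp (4 * t) * (X1 \<gamma> t - X1 \<beta> t + 4 * (X \<gamma> t - X \<beta> t))"
  by (simp_all add: D_def D1_def scaled_diff_def scaled_diff1_def X_def X1_def)

lemma P_eq: "P \<beta> \<gamma> t = 16 * (A t * dquot (X \<beta> t) (X \<gamma> t) - 1)"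
proof -
  have "16 * dquot (X \<beta> t) (X \<gamma> t) = exp (2 * t) * dquot (x \<beta> t) (x \<gamma> t)"
    using exp_X[of \<beta> t] exp_X[of \<gamma> t] by (simp add: dquot_def X_def[abs_def] right_diff_distrib)
  then have "exp (2 * t) * A t * dquot (x \<beta> t) (x \<gamma> t) = A t * (16 * dquot (X \<beta> t) (X \<gamma> t))" by simp
  then show ?thesis by (simp add: P_def diff_potential_def)
qed

lemma dquot_X_le_1: "t \<le> 0 \<Longrightarrow> dquot (X \<beta> t) (X \<gamma> t) \<le> 1"
proof -
  assume t: "t \<le> 0"
  have "dquot (X \<beta> t) (X \<gamma> t) \<le> exp (max (X \<beta> t) (X \<gamma> t))"
    using dquot_bounds(2)[of "X \<beta> t" "X \<gamma> t"] dquot_bounds(2)[of "X \<gamma> t" "X \<beta> t"] dquot_commute[of "X \<beta> t" "X \<gamma> t"]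
    by (cases "X \<beta> t \<le> X \<gamma> t") (auto simp: max_def)
  also have "\<dots> \<le> 1" using X_nonpos[OF t] by simp
  finally show ?thesis .
qed

lemma P_le: "t \<le> 0 \<Longrightarrow> P \<beta> \<gamma> t \<le> 16 * C * exp (2 * t)"
  using mult_mono[of "A t" "1 + C * exp (2 * t)" "dquot (X \<beta> t) (X \<gamma> t)" 1] A_le[of t] A_pos[of t] dquot_X_le_1[of t \<beta> \<gamma>]
    dquot_pos[of "X \<beta> t" "X \<gamma> t"] C
  by (auto simp: P_eq add_nonneg_nonneg less_imp_le)

lemma P_abs: "t \<le> 0 \<Longrightarrow> \<bar>P \<beta> \<gamma> t\<bar> \<le> 16 * (1 + C)"
proof -
  assume t: "t \<le> 0"
  have "C * exp (2 * t) \<le> C * 1" using C t by (intro mult_left_mono) auto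
  moreover have "0 \<le> A t * dquot (X \<beta> t) (X \<gamma> t)"
    using A_pos[OF t] dquot_pos[of "X \<beta> t" "X \<gamma> t"] by simp
  moreover have "16 * (A t * dquot (X \<beta> t) (X \<gamma> t) - 1) \<le> 16 * (C * exp (2 * t))"
    using P_le[OF t, of \<beta> \<gamma>] by (simp add: P_eq mult.assoc)
  moreover have "\<bar>16 * (q - 1)\<bar> \<le> 16 * (1 + C)" if "e \<le> C" "0 \<le> q" "16 * (q - 1) \<le> 16 * e" for q e :: real
    using that C by (simp add: abs_le_iff)
  ultimately show ?thesis unfolding P_eq by auto
qed

text \<open>Left of this time the positive part of the potential is too small to destroy the order
  of two solutions, whatever \<beta> and \<gamma> are; further right the order is not
  guaranteed.\<close>

definition Ts :: real where "Ts = (SOME T. T < 0 \<and> C * exp (2 * T) \<le> 1/16)"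

lemma Ts: "Ts < 0" "C * exp (2 * Ts) \<le> 1/16"
proof -
  have "((\<lambda>t. C * exp (2 * t)) \<longlongrightarrow> 0) at_bot" by real_asymp
  then have "\<forall>\<^sub>F t in at_bot. C * exp (2 * t) < 1/16" by (intro order_tendstoD) auto
  then obtain T' where T': "\<And>t. t \<le> T' \<Longrightarrow> C * exp (2 * t) < 1/16" by (auto simp: eventually_at_bot_linorder)
  have "\<exists>T. T < 0 \<and> C * exp (2 * T) \<le> 1/16" using T'[of "min T' (-1)"] by (intro exI[of _ "min T' (-1)"]) auto
  from someI_ex[OF this] show "Ts < 0" "C * exp (2 * Ts) \<le> 1/16" by (auto simp: Ts_def)
qed

lemma Ts_le: "t \<le> Ts \<Longrightarrow> C * exp (2 * t) \<le> 1/16"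
  using Ts(2) C by (smt (verit) exp_le_cancel_iff mult_left_mono)

text \<open>The potential is at most \<open>16 * C * exp (2 * t)\<close>, for which
  \<open>p = 1 - 8 * C * exp (2 * t)\<close> is a positive supersolution left of \<open>Ts\<close>.
  The Wronskian with \<open>p\<close> bounds \<open>D1\<close> from below, the decrease of
  \<open>x \<gamma> - x \<beta>\<close> bounds it from above.\<close>

lemma D_pos_early:
  assumes "\<beta> < \<gamma>" "t < Ts"
  shows "D \<beta> \<gamma> t > 0" "\<bar>D1 \<beta> \<gamma> t\<bar> \<le> 4 * D \<beta> \<gamma> t"
proof -
  define p where "p = (\<lambda>t. 1 - 8 * C * exp (2 * t))"
  define p1 where "p1 = (\<lambda>t. - 16 * C * exp (2 * t))"
  have p: "hderiv p p1" "hderiv p1 (\<lambda>t. - 32 * C * exp (2 * t))"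
    unfolding p_def p1_def by (rule hderivI, auto intro!: derivative_eq_intros)+
  have p_ge: "p t \<ge> 1 / 2" if "t < Ts" for t using Ts_le[of t] that by (simp add: p_def)
  have lim: "((\<lambda>t. p t * D1 \<beta> \<gamma> t - D \<beta> \<gamma> t * p1 t) \<longlongrightarrow> 0) at_bot"
  proof -
    have "(p \<longlongrightarrow> 1) at_bot" "(p1 \<longlongrightarrow> 0) at_bot" unfolding p_def p1_def by real_asymp+
    then have "((\<lambda>t. p t * D1 \<beta> \<gamma> t - D \<beta> \<gamma> t * p1 t) \<longlongrightarrow> 1 * 0 - 0 * 0) at_bot"
      by (intro tendsto_intros D_lim)
    then show ?thesis by simp
  qed
  have le: "D \<beta> \<gamma> s * (- 32 * C * exp (2 * s)) \<le> p s * (- P \<beta> \<gamma> s * D \<beta> \<gamma> s)" if s: "s < Ts" "0 < D \<beta> \<gamma> s" for s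
  proof -
    have s0: "s \<le> 0" using s Ts by simp
    have "p s * P \<beta> \<gamma> s \<le> p s * (16 * C * exp (2 * s))"
      using p_ge[OF s(1)] P_le[OF s0] by (intro mult_left_mono) auto
    also have "\<dots> \<le> 1 * (16 * C * exp (2 * s))" using C by (intro mult_right_mono) (auto simp: p_def)
    also have "\<dots> \<le> 32 * C * exp (2 * s)" using C by simp
    finally have "D \<beta> \<gamma> s * (p s * P \<beta> \<gamma> s) \<le> D \<beta> \<gamma> s * (32 * C * exp (2 * s))"
      using s by (intro mult_left_mono) auto
    then show ?thesis by (simp add: algebra_simps)
  qed
  note st = sturm_positivity[OF D_deriv p less_imp_le[OF Ts(1)] D_ev[OF assms(1)] _ lim le]
  have pos: "D \<beta> \<gamma> t > 0" if "t < Ts" for t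
    by (rule st(1)) (use p_ge that in force)+
  then show Dt: "D \<beta> \<gamma> t > 0" using assms by blast
  have "p t * D1 \<beta> \<gamma> t - D \<beta> \<gamma> t * p1 t \<ge> 0"
    by (rule st(2)) (use p_ge assms in force)+
  moreover have "p1 t \<ge> - 1" using Ts_le[of t] assms by (simp add: p1_def)
  then have "D \<beta> \<gamma> t * p1 t \<ge> D \<beta> \<gamma> t * (- 1)" using Dt by (intro mult_left_mono) auto
  ultimately have "- D \<beta> \<gamma> t \<le> p t * D1 \<beta> \<gamma> t" by linarith
  then have "D1 \<beta> \<gamma> t \<ge> - (2 * D \<beta> \<gamma> t)"
  proof (cases "D1 \<beta> \<gamma> t \<ge> 0")
    case False
    then have "p t * D1 \<beta> \<gamma> t \<le> 1 / 2 * D1 \<beta> \<gamma> t" using p_ge[OF assms(2)] by (intro mult_right_mono_neg) auto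
    then show ?thesis using \<open>- D \<beta> \<gamma> t \<le> p t * D1 \<beta> \<gamma> t\<close> by simp
  qed (use Dt in simp)
  moreover have "D1 \<beta> \<gamma> t \<le> 4 * D \<beta> \<gamma> t"
  proof -
    have "x1 \<gamma> t - x1 \<beta> t < 0"
    proof (rule logsol_diff_decreasing(1)[OF sol sol A_pos, of t Ts])
      show "x \<beta> s < x \<gamma> s" if "s < Ts" for s
        using pos[OF that] by (simp add: D_eq X_def zero_less_mult_iff)
    qed (use assms Ts in auto)
    then have "exp (4 * t) * (X1 \<gamma> t - X1 \<beta> t) \<le> 0" by (simp add: X1_def mult_le_0_iff)
    then show ?thesis by (simp add: D_eq D1_eq algebra_simps)
  qed
  ultimately show "\<bar>D1 \<beta> \<gamma> t\<bar> \<le> 4 * D \<beta> \<gamma> t" using Dt by linarith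
qed

lemma X_mono_early: "\<beta> < \<gamma> \<Longrightarrow> t < Ts \<Longrightarrow> X \<beta> t < X \<gamma> t"
  using D_pos_early(1)[of \<beta> \<gamma> t] by (simp add: D_eq zero_less_mult_iff)

text \<open>Beyond \<open>Ts\<close> only the energy estimate is available. Its cost depends on T
  but not on \<beta> and \<gamma>; the factor 17 is 1 + 16, from
  \<open>\<bar>D1\<bar> \<le> 4 * D\<close> at T.\<close>

lemma D_growth:
  assumes "T < Ts"
  obtains K where "K > 0" "\<And>\<beta> \<gamma> t. \<beta> < \<gamma> \<Longrightarrow> T \<le> t \<Longrightarrow> t \<le> 0 \<Longrightarrow> \<bar>D \<beta> \<gamma> t\<bar> \<le> K * D \<beta> \<gamma> T \<and> \<bar>D1 \<beta> \<gamma> t\<bar> \<le> K * D \<beta> \<gamma> T"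
proof -
  define E where "E = 17 * exp ((1 + 16 * (1 + C)) * (- T))"
  have E: "E > 0" by (simp add: E_def)
  have T0: "T < 0" using assms Ts by simp
  show ?thesis
  proof (rule that[of "sqrt E"])
    fix \<beta> \<gamma> t :: real assume bg: "\<beta> < \<gamma>" and t: "T \<le> t" "t \<le> 0"
    note DT = D_pos_early[OF bg assms]
    have "(D \<beta> \<gamma> t)\<^sup>2 + (D1 \<beta> \<gamma> t)\<^sup>2 \<le> ((D \<beta> \<gamma> T)\<^sup>2 + (D1 \<beta> \<gamma> T)\<^sup>2) * exp ((1 + 16 * (1 + C)) * (t - T))"
      by (rule energy_gronwall[OF D_deriv _ t]) (use P_abs t in auto)
    also have "\<dots> \<le> ((D \<beta> \<gamma> T)\<^sup>2 + (4 * D \<beta> \<gamma> T)\<^sup>2) * exp ((1 + 16 * (1 + C)) * (- T))"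
    proof (intro mult_mono add_mono order.refl abs_le_square_iff[THEN iffD1])
      have "(1 + 16 * (1 + C)) * (t - T) \<le> (1 + 16 * (1 + C)) * (- T)" using t C by (intro mult_left_mono) auto
      then show "exp ((1 + 16 * (1 + C)) * (t - T)) \<le> exp ((1 + 16 * (1 + C)) * (- T))" by simp
    qed (use DT in auto)
    also have "\<dots> = (sqrt E * D \<beta> \<gamma> T)\<^sup>2" using E by (simp add: E_def power_mult_distrib)
    finally have le: "(D \<beta> \<gamma> t)\<^sup>2 + (D1 \<beta> \<gamma> t)\<^sup>2 \<le> (sqrt E * D \<beta> \<gamma> T)\<^sup>2" .
    have "\<bar>D \<beta> \<gamma> t\<bar>\<^sup>2 \<le> (sqrt E * D \<beta> \<gamma> T)\<^sup>2" "\<bar>D1 \<beta> \<gamma> t\<bar>\<^sup>2 \<le> (sqrt E * D \<beta> \<gamma> T)\<^sup>2"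
      using le zero_le_power2[of "D \<beta> \<gamma> t"] zero_le_power2[of "D1 \<beta> \<gamma> t"] unfolding power2_abs by linarith+
    then show "\<bar>D \<beta> \<gamma> t\<bar> \<le> sqrt E * D \<beta> \<gamma> T \<and> \<bar>D1 \<beta> \<gamma> t\<bar> \<le> sqrt E * D \<beta> \<gamma> T"
      using DT E by (meson power2_le_imp_le mult_nonneg_nonneg real_sqrt_ge_zero less_imp_le)
  qed (use E in simp)
qed

text \<open>At \<open>s = - \<beta> / 2 + k\<close> the scaling factor \<open>exp (4 * s)\<close>
  makes D small. From there on \<open>P \<ge> - 1\<close>, so D grows at most like
  \<open>exp (t - s)\<close>, and the product is of order \<open>exp (t + 3 * s)\<close>. The crude
  growth rate costs one of the four powers of \<open>exp s\<close>.\<close>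

lemma D_decay:
  obtains k T where "k > 0" "T < Ts"
    "\<And>\<beta> \<gamma> t. \<beta> < \<gamma> \<Longrightarrow> - \<beta> / 2 + k \<le> t \<Longrightarrow> t \<le> T \<Longrightarrow> D \<beta> \<gamma> t \<le> 5 / 2 * exp (t + 3 * (- \<beta> / 2 + k))"
proof -
  \<comment> \<open>The value 1/16 gives \<open>exp X \<ge> 15/16\<close> and thereby
    \<open>P \<ge> 16 * (15/16 - 1) = - 1\<close>.\<close>
  obtain k T0 where k: "k > 0" "T0 < 0" "\<And>\<beta> t. - \<beta> / 2 + k \<le> t \<Longrightarrow> t \<le> T0 \<Longrightarrow> X \<beta> t \<ge> - (1 / 16)"
    by (rule X_small[of "1/16"]) auto
  define T where "T = min T0 (Ts - 1)"
  have T: "T \<le> T0" "T < Ts" "T < 0" using Ts by (auto simp: T_def)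
  show ?thesis
  proof (rule that[of k T, OF k(1) T(2)])
    fix \<beta> \<gamma> t :: real assume bg: "\<beta> < \<gamma>" and t: "- \<beta> / 2 + k \<le> t" "t \<le> T"
    define s where "s = - \<beta> / 2 + k"
    have st: "s \<le> t" "t < Ts" "t \<le> 0" using t T by (auto simp: s_def)
    note De = D_pos_early[OF bg]
    have P_ge: "P \<beta> \<gamma> y \<ge> - 1" if "s \<le> y" "y \<le> T" for y
    proof -
      have y: "y \<le> 0" "y < Ts" using that T by auto
      have "X \<beta> y \<ge> - (1/16)" using that T by (intro k(3)) (auto simp: s_def)
      then have "1 - 1/16 \<le> exp (X \<beta> y)" using exp_ge_add_one_self[of "X \<beta> y"] by linarith
      also have "\<dots> \<le> dquot (X \<beta> y) (X \<gamma> y)" using X_mono_early[OF bg y(2)] by (intro dquot_bounds) simp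
      also have "\<dots> \<le> A y * dquot (X \<beta> y) (X \<gamma> y)"
        using A_ge[OF y(1)] dquot_pos[of "X \<beta> y" "X \<gamma> y"] by simp
      finally show ?thesis by (simp add: P_eq)
    qed
    have step1: "D1 \<beta> \<gamma> y - D \<beta> \<gamma> y \<le> 3 * D \<beta> \<gamma> s * exp (s - y)" if y: "s \<le> y" "y \<le> T" for y
    proof -
      have h: "hderiv (\<lambda>t. exp (1 * t) * (D \<beta> \<gamma> t - D1 \<beta> \<gamma> t)) (\<lambda>t. exp (1 * t) * ((1 + P \<beta> \<gamma> t) * D \<beta> \<gamma> t))"
        by (rule hderiv_cong[OF hderiv_mult[OF hderiv_exp hderiv_diff[OF D_deriv]]]) (simp add: algebra_simps)
      have "exp (1 * s) * (D \<beta> \<gamma> s - D1 \<beta> \<gamma> s) \<le> exp (1 * y) * (D \<beta> \<gamma> y - D1 \<beta> \<gamma> y)"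
      proof (rule hderiv_mono[OF h y(1)])
        fix z assume z: "s < z" "z < y"
        show "0 \<le> exp (1 * z) * ((1 + P \<beta> \<gamma> z) * D \<beta> \<gamma> z)"
          using P_ge[of z] De(1)[of z] z y T by (intro mult_nonneg_nonneg) auto
      qed (use y T in auto)
      then have "exp y * (D1 \<beta> \<gamma> y - D \<beta> \<gamma> y) \<le> exp s * (D1 \<beta> \<gamma> s - D \<beta> \<gamma> s)" by (simp add: algebra_simps)
      also have "\<dots> \<le> exp s * (3 * D \<beta> \<gamma> s)" using De(2)[of s] st by (intro mult_left_mono) auto
      also have "\<dots> = exp y * (3 * D \<beta> \<gamma> s * exp (s - y))" by (simp add: exp_diff)
      finally show ?thesis by simp
    qed
    \<comment> \<open>Minus the derivative of \<open>c * exp (- 2 * t)\<close> is the bound that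
      \<open>step1\<close> gives for the derivative of \<open>exp (- t) * D\<close>.\<close>
    define c where "c = 3 / 2 * exp s * D \<beta> \<gamma> s"
    have h2: "hderiv (\<lambda>t. - (exp (- 1 * t) * D \<beta> \<gamma> t + c * exp (- 2 * t)))
       (\<lambda>t. exp (- 1 * t) * (2 * c * exp (- 1 * t) - (D1 \<beta> \<gamma> t - D \<beta> \<gamma> t)))"
    proof (rule hderiv_cong[OF hderiv_minus[OF hderiv_add[OF hderiv_mult[OF hderiv_exp D_deriv(1)] hderiv_cmult[OF hderiv_exp]]]])
      fix t :: real
      have "exp (- 2 * t) = exp (- 1 * t) * exp (- 1 * t)" by (simp flip: exp_add)
      then show "- (- 1 * exp (- 1 * t) * D \<beta> \<gamma> t + D1 \<beta> \<gamma> t * exp (- 1 * t) + c * (- 2 * exp (- 2 * t)))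
         = exp (- 1 * t) * (2 * c * exp (- 1 * t) - (D1 \<beta> \<gamma> t - D \<beta> \<gamma> t))"
        by (simp add: algebra_simps)
    qed
    have "- (exp (- 1 * s) * D \<beta> \<gamma> s + c * exp (- 2 * s)) \<le> - (exp (- 1 * t) * D \<beta> \<gamma> t + c * exp (- 2 * t))"
    proof (rule hderiv_mono[OF h2 st(1,3)])
      fix z assume z: "s < z" "z < t"
      have "2 * c * exp (- 1 * z) = 3 * D \<beta> \<gamma> s * exp (s - z)" by (simp add: c_def exp_diff exp_minus field_simps)
      then show "0 \<le> exp (- 1 * z) * (2 * c * exp (- 1 * z) - (D1 \<beta> \<gamma> z - D \<beta> \<gamma> z))"
        using step1[of z] z t by (intro mult_nonneg_nonneg) auto
    qed
    moreover have "c * exp (- 2 * s) = 3 / 2 * exp (- s) * D \<beta> \<gamma> s"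
    proof -
      have "exp s * exp (- 2 * s) = exp (- s)" by (simp flip: exp_add)
      then show ?thesis by (simp add: c_def)
    qed
    moreover have "c * exp (- 2 * t) \<ge> 0" using De(1)[of s] st by (simp add: c_def)
    ultimately have "exp (- t) * D \<beta> \<gamma> t \<le> 5 / 2 * (exp (- s) * D \<beta> \<gamma> s)" by simp
    also have "exp (- s) * D \<beta> \<gamma> s = exp (3 * s) * (X \<gamma> s - X \<beta> s)"
    proof -
      have "exp (- s) * exp (4 * s) = exp (3 * s)" by (simp flip: exp_add)
      then show ?thesis by (simp add: D_eq flip: mult.assoc)
    qed
    also have "X \<gamma> s - X \<beta> s \<le> 1" using X_nonpos[of s \<gamma>] k(3)[of \<beta> s] st t T by (simp add: s_def)
    finally have "exp (- t) * D \<beta> \<gamma> t \<le> 5 / 2 * exp (3 * s)" by simp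
    then have "exp t * (exp (- t) * D \<beta> \<gamma> t) \<le> exp t * (5 / 2 * exp (3 * s))" by (intro mult_left_mono) auto
    moreover have "exp t * (exp (- t) * D \<beta> \<gamma> t) = D \<beta> \<gamma> t" by (simp add: exp_minus)
    ultimately show "D \<beta> \<gamma> t \<le> 5 / 2 * exp (t + 3 * (- \<beta> / 2 + k))"
      by (simp add: exp_add s_def mult_ac)
  qed
qed

text \<open>\<open>D_decay\<close> applies up to a fixed time and \<open>D_growth\<close> from there
  to 0; the rate is the factor \<open>exp (3 * (- \<beta> / 2))\<close> of the former. The threshold
  for \<beta> ensures \<open>- \<beta> / 2 + k \<le> T'\<close>.\<close>

lemma X_diff_decay:
  assumes "T \<le> 0"
  obtains K B where "K > 0"
    "\<And>\<beta> \<gamma> t. B \<le> \<beta> \<Longrightarrow> \<beta> < \<gamma> \<Longrightarrow> T \<le> t \<Longrightarrow> t \<le> 0 \<Longrightarrow> \<bar>X \<gamma> t - X \<beta> t\<bar> \<le> K * exp (- 3 / 2 * \<beta>) \<and> \<bar>X1 \<gamma> t - X1 \<beta> t\<bar> \<le> K * exp (- 3 / 2 * \<beta>)"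
proof -
  obtain k T0 where k: "k > 0" "T0 < Ts"
    "\<And>\<beta> \<gamma> t. \<beta> < \<gamma> \<Longrightarrow> - \<beta> / 2 + k \<le> t \<Longrightarrow> t \<le> T0 \<Longrightarrow> D \<beta> \<gamma> t \<le> 5 / 2 * exp (t + 3 * (- \<beta> / 2 + k))"
    by (rule D_decay) blast
  define T' where "T' = min T T0"
  have T': "T' \<le> T" "T' \<le> T0" "T' < Ts" using k(2) by (auto simp: T'_def)
  obtain K where K: "K > 0" "\<And>\<beta> \<gamma> t. \<beta> < \<gamma> \<Longrightarrow> T' \<le> t \<Longrightarrow> t \<le> 0 \<Longrightarrow> \<bar>D \<beta> \<gamma> t\<bar> \<le> K * D \<beta> \<gamma> T' \<and> \<bar>D1 \<beta> \<gamma> t\<bar> \<le> K * D \<beta> \<gamma> T'"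
    by (rule D_growth[OF T'(3)]) blast
  define L where "L = exp (- 4 * T') * (K * (5 / 2 * exp (T' + 3 * k)))"
  have L: "L > 0" using K by (simp add: L_def)
  show ?thesis
  proof (rule that[of "5 * L" "2 * (k - T')"])
    fix \<beta> \<gamma> t :: real assume *: "2 * (k - T') \<le> \<beta>" "\<beta> < \<gamma>" "T \<le> t" "t \<le> 0"
    have "D \<beta> \<gamma> T' \<le> 5 / 2 * exp (T' + 3 * (- \<beta> / 2 + k))" using * T' by (intro k) auto
    also have "\<dots> = 5 / 2 * exp (T' + 3 * k) * exp (- 3 / 2 * \<beta>)" by (simp flip: exp_add add: algebra_simps)
    finally have DT: "K * D \<beta> \<gamma> T' \<le> K * (5 / 2 * exp (T' + 3 * k) * exp (- 3 / 2 * \<beta>))" using K by (intro mult_left_mono) auto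
    have e: "exp (- 4 * t) * Y \<le> L * exp (- 3 / 2 * \<beta>)" if "Y \<le> K * D \<beta> \<gamma> T'" "0 \<le> Y" for Y
    proof -
      have "exp (- 4 * t) * Y \<le> exp (- 4 * T') * (K * (5 / 2 * exp (T' + 3 * k) * exp (- 3 / 2 * \<beta>)))"
        using T' * that(2) by (intro mult_mono order_trans[OF that(1) DT]) auto
      then show ?thesis by (simp add: L_def mult_ac)
    qed
    have 1: "\<bar>X \<gamma> t - X \<beta> t\<bar> = exp (- 4 * t) * \<bar>D \<beta> \<gamma> t\<bar>"
      by (simp add: D_eq abs_mult exp_minus)
    have "exp (- 4 * t) * exp (4 * t) = 1" by (simp flip: exp_add)
    then have 2: "X1 \<gamma> t - X1 \<beta> t = exp (- 4 * t) * D1 \<beta> \<gamma> t - 4 * (X \<gamma> t - X \<beta> t)"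
      unfolding D1_eq mult.assoc[symmetric] by simp
    have 3: "\<bar>X \<gamma> t - X \<beta> t\<bar> \<le> L * exp (- 3 / 2 * \<beta>)" unfolding 1 using K(2)[of \<beta> \<gamma> t] * T' by (intro e) auto
    have "\<bar>exp (- 4 * t) * D1 \<beta> \<gamma> t\<bar> \<le> L * exp (- 3 / 2 * \<beta>)"
      unfolding abs_mult abs_exp_cancel using K(2)[of \<beta> \<gamma> t] * T' by (intro e) auto
    moreover have "\<bar>a - 4 * b\<bar> \<le> 5 * c" if "\<bar>a\<bar> \<le> c" "\<bar>b\<bar> \<le> c" for a b c :: real
      using that by linarith
    ultimately have 4: "\<bar>X1 \<gamma> t - X1 \<beta> t\<bar> \<le> 5 * (L * exp (- 3 / 2 * \<beta>))" unfolding 2 using 3 by blast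
    have "L * exp (- 3 / 2 * \<beta>) \<ge> 0" using L by simp
    then show "\<bar>X \<gamma> t - X \<beta> t\<bar> \<le> 5 * L * exp (- 3 / 2 * \<beta>) \<and> \<bar>X1 \<gamma> t - X1 \<beta> t\<bar> \<le> 5 * L * exp (- 3 / 2 * \<beta>)"
      using 3 4 by (simp add: mult.assoc)
  qed (use L in simp)
qed

section \<open>The singular solution as limit of the regular ones\<close>

definition Xs :: "real \<Rightarrow> real" where "Xs t = lim (\<lambda>n. X (real n) t)"
definition Xs1 :: "real \<Rightarrow> real" where "Xs1 t = lim (\<lambda>n. X1 (real n) t)"

lemma Xs_lim: assumes "t \<le> 0" shows "(\<lambda>n. X (real n) t) \<longlonglongrightarrow> Xs t" "(\<lambda>n. X1 (real n) t) \<longlonglongrightarrow> Xs1 t"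
proof -
  obtain K B where K: "K > 0" "\<And>\<beta> \<gamma> s. B \<le> \<beta> \<Longrightarrow> \<beta> < \<gamma> \<Longrightarrow> t \<le> s \<Longrightarrow> s \<le> 0 \<Longrightarrow>
     \<bar>X \<gamma> s - X \<beta> s\<bar> \<le> K * exp (- 3 / 2 * \<beta>) \<and> \<bar>X1 \<gamma> s - X1 \<beta> s\<bar> \<le> K * exp (- 3 / 2 * \<beta>)"
    by (rule X_diff_decay[OF assms]) blast
  have C: "Cauchy (\<lambda>n. f (real n))"
    if f: "\<And>\<beta> \<gamma>. B \<le> \<beta> \<Longrightarrow> \<beta> < \<gamma> \<Longrightarrow> \<bar>f \<gamma> - f \<beta>\<bar> \<le> K * exp (- 3 / 2 * \<beta>)" for f :: "real \<Rightarrow> real"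
  proof (rule metric_CauchyI)
    fix e :: real assume "e > 0"
    have "((\<lambda>n. K * exp (- 3 / 2 * real n)) \<longlongrightarrow> 0) sequentially" by real_asymp
    then have "\<forall>\<^sub>F n in sequentially. K * exp (- 3 / 2 * real n) < e" using \<open>e > 0\<close> by (intro order_tendstoD) auto
    moreover have "\<forall>\<^sub>F n in sequentially. B \<le> real n" by real_asymp
    ultimately obtain N where N: "\<And>n. n \<ge> N \<Longrightarrow> K * exp (- 3 / 2 * real n) < e \<and> B \<le> real n"
      unfolding eventually_sequentially by (metis (no_types, lifting) le_trans nat_le_linear)
    have "dist (f (real m)) (f (real n)) < e" if "N \<le> m" "N \<le> n" for m n
    proof (cases m n rule: linorder_cases)
      case less
      then show ?thesis using f[of "real m" "real n"] N[OF that(1)] by (simp add: dist_real_def abs_minus_commute)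
    next
      case greater
      then show ?thesis using f[of "real n" "real m"] N[OF that(2)] by (simp add: dist_real_def)
    qed (use \<open>e > 0\<close> in simp)
    then show "\<exists>M. \<forall>m\<ge>M. \<forall>n\<ge>M. dist (f (real m)) (f (real n)) < e" by blast
  qed
  have "Cauchy (\<lambda>n. X (real n) t)" "Cauchy (\<lambda>n. X1 (real n) t)"
    using C[of "\<lambda>\<beta>. X \<beta> t"] C[of "\<lambda>\<beta>. X1 \<beta> t"] K(2) assms by auto
  then show "(\<lambda>n. X (real n) t) \<longlonglongrightarrow> Xs t" "(\<lambda>n. X1 (real n) t) \<longlonglongrightarrow> Xs1 t"
    unfolding Xs_def Xs1_def by (simp_all add: Cauchy_convergent_iff convergent_LIMSEQ_iff)
qed

lemma eventually_real_gt: "\<forall>\<^sub>F n in sequentially. real n > B"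
  by real_asymp

text \<open>The limit is taken along integer initial values; sending \<gamma> to infinity along them
  in \<open>X_diff_decay\<close> gives the rate for every real \<beta>.\<close>

lemma Xs_close:
  assumes "T \<le> 0"
  obtains K B where "K > 0" "\<And>\<beta> t. B \<le> \<beta> \<Longrightarrow> T \<le> t \<Longrightarrow> t \<le> 0 \<Longrightarrow>
     \<bar>Xs t - X \<beta> t\<bar> \<le> K * exp (- 3 / 2 * \<beta>) \<and> \<bar>Xs1 t - X1 \<beta> t\<bar> \<le> K * exp (- 3 / 2 * \<beta>)"
proof -
  obtain K B where K: "K > 0" "\<And>\<beta> \<gamma> s. B \<le> \<beta> \<Longrightarrow> \<beta> < \<gamma> \<Longrightarrow> T \<le> s \<Longrightarrow> s \<le> 0 \<Longrightarrow>
     \<bar>X \<gamma> s - X \<beta> s\<bar> \<le> K * exp (- 3 / 2 * \<beta>) \<and> \<bar>X1 \<gamma> s - X1 \<beta> s\<bar> \<le> K * exp (- 3 / 2 * \<beta>)"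
    by (rule X_diff_decay[OF assms]) blast
  show ?thesis
  proof (rule that[OF K(1), of B])
    fix \<beta> t assume *: "B \<le> \<beta>" "T \<le> t" "t \<le> 0"
    have ev: "\<forall>\<^sub>F n in sequentially. \<bar>X (real n) t - X \<beta> t\<bar> \<le> K * exp (- 3 / 2 * \<beta>) \<and> \<bar>X1 (real n) t - X1 \<beta> t\<bar> \<le> K * exp (- 3 / 2 * \<beta>)"
      using eventually_real_gt[of \<beta>] by eventually_elim (use K(2) * in blast)
    have "\<bar>Xs t - X \<beta> t\<bar> \<le> K * exp (- 3 / 2 * \<beta>)"
      by (rule tendsto_upperbound[of "\<lambda>n. \<bar>X (real n) t - X \<beta> t\<bar>" _ sequentially])
         (use ev in \<open>auto intro!: tendsto_intros Xs_lim * elim: eventually_mono\<close>)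
    moreover have "\<bar>Xs1 t - X1 \<beta> t\<bar> \<le> K * exp (- 3 / 2 * \<beta>)"
      by (rule tendsto_upperbound[of "\<lambda>n. \<bar>X1 (real n) t - X1 \<beta> t\<bar>" _ sequentially])
         (use ev in \<open>auto intro!: tendsto_intros Xs_lim * elim: eventually_mono\<close>)
    ultimately show "\<bar>Xs t - X \<beta> t\<bar> \<le> K * exp (- 3 / 2 * \<beta>) \<and> \<bar>Xs1 t - X1 \<beta> t\<bar> \<le> K * exp (- 3 / 2 * \<beta>)" by blast
  qed
qed

lemma Xs_uniform:
  assumes "T \<le> 0" "e > 0"
  shows "\<forall>\<^sub>F n in sequentially. \<forall>t\<in>{T..0}. \<bar>X (real n) t - Xs t\<bar> \<le> e \<and> \<bar>X1 (real n) t - Xs1 t\<bar> \<le> e"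
proof -
  obtain K B where K: "K > 0" "\<And>\<beta> t. B \<le> \<beta> \<Longrightarrow> T \<le> t \<Longrightarrow> t \<le> 0 \<Longrightarrow>
     \<bar>Xs t - X \<beta> t\<bar> \<le> K * exp (- 3 / 2 * \<beta>) \<and> \<bar>Xs1 t - X1 \<beta> t\<bar> \<le> K * exp (- 3 / 2 * \<beta>)"
    by (rule Xs_close[OF assms(1)]) blast
  have "((\<lambda>n. K * exp (- 3 / 2 * real n)) \<longlongrightarrow> 0) sequentially" by real_asymp
  then have "\<forall>\<^sub>F n in sequentially. K * exp (- 3 / 2 * real n) < e" using \<open>e > 0\<close> by (intro order_tendstoD) auto
  then show ?thesis using eventually_real_gt[of B]
  proof eventually_elim
    case (elim n)
    show ?case
    proof
      fix t assume "t \<in> {T..0}"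
      then have "\<bar>Xs t - X (real n) t\<bar> \<le> K * exp (- 3 / 2 * real n) \<and> \<bar>Xs1 t - X1 (real n) t\<bar> \<le> K * exp (- 3 / 2 * real n)"
        using elim K(2)[of "real n" t] by simp
      then show "\<bar>X (real n) t - Xs t\<bar> \<le> e \<and> \<bar>X1 (real n) t - Xs1 t\<bar> \<le> e"
        using elim by (simp add: abs_minus_commute)
    qed
  qed
qed

lemma Xs_nonpos: "t \<le> 0 \<Longrightarrow> Xs t \<le> 0"
  using tendsto_upperbound[OF Xs_lim(1)] X_nonpos by (auto intro: always_eventually)

lemma Xs_deriv: "hderiv Xs Xs1"
  by (rule hderiv_limit[of "\<lambda>n. X (real n)" "\<lambda>n. X1 (real n)", OF X_deriv _ Xs_lim(1)])
     (auto elim!: eventually_mono[OF Xs_uniform])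

lemma Xs1_deriv: "hderiv Xs1 (\<lambda>t. - 8 * Xs1 t + 16 * (1 - A t * exp (Xs t)))"
proof (rule hderiv_limit[of "\<lambda>n. X1 (real n)", OF X1_deriv _ Xs_lim(2)])
  fix T e :: real assume T: "T \<le> 0" and e: "e > 0"
  define d where "d = e / (8 + 16 * (1 + C))"
  have "8 + 16 * (1 + C) > 0" using C by simp
  then have d: "d > 0" "(8 + 16 * (1 + C)) * d = e" using e by (simp_all add: d_def)
  then have d: "d > 0" "8 * d + 16 * (1 + C) * d = e" by (simp_all add: algebra_simps)
  show "\<forall>\<^sub>F n in sequentially. \<forall>t\<in>{T..0}. \<bar>(- 8 * X1 (real n) t + 16 * (1 - A t * exp (X (real n) t))) - (- 8 * Xs1 t + 16 * (1 - A t * exp (Xs t)))\<bar> \<le> e"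
    using Xs_uniform[OF T d(1)]
  proof eventually_elim
    case (elim n)
    show ?case
    proof
      fix t assume t: "t \<in> {T..0}"
      then have t0: "t \<le> 0" by simp
      have 1: "\<bar>X (real n) t - Xs t\<bar> \<le> d" "\<bar>X1 (real n) t - Xs1 t\<bar> \<le> d" using elim t by auto
      have "\<bar>exp (X (real n) t) - exp (Xs t)\<bar> \<le> exp 0 * \<bar>X (real n) t - Xs t\<bar>"
        by (rule exp_diff_le) (use X_nonpos Xs_nonpos t0 in auto)
      then have "A t * \<bar>exp (X (real n) t) - exp (Xs t)\<bar> \<le> (1 + C) * d"
        using 1 A_pos[OF t0] A_le'[OF t0] by (intro mult_mono) auto
      then have 2: "\<bar>A t * (exp (X (real n) t) - exp (Xs t))\<bar> \<le> (1 + C) * d" using A_pos[OF t0] by (simp add: abs_mult)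
      have "(- 8 * X1 (real n) t + 16 * (1 - A t * exp (X (real n) t))) - (- 8 * Xs1 t + 16 * (1 - A t * exp (Xs t)))
        = - (8 * (X1 (real n) t - Xs1 t)) - 16 * (A t * (exp (X (real n) t) - exp (Xs t)))" by (simp add: algebra_simps)
      moreover have "\<bar>- (8 * u) - 16 * v\<bar> \<le> 8 * d + 16 * w" if "\<bar>u\<bar> \<le> d" "\<bar>v\<bar> \<le> w" for u v w :: real
        using that by linarith
      ultimately show "\<bar>(- 8 * X1 (real n) t + 16 * (1 - A t * exp (X (real n) t))) - (- 8 * Xs1 t + 16 * (1 - A t * exp (Xs t)))\<bar> \<le> e"
        using 1(2) 2 d(2) by (metis mult.assoc)
    qed
  qed
qed

lemma Xs1_bounds: assumes "t \<le> 0" shows "Xs1 t \<le> 2" "Xs1 t \<ge> - 2 * C"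
proof -
  have "X1 \<beta> t \<ge> - 2 * C" for \<beta>
  proof -
    have "2 * C * exp (2 * t) \<le> 2 * C * 1" using C assms by (intro mult_left_mono) auto
    then show ?thesis using X1_ge[OF assms, of \<beta>] by linarith
  qed
  then show "Xs1 t \<le> 2" "Xs1 t \<ge> - 2 * C"
    using tendsto_upperbound[OF Xs_lim(2)[OF assms], of 2] tendsto_lowerbound[OF Xs_lim(2)[OF assms], of "- 2 * C"]
      X1_le[OF assms] by (auto intro: always_eventually)
qed

lemma X_le_Xs: assumes "t < Ts" shows "X \<beta> t \<le> Xs t"
proof (rule tendsto_lowerbound[OF Xs_lim(1)])
  show "\<forall>\<^sub>F n in sequentially. X \<beta> t \<le> X (real n) t"
    using eventually_real_gt[of \<beta>] by eventually_elim (use X_mono_early assms in \<open>auto intro: less_imp_le\<close>)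
qed (use assms Ts in auto)

text \<open>By \<open>X_small\<close> the limit is at least \<open>- \<epsilon>\<close> far enough
  to the left, for any \<epsilon>; almost monotonicity transports this to t at the cost of
  \<open>C * exp (2 * t)\<close>. With \<open>Xs_nonpos\<close> this fixes the singular profile at
  the centre.\<close>

lemma Xs_ge: assumes t: "t \<le> 0" shows "Xs t \<ge> - C * exp (2 * t)"
proof (rule field_le_epsilon)
  fix e :: real assume "e > 0"
  define e' where "e' = min e 1"
  have e': "0 < e'" "e' \<le> 1" "e' \<le> e" using \<open>e > 0\<close> by (auto simp: e'_def)
  obtain k T where k: "k > 0" "T < 0" "\<And>\<beta> t. - \<beta> / 2 + k \<le> t \<Longrightarrow> t \<le> T \<Longrightarrow> X \<beta> t \<ge> - e'"
    by (rule X_small[OF e'(1,2)]) blast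
  define s where "s = min t T"
  have "Xs s \<ge> - e'"
  proof (rule tendsto_lowerbound[OF Xs_lim(1)])
    show "\<forall>\<^sub>F n in sequentially. - e' \<le> X (real n) s"
      using eventually_real_gt[of "2 * (k - s)"]
    proof eventually_elim
      case (elim n)
      then have "- real n / 2 + k \<le> s" by (simp add: field_simps)
      moreover have "s \<le> T" by (simp add: s_def)
      ultimately show ?case by (rule k(3))
    qed
  qed (use t in \<open>auto simp: s_def\<close>)
  moreover have "Xs s + C * exp (2 * s) \<le> Xs t + C * exp (2 * t)"
  proof (rule LIMSEQ_le)
    show "(\<lambda>n. X (real n) s + C * exp (2 * s)) \<longlonglongrightarrow> Xs s + C * exp (2 * s)"
      "(\<lambda>n. X (real n) t + C * exp (2 * t)) \<longlonglongrightarrow> Xs t + C * exp (2 * t)"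
      using t by (auto intro!: tendsto_intros Xs_lim simp: s_def)
    show "\<exists>N. \<forall>n\<ge>N. X (real n) s + C * exp (2 * s) \<le> X (real n) t + C * exp (2 * t)"
      using X_almost_mono[of s t] t by (auto simp: s_def)
  qed
  moreover have "C * exp (2 * s) \<ge> 0" using C by simp
  ultimately show "- C * exp (2 * t) \<le> Xs t + e" using e' by simp
qed

section \<open>Linearization at the singular solution\<close>

definition Ps :: "real \<Rightarrow> real" where "Ps t = 16 * (A t * exp (Xs t) - 1)"

lemma Ps_cont: "continuous_on {..0} Ps"
  unfolding Ps_def by (intro continuous_intros A_cont hderiv_cont[OF Xs_deriv]) auto

text \<open>The two-sided bound makes the linearized equation an integrable perturbation of
  \<open>G'' = 0\<close>, as \<open>linear_ode_asymptotics\<close> requires.\<close>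

lemma Ps_abs: assumes t: "t \<le> 0" shows "\<bar>Ps t\<bar> \<le> 16 * C * exp (2 * t)"
proof -
  have "A t * exp (Xs t) \<le> (1 + C * exp (2 * t)) * 1"
    using A_le[OF t] A_pos[OF t] Xs_nonpos[OF t] C by (intro mult_mono) auto
  moreover have "1 - C * exp (2 * t) \<le> A t * exp (Xs t)"
  proof -
    have "1 - C * exp (2 * t) \<le> exp (Xs t)" using Xs_ge[OF t] exp_ge_add_one_self[of "Xs t"] by linarith
    also have "\<dots> \<le> A t * exp (Xs t)" using A_ge[OF t] by simp
    finally show ?thesis .
  qed
  ultimately show ?thesis by (simp add: Ps_def abs_le_iff)
qed

lemma P_le_Ps: assumes "\<beta> < \<gamma>" "t < Ts" shows "P \<beta> \<gamma> t \<le> Ps t"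
proof -
  have "dquot (X \<beta> t) (X \<gamma> t) \<le> exp (X \<gamma> t)" using X_mono_early[OF assms] by (intro dquot_bounds) simp
  also have "\<dots> \<le> exp (Xs t)" using X_le_Xs[OF assms(2)] by simp
  finally show ?thesis using A_pos[of t] assms Ts by (simp add: P_eq Ps_def)
qed

lemma P_close:
  assumes "T \<le> 0"
  obtains K B where "K > 0" "\<And>\<beta> \<gamma> t. B \<le> \<beta> \<Longrightarrow> \<beta> < \<gamma> \<Longrightarrow> T \<le> t \<Longrightarrow> t \<le> 0 \<Longrightarrow> \<bar>Ps t - P \<beta> \<gamma> t\<bar> \<le> K * exp (- 3 / 2 * \<beta>)"
proof -
  obtain K B where K: "K > 0" "\<And>\<beta> t. B \<le> \<beta> \<Longrightarrow> T \<le> t \<Longrightarrow> t \<le> 0 \<Longrightarrow>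
     \<bar>Xs t - X \<beta> t\<bar> \<le> K * exp (- 3 / 2 * \<beta>) \<and> \<bar>Xs1 t - X1 \<beta> t\<bar> \<le> K * exp (- 3 / 2 * \<beta>)"
    by (rule Xs_close[OF assms]) blast
  show ?thesis
  proof (rule that[of "16 * (1 + C) * K" B])
    fix \<beta> \<gamma> t :: real assume *: "B \<le> \<beta>" "\<beta> < \<gamma>" "T \<le> t" "t \<le> 0"
    define r where "r = K * exp (- 3 / 2 * \<beta>)"
    have e: "\<bar>exp (X \<delta> t) - exp (Xs t)\<bar> \<le> r" if "\<beta> \<le> \<delta>" for \<delta>
    proof -
      have "\<bar>exp (X \<delta> t) - exp (Xs t)\<bar> \<le> exp 0 * \<bar>X \<delta> t - Xs t\<bar>"
        by (rule exp_diff_le) (use X_nonpos Xs_nonpos * in auto)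
      also have "\<dots> \<le> K * exp (- 3 / 2 * \<delta>)" using K(2)[of \<delta> t] that * by (simp add: abs_minus_commute)
      also have "\<dots> \<le> r" unfolding r_def using that K(1) by (intro mult_left_mono) auto
      finally show ?thesis .
    qed
    have b: "exp (min (X \<beta> t) (X \<gamma> t)) \<le> dquot (X \<beta> t) (X \<gamma> t)" "dquot (X \<beta> t) (X \<gamma> t) \<le> exp (max (X \<beta> t) (X \<gamma> t))"
      using dquot_bounds[of "X \<beta> t" "X \<gamma> t"] dquot_bounds[of "X \<gamma> t" "X \<beta> t"] dquot_commute[of "X \<beta> t" "X \<gamma> t"]
      by (cases "X \<beta> t \<le> X \<gamma> t"; auto simp: max_def min_def)+
    have "\<bar>exp (Xs t) - dquot (X \<beta> t) (X \<gamma> t)\<bar> \<le> r"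
      using b e[of \<beta>] e[of \<gamma>] *(2) by (auto simp: abs_le_iff max_def min_def split: if_splits)
    then have "A t * \<bar>exp (Xs t) - dquot (X \<beta> t) (X \<gamma> t)\<bar> \<le> (1 + C) * r"
      using A_pos[of t] A_le'[of t] * by (intro mult_mono) auto
    moreover have "\<bar>Ps t - P \<beta> \<gamma> t\<bar> = 16 * (A t * \<bar>exp (Xs t) - dquot (X \<beta> t) (X \<gamma> t)\<bar>)"
    proof -
      have "Ps t - P \<beta> \<gamma> t = 16 * (A t * (exp (Xs t) - dquot (X \<beta> t) (X \<gamma> t)))" by (simp add: Ps_def P_eq algebra_simps)
      then show ?thesis using A_pos[of t] * by (simp add: abs_mult)
    qed
    ultimately have "\<bar>Ps t - P \<beta> \<gamma> t\<bar> \<le> 16 * ((1 + C) * r)" by linarith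
    then show "\<bar>Ps t - P \<beta> \<gamma> t\<bar> \<le> 16 * (1 + C) * K * exp (- 3 / 2 * \<beta>)" by (simp only: r_def mult.assoc)
  qed (use K C in auto)
qed

text \<open>The Wronskian of \<open>D\<close> with a solution \<open>G\<close> of the limit equation vanishing at \<open>t1\<close>: its derivative
  \<open>G D (Ps - P)\<close> is positive and of order one near \<open>t = -\<beta>/2\<close>, where the regular solution leaves the singular
  one, and negligible afterwards.\<close>

lemma wronskian_sign:
  assumes G: "hderiv G G1" "hderiv G1 (\<lambda>t. - Ps t * G t)" and t1: "t1 \<le> 0" "G t1 = 0"
    and c: "c > 0" "\<And>t. t \<le> T0 \<Longrightarrow> G t \<ge> c"
    and N: "\<And>t. t \<le> 0 \<Longrightarrow> \<bar>G t\<bar> \<le> N * (1 - t)" "\<And>t. t \<le> 0 \<Longrightarrow> \<bar>G1 t\<bar> \<le> N"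
  obtains B where "\<And>\<beta> \<gamma>. B \<le> \<beta> \<Longrightarrow> \<beta> < \<gamma> \<Longrightarrow> D \<beta> \<gamma> t1 * G1 t1 < 0"
proof -
  define T where "T = min T0 (Ts - 1)"
  have T: "T \<le> T0" "T < Ts" "T < 0" using Ts by (auto simp: T_def)
  have "T < t1" using c(2)[of t1] t1 c(1) T by (cases "t1 \<le> T") auto
  have N0: "N \<ge> 0" using N(2)[of 0] abs_ge_zero[of "G1 0"] by linarith
  obtain K where K: "K > 0" "\<And>\<beta> \<gamma> t. \<beta> < \<gamma> \<Longrightarrow> T \<le> t \<Longrightarrow> t \<le> 0 \<Longrightarrow> \<bar>D \<beta> \<gamma> t\<bar> \<le> K * D \<beta> \<gamma> T \<and> \<bar>D1 \<beta> \<gamma> t\<bar> \<le> K * D \<beta> \<gamma> T"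
    by (rule D_growth[OF T(2)]) blast
  obtain Q B0 where Q: "Q > 0" "\<And>\<beta> \<gamma> t. B0 \<le> \<beta> \<Longrightarrow> \<beta> < \<gamma> \<Longrightarrow> T \<le> t \<Longrightarrow> t \<le> 0 \<Longrightarrow> \<bar>Ps t - P \<beta> \<gamma> t\<bar> \<le> Q * exp (- 3 / 2 * \<beta>)"
    by (rule P_close[OF less_imp_le[OF T(3)]]) blast
  define GT where "GT = N * (1 - T)"
  \<comment> \<open>\<open>k1\<close> and \<open>k2\<close> bound \<open>D T\<close> by
    \<open>w T\<close>: the part present at time \<open>- \<beta> / 2\<close>, and the growth over
    an interval of length at most \<open>\<beta> / 2\<close>. \<open>k3\<close> bounds the later
    change of \<open>w\<close> in terms of \<open>D T\<close>.\<close>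
  define k1 where "k1 = GT * (exp 4 / (3 * c\<^sup>2))"
  define k2 where "k2 = GT / (2 * c\<^sup>2)"
  define k3 where "k3 = (- T) * (GT * K * Q)"
  have GT: "GT \<ge> 0" "GT \<ge> c" using N0 T c(2)[of T] N(1)[of T] by (auto simp: GT_def)
  \<comment> \<open>The loss linear in \<beta>, due to the double root, against the exponential rate
    of \<open>P_close\<close>.\<close>
  have "((\<lambda>\<beta>. (k1 + k2 * \<beta>) * (k3 * exp (- 3 / 2 * \<beta>))) \<longlongrightarrow> 0) at_top" by real_asymp
  then have "\<forall>\<^sub>F \<beta> in at_top. (k1 + k2 * \<beta>) * (k3 * exp (- 3 / 2 * \<beta>)) < 1" by (rule order_tendstoD) simp
  then obtain B1 where B1: "\<And>\<beta>. B1 \<le> \<beta> \<Longrightarrow> (k1 + k2 * \<beta>) * (k3 * exp (- 3 / 2 * \<beta>)) < 1"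
    by (auto simp: eventually_at_top_linorder)
  show ?thesis
  proof (rule that[of "max (max B0 B1) (- 2 * T)"])
    fix \<beta> \<gamma> :: real assume "max (max B0 B1) (- 2 * T) \<le> \<beta>" and bg: "\<beta> < \<gamma>"
    then have \<beta>: "B0 \<le> \<beta>" "B1 \<le> \<beta>" "- 2 * T \<le> \<beta>" by auto
    define s where "s = - \<beta> / 2"
    have s: "s \<le> T" "\<beta> = - 2 * s" using \<beta> by (auto simp: s_def)
    define w where "w = (\<lambda>t. G t * D1 \<beta> \<gamma> t - D \<beta> \<gamma> t * G1 t)"
    define w1 where "w1 = (\<lambda>t. G t * D \<beta> \<gamma> t * (Ps t - P \<beta> \<gamma> t))"
    have wd: "hderiv w w1" unfolding w_def
      by (rule hderiv_cong[OF hderiv_diff[OF hderiv_mult[OF G(1) D_deriv(2)] hderiv_mult[OF D_deriv(1) G(2)]]])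
         (simp add: w1_def algebra_simps)
    have Dpos: "D \<beta> \<gamma> t > 0" if "t \<le> T" for t using D_pos_early(1)[OF bg] that T by simp
    have Gpos: "G t \<ge> c" if "t \<le> T" for t using c(2) that T by simp
    have w1_nn: "w1 t \<ge> 0" if "t \<le> T" for t
      unfolding w1_def using Dpos[OF that] Gpos[OF that] c(1) P_le_Ps[OF bg, of t] that T by simp
    \<comment> \<open>\<open>G\<close> grows at most linearly and \<open>G1\<close> is bounded,
      while \<open>D\<close> and \<open>D1\<close> are of order \<open>exp (4 * t)\<close>.\<close>
    have wl: "(w \<longlongrightarrow> 0) at_bot"
    proof -
      have xl: "((\<lambda>t. x \<gamma> t - x \<beta> t) \<longlongrightarrow> \<gamma> - \<beta>) at_bot" "((\<lambda>t. x1 \<gamma> t - x1 \<beta> t) \<longlongrightarrow> 0 - 0) at_bot"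
        by (intro tendsto_diff logsolD(3)[OF sol] logsolD(4)[OF sol])+
      have e: "((\<lambda>t. N * ((1 - t) * exp (4 * t))) \<longlongrightarrow> 0) at_bot" by real_asymp
      have d1: "((\<lambda>t. x1 \<gamma> t - x1 \<beta> t + 4 * (x \<gamma> t - x \<beta> t)) \<longlongrightarrow> 0 - 0 + 4 * (\<gamma> - \<beta>)) at_bot"
        by (intro tendsto_intros xl)
      have "((\<lambda>t. G t * D1 \<beta> \<gamma> t) \<longlongrightarrow> 0) at_bot"
      proof (rule Lim_null_comparison)
        show "((\<lambda>t. N * ((1 - t) * exp (4 * t)) * \<bar>x1 \<gamma> t - x1 \<beta> t + 4 * (x \<gamma> t - x \<beta> t)\<bar>) \<longlongrightarrow> 0) at_bot"
          using tendsto_mult[OF e tendsto_rabs[OF d1]] by simp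
        show "\<forall>\<^sub>F t in at_bot. norm (G t * D1 \<beta> \<gamma> t) \<le> N * ((1 - t) * exp (4 * t)) * \<bar>x1 \<gamma> t - x1 \<beta> t + 4 * (x \<gamma> t - x \<beta> t)\<bar>"
          using eventually_le_at_bot[of 0]
        proof eventually_elim
          case (elim t)
          have "norm (G t * D1 \<beta> \<gamma> t) = \<bar>G t\<bar> * (exp (4 * t) * \<bar>x1 \<gamma> t - x1 \<beta> t + 4 * (x \<gamma> t - x \<beta> t)\<bar>)"
            by (simp add: D1_def scaled_diff1_def abs_mult)
          also have "\<dots> \<le> (N * (1 - t)) * (exp (4 * t) * \<bar>x1 \<gamma> t - x1 \<beta> t + 4 * (x \<gamma> t - x \<beta> t)\<bar>)"
            by (intro mult_right_mono N elim) auto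
          finally show ?case by (simp add: mult_ac)
        qed
      qed
      moreover have "((\<lambda>t. D \<beta> \<gamma> t * G1 t) \<longlongrightarrow> 0) at_bot"
      proof (rule Lim_null_comparison)
        show "((\<lambda>t. \<bar>D \<beta> \<gamma> t\<bar> * N) \<longlongrightarrow> 0) at_bot"
          using tendsto_mult[OF tendsto_rabs[OF D_lim(1)] tendsto_const[of N]] by simp
        show "\<forall>\<^sub>F t in at_bot. norm (D \<beta> \<gamma> t * G1 t) \<le> \<bar>D \<beta> \<gamma> t\<bar> * N"
          using eventually_le_at_bot[of 0] by eventually_elim (simp add: abs_mult mult_left_mono N)
      qed
      ultimately show ?thesis unfolding w_def using tendsto_diff by force
    qed
    have w_nn: "w t \<ge> 0" if "t \<le> T" for t
      by (rule hderiv_mono_from_bot[OF wd less_imp_le[OF T(3)] _ wl that]) (use w1_nn in auto)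
    have w_mono: "w t \<le> w T" if "t \<le> T" for t
      by (rule hderiv_mono[OF wd that less_imp_le[OF T(3)]]) (use w1_nn in auto)
    \<comment> \<open>On \<open>(s - 1, s)\<close> the smaller solution is still far below the
      singular profile: \<open>x \<beta> \<le> \<beta>\<close> gives
      \<open>exp (X \<beta>) \<le> 1/16\<close>, whereas \<open>exp Xs \<ge> 1/2\<close>. By the
      trapezoid bound the potentials differ by at least 3, however large \<gamma> is. The factor
      \<open>exp (- 4)\<close> is the most that \<open>D\<close> can lose over unit time, as
      \<open>D1 \<le> 4 * D\<close>.\<close>
    have Ds: "D \<beta> \<gamma> s * (3 * c * exp (- 4)) \<le> w s"
    proof -
      obtain y where y: "s - 1 < y" "y < s" "w s - w (s - 1) = (s - (s - 1)) * w1 y"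
        by (rule hderiv_mvt[OF wd, of "s - 1" s]) (use s T in auto)
      have y0: "y \<le> T" "y \<le> 0" "y < Ts" using y s T by auto
      have XL: "exp (X \<beta> y) \<le> 1 / 16"
      proof -
        have "x \<beta> y \<le> \<beta>" using logsol_decreasing(2)[OF sol, of y \<beta>] A_pos y0 by (simp add: less_imp_le)
        then have "exp (x \<beta> y + 2 * y) \<le> exp 0" using y s by (simp del: exp_zero)
        then show ?thesis using exp_X[of \<beta> y] by (simp add: exp_add mult.commute)
      qed
      have "C * exp (2 * y) \<le> 1 / 16" using Ts_le[of y] y0 by simp
      then have "Xs y \<ge> - (1 / 16)" using Xs_ge[OF y0(2)] by linarith
      then have XsL: "exp (Xs y) \<ge> 1 / 2" using exp_ge_add_one_self[of "Xs y"] by linarith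
      have "dquot (X \<beta> y) (X \<gamma> y) \<le> (exp (X \<beta> y) + exp (X \<gamma> y)) / 2"
        using X_mono_early[OF bg y0(3)] by (intro dquot_le_average) simp
      also have "exp (X \<gamma> y) \<le> exp (Xs y)" using X_le_Xs[OF y0(3)] by simp
      finally have "exp (Xs y) - dquot (X \<beta> y) (X \<gamma> y) \<ge> 3 / 16" using XL XsL by simp
      then have "1 * (3 / 16) \<le> A y * (exp (Xs y) - dquot (X \<beta> y) (X \<gamma> y))"
        using A_ge[OF y0(2)] by (intro mult_mono) auto
      moreover have "Ps y - P \<beta> \<gamma> y = 16 * (A y * (exp (Xs y) - dquot (X \<beta> y) (X \<gamma> y)))" by (simp add: Ps_def P_eq algebra_simps)
      ultimately have PP: "Ps y - P \<beta> \<gamma> y \<ge> 3" by linarith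
      have Dy: "D \<beta> \<gamma> s * exp (- 4) \<le> D \<beta> \<gamma> y"
      proof -
        have h: "hderiv (\<lambda>t. - (exp (- 4 * t) * D \<beta> \<gamma> t)) (\<lambda>t. exp (- 4 * t) * (4 * D \<beta> \<gamma> t - D1 \<beta> \<gamma> t))"
          by (rule hderiv_cong[OF hderiv_minus[OF hderiv_mult[OF hderiv_exp D_deriv(1)]]]) (simp add: algebra_simps)
        have "- (exp (- 4 * y) * D \<beta> \<gamma> y) \<le> - (exp (- 4 * s) * D \<beta> \<gamma> s)"
        proof (rule hderiv_mono[OF h])
          fix z assume "y < z" "z < s"
          then have "z < Ts" using s T by simp
          then show "0 \<le> exp (- 4 * z) * (4 * D \<beta> \<gamma> z - D1 \<beta> \<gamma> z)"
            using D_pos_early(2)[OF bg \<open>z < Ts\<close>] by (intro mult_nonneg_nonneg) auto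
        qed (use y s T in auto)
        then have "exp (4 * y) * (exp (- 4 * s) * D \<beta> \<gamma> s) \<le> exp (4 * y) * (exp (- 4 * y) * D \<beta> \<gamma> y)"
          by (intro mult_left_mono) auto
        moreover have "exp (4 * y) * (exp (- 4 * y) * D \<beta> \<gamma> y) = D \<beta> \<gamma> y" by (simp add: exp_minus)
        moreover have "exp (- 4) * D \<beta> \<gamma> s \<le> exp (4 * y) * (exp (- 4 * s) * D \<beta> \<gamma> s)"
          unfolding mult.assoc[symmetric] using y Dpos[OF s(1)] by (intro mult_right_mono) (auto simp flip: exp_add)
        ultimately have "exp (- 4) * D \<beta> \<gamma> s \<le> D \<beta> \<gamma> y" by linarith
        then show ?thesis by (simp only: mult.commute)
      qed
      have "(c * (D \<beta> \<gamma> s * exp (- 4))) * 3 \<le> w1 y"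
        unfolding w1_def using Gpos[OF y0(1)] Dy PP c(1) Dpos[OF s(1)] Dpos[OF y0(1)]
        by (intro mult_mono) (auto intro!: mult_nonneg_nonneg)
      then show ?thesis using y(3) w_nn[of "s - 1"] s by (simp add: mult_ac)
    qed
    \<comment> \<open>\<open>(D / G)' = w / G^2 \<le> w T / c^2\<close> on \<open>[s, T]\<close>,
      since \<open>w\<close> increases there; integrating over the length \<open>T - s\<close>
      produces the factor linear in \<beta>.\<close>
    have DT: "D \<beta> \<gamma> T \<le> (k1 + k2 * \<beta>) * w T"
    proof -
      define m where "m = w T / c\<^sup>2"
      define R where "R = (\<lambda>t. D \<beta> \<gamma> t / G t - t * m)"
      have "R T \<le> R s"
      proof (cases "s = T")
        case False
        show ?thesis
        proof (rule DERIV_nonpos_imp_nonincreasing[of s T R])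
          fix y assume y: "s \<le> y" "y \<le> T"
          have y0: "y < 0" using y T by simp
          have g: "G y \<ge> c" "G y \<noteq> 0" using Gpos[OF y(2)] c(1) by auto
          have "(R has_real_derivative (D1 \<beta> \<gamma> y * G y - D \<beta> \<gamma> y * G1 y) / (G y * G y) - m) (at y)"
            unfolding R_def using g(2)
            by (auto intro!: derivative_eq_intros hderiv_at[OF D_deriv(1) y0] hderiv_at[OF G(1) y0])
          moreover have "(D1 \<beta> \<gamma> y * G y - D \<beta> \<gamma> y * G1 y) / (G y * G y) \<le> m"
          proof -
            have "D1 \<beta> \<gamma> y * G y - D \<beta> \<gamma> y * G1 y = w y" by (simp add: w_def)
            moreover have "c\<^sup>2 \<le> G y * G y" unfolding power2_eq_square using g c(1) by (intro mult_mono) auto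
            ultimately show ?thesis using w_mono[OF y(2)] w_nn[OF y(2)] c(1) unfolding m_def by (auto intro!: frac_le)
          qed
          ultimately show "\<exists>z. (R has_real_derivative z) (at y) \<and> z \<le> 0" by force
        qed (use s in simp)
      qed simp
      then have "D \<beta> \<gamma> T / G T \<le> D \<beta> \<gamma> s / G s + (T - s) * (w T / c\<^sup>2)"
        unfolding m_def[symmetric] by (simp add: R_def left_diff_distrib)
      also have "\<dots> \<le> exp 4 / (3 * c\<^sup>2) * w T + \<beta> / 2 * (w T / c\<^sup>2)"
      proof (rule add_mono)
        have "D \<beta> \<gamma> s / G s \<le> D \<beta> \<gamma> s / c"
          using Dpos[OF s(1)] Gpos[OF s(1)] c(1) by (intro divide_left_mono) auto
        also have "D \<beta> \<gamma> s \<le> exp 4 / (3 * c) * w T"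
        proof -
          have "D \<beta> \<gamma> s * (3 * c * exp (- 4)) \<le> w T" using Ds w_mono[OF s(1)] by linarith
          then show ?thesis using c(1) by (simp add: exp_minus field_simps)
        qed
        finally show "D \<beta> \<gamma> s / G s \<le> exp 4 / (3 * c\<^sup>2) * w T" using c(1) by (simp add: divide_right_mono power2_eq_square field_simps)
        show "(T - s) * (w T / c\<^sup>2) \<le> \<beta> / 2 * (w T / c\<^sup>2)"
          using w_nn[of T] T by (intro mult_right_mono) (auto simp: s_def)
      qed
      also have "\<dots> = (exp 4 / (3 * c\<^sup>2) + \<beta> / (2 * c\<^sup>2)) * w T" by (simp add: algebra_simps)
      finally have "D \<beta> \<gamma> T \<le> G T * ((exp 4 / (3 * c\<^sup>2) + \<beta> / (2 * c\<^sup>2)) * w T)"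
        using Gpos[of T] c(1) by (simp add: divide_le_eq mult.commute)
      also have "\<dots> \<le> GT * ((exp 4 / (3 * c\<^sup>2) + \<beta> / (2 * c\<^sup>2)) * w T)"
        using N(1)[of T] T w_nn[of T] \<beta> unfolding GT_def by (intro mult_right_mono mult_nonneg_nonneg add_nonneg_nonneg) auto
      finally show ?thesis by (simp add: k1_def k2_def algebra_simps)
    qed
    have wT: "w T > 0"
    proof (rule ccontr)
      assume "\<not> w T > 0"
      then have "w T = 0" using w_nn[of T] by simp
      then show False using DT Dpos[of T] by simp
    qed
    define r where "r = GT * K * Q * exp (- 3 / 2 * \<beta>) * D \<beta> \<gamma> T"
    \<comment> \<open>Right of T neither the order of the solutions nor the sign of
      \<open>Ps - P\<close> is available; only the smallness of \<open>Ps - P\<close> is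
      used.\<close>
    have "w T + (- r) * (t1 - T) \<le> w t1"
    proof -
      have h: "hderiv (\<lambda>t. w t + r * t) (\<lambda>t. w1 t + r * 1)" by (intro hderiv_add wd hderiv_cmult hderiv_ident)
      have "w T + r * T \<le> w t1 + r * t1"
      proof (rule hderiv_mono[OF h less_imp_le[OF \<open>T < t1\<close>] t1(1)])
        fix y assume y: "T < y" "y < t1"
        then have y0: "y \<le> 0" using t1 by simp
        have "\<bar>w1 y\<bar> = \<bar>G y\<bar> * \<bar>D \<beta> \<gamma> y\<bar> * \<bar>Ps y - P \<beta> \<gamma> y\<bar>" by (simp add: w1_def abs_mult)
        also have "\<dots> \<le> GT * (K * D \<beta> \<gamma> T) * (Q * exp (- 3 / 2 * \<beta>))"
        proof (intro mult_mono)
          have "\<bar>G y\<bar> \<le> N * (1 - y)" by (rule N(1)[OF y0])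
          also have "\<dots> \<le> GT" unfolding GT_def using y N0 by (intro mult_left_mono) auto
          finally show "\<bar>G y\<bar> \<le> GT" .
          show "\<bar>D \<beta> \<gamma> y\<bar> \<le> K * D \<beta> \<gamma> T" using K(2)[OF bg, of y] y y0 by simp
          show "\<bar>Ps y - P \<beta> \<gamma> y\<bar> \<le> Q * exp (- 3 / 2 * \<beta>)" using Q(2)[OF \<beta>(1) bg, of y] y y0 by simp
        qed (use GT K Dpos[of T] in auto)
        also have "\<dots> = r" by (simp add: r_def)
        finally show "0 \<le> w1 y + r * 1" by (simp add: abs_le_iff)
      qed
      then show ?thesis by (simp add: algebra_simps)
    qed
    moreover have "r * (t1 - T) < w T"
    proof -
      have r0: "0 \<le> r" unfolding r_def using GT K Q Dpos[of T] by simp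
      have "r * (t1 - T) \<le> r * (- T)" using r0 t1 by (intro mult_left_mono) auto
      also have "\<dots> = k3 * exp (- 3 / 2 * \<beta>) * D \<beta> \<gamma> T" by (simp add: r_def k3_def)
      also have "\<dots> \<le> k3 * exp (- 3 / 2 * \<beta>) * ((k1 + k2 * \<beta>) * w T)"
        unfolding k3_def using GT(1) K(1) Q(1) T(3)
        by (intro mult_left_mono[OF DT] mult_nonneg_nonneg) auto
      also have "\<dots> = ((k1 + k2 * \<beta>) * (k3 * exp (- 3 / 2 * \<beta>))) * w T" by (simp add: mult_ac)
      also have "\<dots> < 1 * w T" using B1[OF \<beta>(2)] wT by (intro mult_strict_right_mono)
      finally show ?thesis by simp
    qed
    ultimately have "w t1 > 0" by simp
    then show "D \<beta> \<gamma> t1 * G1 t1 < 0" using t1(2) by (simp add: w_def)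
  qed
qed

text \<open>The solution that vanishes at the boundary is bounded away from 0 near -infinity, hence
  of constant sign there, and the sign is normalized to be positive.\<close>

lemma singular_solution:
  obtains g g1 c N T where "hderiv g g1" "hderiv g1 (\<lambda>t. - Ps t * g t)" "g 0 = 0" "g1 0 \<noteq> 0"
    "c > 0" "N > 0" "T < 0" "\<And>t. t \<le> T \<Longrightarrow> g t \<ge> c"
    "\<And>t. t \<le> 0 \<Longrightarrow> \<bar>g t\<bar> \<le> N * (1 - t)" "\<And>t. t \<le> 0 \<Longrightarrow> \<bar>g1 t\<bar> \<le> N"
proof -
  have Pb: "\<bar>Ps t\<bar> \<le> 16 * C" if "t \<le> 0" for t
  proof -
    have "16 * C * exp (2 * t) \<le> 16 * C * 1" using C that by (intro mult_left_mono) auto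
    then show ?thesis using Ps_abs[OF that] by linarith
  qed
  obtain G G1 where G: "hderiv G G1" "hderiv G1 (\<lambda>t. - Ps t * G t)" "G 0 = 0" "G1 0 = 1"
    by (rule linear_ode_exists[OF Ps_cont Pb])
  obtain c N T where as: "c > 0" "N > 0" "T < 0" "\<And>t. t \<le> T \<Longrightarrow> \<bar>G t\<bar> \<ge> c"
    "\<And>t. t \<le> 0 \<Longrightarrow> \<bar>G t\<bar> \<le> N * (1 - t)" "\<And>t. t \<le> 0 \<Longrightarrow> \<bar>G1 t\<bar> \<le> N"
    by (rule linear_ode_asymptotics[OF G(1,2) _ Ps_abs]) (use G in \<open>auto\<close>)
  define \<sigma> where "\<sigma> = sgn (G T)"
  have \<sigma>: "\<sigma> = 1 \<or> \<sigma> = - 1" using as(4)[of T] as(1) by (auto simp: \<sigma>_def sgn_if)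
  have "\<sigma> * G t \<ge> c" if t: "t \<le> T" for t
  proof (rule ccontr)
    assume neg: "\<not> \<sigma> * G t \<ge> c"
    have "\<bar>\<sigma> * G t\<bar> \<ge> c" "\<bar>\<sigma> * G T\<bar> \<ge> c" using as(4)[OF t] as(4)[of T] \<sigma> by auto
    then have "\<sigma> * G t \<le> 0" using neg by linarith
    have "\<sigma> * G T \<ge> 0" by (simp add: \<sigma>_def sgn_if)
    moreover have "continuous_on {t..T} (\<lambda>t. \<sigma> * G t)"
      using as(3) by (intro continuous_intros hderiv_cont[OF G(1)]) auto
    ultimately obtain z where "t \<le> z" "z \<le> T" "\<sigma> * G z = 0"
      using IVT'[of "\<lambda>t. \<sigma> * G t" t 0 T] \<open>\<sigma> * G t \<le> 0\<close> t by auto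
    then have "G z = 0" using \<sigma> by auto
    then show False using as(4)[OF \<open>z \<le> T\<close>] as(1) by simp
  qed
  moreover have "hderiv (\<lambda>t. \<sigma> * G1 t) (\<lambda>t. - Ps t * (\<sigma> * G t))"
    by (rule hderiv_cong[OF hderiv_cmult[OF G(2)]]) simp
  moreover have "\<bar>\<sigma> * y\<bar> = \<bar>y\<bar>" for y using \<sigma> by (auto simp: abs_mult)
  ultimately show ?thesis
    using as \<sigma> G by (intro that[of "\<lambda>t. \<sigma> * G t" "\<lambda>t. \<sigma> * G1 t" c N T] hderiv_cmult) auto
qed

section \<open>Monotonicity for very large and for very negative initial values\<close>

lemma eventually_monotone:
  obtains B where "(\<forall>\<beta> \<gamma>. B \<le> \<beta> \<longrightarrow> \<beta> < \<gamma> \<longrightarrow> x \<beta> 0 < x \<gamma> 0) \<or> (\<forall>\<beta> \<gamma>. B \<le> \<beta> \<longrightarrow> \<beta> < \<gamma> \<longrightarrow> x \<gamma> 0 < x \<beta> 0)"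
proof -
  obtain g g1 c N T where g: "hderiv g g1" "hderiv g1 (\<lambda>t. - Ps t * g t)" "g 0 = 0" "g1 0 \<noteq> 0"
    "c > 0" "N > 0" "T < 0" "\<And>t. t \<le> T \<Longrightarrow> g t \<ge> c"
    "\<And>t. t \<le> 0 \<Longrightarrow> \<bar>g t\<bar> \<le> N * (1 - t)" "\<And>t. t \<le> 0 \<Longrightarrow> \<bar>g1 t\<bar> \<le> N"
    by (rule singular_solution) blast
  obtain B where B: "\<And>\<beta> \<gamma>. B \<le> \<beta> \<Longrightarrow> \<beta> < \<gamma> \<Longrightarrow> D \<beta> \<gamma> 0 * g1 0 < 0"
    by (rule wronskian_sign[OF g(1,2) order.refl g(3,5,8,9,10)]) (assumption | rule that)+
  \<comment> \<open>The sign of \<open>D \<beta> \<gamma> 0\<close> is opposite to that of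
    \<open>g1 0\<close>, which does not depend on \<beta> and \<gamma>; which of the two signs
    occurs is left open.\<close>
  have "D \<beta> \<gamma> 0 = x \<gamma> 0 - x \<beta> 0" for \<beta> \<gamma> by (simp add: D_eq X_def)
  then show ?thesis using B g(4) that[of B] by (cases "g1 0 > 0") (force simp: mult_less_0_iff)+
qed

text \<open>For \<gamma> this small the potential \<open>exp (2 * t) * A t * exp (x t)\<close> stays
  below the Hardy constant 16, so D is convex where it is positive and the constant 1 serves as
  comparison function.\<close>

lemma early_increasing:
  assumes "\<beta> < \<gamma>" "(1 + C) * exp \<gamma> \<le> 16" "t \<le> 0"
  shows "x \<beta> t < x \<gamma> t"
proof -
  have P: "P \<beta> \<gamma> t \<le> 0" if t: "t \<le> 0" for t
  proof -
    have xl: "x \<beta> t \<le> \<gamma>" "x \<gamma> t \<le> \<gamma>"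
      using logsol_decreasing(2)[OF sol, of t \<beta>] logsol_decreasing(2)[OF sol, of t \<gamma>] A_pos t assms(1)
      by (simp_all add: less_imp_le)
    have "dquot (x \<beta> t) (x \<gamma> t) \<le> exp (max (x \<beta> t) (x \<gamma> t))"
      using dquot_bounds(2)[of "x \<beta> t" "x \<gamma> t"] dquot_bounds(2)[of "x \<gamma> t" "x \<beta> t"] dquot_commute[of "x \<beta> t" "x \<gamma> t"]
      by (cases "x \<beta> t \<le> x \<gamma> t") (auto simp: max_def)
    also have "\<dots> \<le> exp \<gamma>" using xl by simp
    finally have "(exp (2 * t) * A t) * dquot (x \<beta> t) (x \<gamma> t) \<le> (1 * (1 + C)) * exp \<gamma>"
      using A_pos[OF t] A_le'[OF t] t C dquot_pos[of "x \<beta> t" "x \<gamma> t"] by (intro mult_mono) auto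
    then show ?thesis using assms(2) by (simp add: P_def diff_potential_def)
  qed
  have one: "hderiv (\<lambda>t. 1) (\<lambda>t. 0)" "hderiv (\<lambda>t. 0) (\<lambda>t. 0)" by (rule hderiv_const)+
  have lim: "((\<lambda>t. 1 * D1 \<beta> \<gamma> t - D \<beta> \<gamma> t * 0) \<longlongrightarrow> 0) at_bot" using D_lim(2) by simp
  have le: "D \<beta> \<gamma> s * 0 \<le> 1 * (- P \<beta> \<gamma> s * D \<beta> \<gamma> s)" if "s < 0" "0 < D \<beta> \<gamma> s" for s
    using P[of s] that by (simp add: mult_nonpos_nonneg)
  note st = sturm_positivity[OF D_deriv one order.refl D_ev[OF assms(1)] zero_less_one lim le]
  have "0 < D \<beta> \<gamma> (t - 1)" by (rule st(1)) (use assms in auto)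
  also have "\<dots> \<le> D \<beta> \<gamma> t"
  proof (rule hderiv_mono[OF D_deriv(1)])
    show "0 \<le> D1 \<beta> \<gamma> y" if "y < t" for y
      using st(2)[of y] that assms by simp
  qed (use assms in auto)
  finally show ?thesis by (simp add: D_eq X_def zero_less_mult_iff)
qed

text \<open>Under the ordering, \<open>wronskian_sign\<close> gives \<open>g\<close> a negative
  slope at each of its zeros; two consecutive zeros cannot both have one, so \<open>g > 0\<close>
  before the boundary. As in the Type II bound, W compares a potential with the threshold, now at
  the singular solution and with \<open>g\<close> in place of \<open>psi\<close>, and it comes out
  positive. Then \<open>g\<close> has the larger potential, both \<open>g\<close> and
  \<open>psi\<close> vanish at 0, and \<open>g\<close> would have to become negative far to the
  left.\<close>

lemma not_all_ordered:
  assumes b: "\<And>t. t \<le> 0 \<Longrightarrow> A t = b t * ((1 + H_disc * exp (2 * t) / 16) * exp (H_disc * exp (2 * t) / 20))"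
    "\<And>t. t \<le> 0 \<Longrightarrow> b t > 0" "\<And>t. t < 0 \<Longrightarrow> (b has_real_derivative b1 t) (at t)"
    "\<And>t. t < 0 \<Longrightarrow> b1 t > 0" "(b \<longlongrightarrow> 1) at_bot"
    and ordered: "\<And>\<beta> \<gamma> t. \<beta> < \<gamma> \<Longrightarrow> t \<le> 0 \<Longrightarrow> x \<beta> t < x \<gamma> t"
  shows False
proof -
  let ?H = H_disc
  obtain g g1 c N T where g: "hderiv g g1" "hderiv g1 (\<lambda>t. - Ps t * g t)" "g 0 = 0" "g1 0 \<noteq> 0"
    "c > 0" "N > 0" "T < 0" "\<And>t. t \<le> T \<Longrightarrow> g t \<ge> c"
    "\<And>t. t \<le> 0 \<Longrightarrow> \<bar>g t\<bar> \<le> N * (1 - t)" "\<And>t. t \<le> 0 \<Longrightarrow> \<bar>g1 t\<bar> \<le> N"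
    by (rule singular_solution) blast
  have slope: "g1 t < 0" if t: "t \<le> 0" "g t = 0" for t
  proof -
    obtain B where B: "\<And>\<beta> \<gamma>. B \<le> \<beta> \<Longrightarrow> \<beta> < \<gamma> \<Longrightarrow> D \<beta> \<gamma> t * g1 t < 0"
      by (rule wronskian_sign[OF g(1,2) t g(5,8,9,10)]) (assumption | rule that)+
    have "D B (B + 1) t > 0" using ordered[of B "B + 1" t] t by (simp add: D_eq X_def)
    then show ?thesis using B[of B "B + 1"] by (simp add: mult_less_0_iff)
  qed
  have gc: "continuous_on {..0} g" by (rule hderiv_cont[OF g(1)]) simp
  have ev: "\<forall>\<^sub>F t in at_bot. g t > 0"
    using eventually_le_at_bot[of T] by eventually_elim (use g(5,8) in force)
  have gpos: "g t > 0" if "t < 0" for t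
  proof (rule ccontr)
    assume "\<not> g t > 0"
    then have le: "t \<le> 0" "g t \<le> 0" using \<open>t < 0\<close> by auto
    obtain z where z: "z \<le> t" "g z = 0" "\<And>s. s < z \<Longrightarrow> g s > 0"
      by (rule first_zero[OF gc ev le]) (rule that)
    have z0: "z < 0" using z \<open>t < 0\<close> by simp
    obtain d where d: "d > 0" "\<And>h. 0 < h \<Longrightarrow> z + h \<in> {..0} \<Longrightarrow> h < d \<Longrightarrow> g (z + h) < g z"
      using has_real_derivative_neg_dec_right[OF hderivD[OF g(1)] slope, of z] z z0 by auto
    define m where "m = z + min d (- z) / 2"
    have m: "z < m" "m < 0" "g m < 0" using d(2)[of "m - z"] d(1) z0 z(2) by (auto simp: m_def min_def split: if_splits)
    \<comment> \<open>\<open>g\<close> is frozen left of \<open>m\<close> at a negative value, so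
      that \<open>first_zero\<close> yields the next zero after \<open>m\<close>. There
      \<open>g\<close> arrives from negative values, against \<open>slope\<close>.\<close>
    have mc: "continuous_on {..0} (\<lambda>t. - g (max t m))"
      by (intro continuous_intros continuous_on_compose2[OF gc]) (use m in auto)
    have mev: "\<forall>\<^sub>F t in at_bot. - g (max t m) > 0"
      using eventually_le_at_bot[of m] by eventually_elim (use m in \<open>simp add: max_def\<close>)
    obtain y where y: "y \<le> 0" "- g (max y m) = 0" "\<And>s. s < y \<Longrightarrow> - g (max s m) > 0"
      by (rule first_zero[OF mc mev order.refl]) (use m g(3) in \<open>auto simp: max_def\<close>)
    have ym: "m < y" "g y = 0" using y(2) m by (auto simp: max_def split: if_splits intro: le_neq_trans)
    obtain e where e: "e > 0" "\<And>h. 0 < h \<Longrightarrow> y - h \<in> {..0} \<Longrightarrow> h < e \<Longrightarrow> g y < g (y - h)"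
      using has_real_derivative_neg_dec_left[OF hderivD[OF g(1)] slope, of y] y ym by auto
    define h where "h = min e (y - m) / 2"
    have h: "0 < h" "h < e" "m < y - h" using e(1) ym by (auto simp: h_def min_def field_simps)
    then have "g (y - h) > 0" using e(2)[of h] y(1) ym by simp
    moreover have "- g (max (y - h) m) > 0" using h by (intro y(3)) simp
    ultimately show False using h by (simp add: max_def)
  qed
  define V where "V = (\<lambda>t. Xs t + ?H * exp (2 * t) / 20)"
  define V1 where "V1 = (\<lambda>t. Xs1 t + ?H * exp (2 * t) / 10)"
  define W where "W = (\<lambda>t. V t + ln (b t))"
  have Vd: "hderiv V V1" unfolding V_def V1_def
    by (rule hderivI) (auto intro!: derivative_eq_intros hderivD[OF Xs_deriv])
  have V1d: "hderiv V1 (\<lambda>t. - 8 * Xs1 t + 16 * (1 - A t * exp (Xs t)) + ?H * exp (2 * t) / 5)"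
    unfolding V1_def by (rule hderivI) (auto intro!: derivative_eq_intros hderivD[OF Xs1_deriv])
  have eW: "16 * (A t * exp (Xs t)) = (16 + ?H * exp (2 * t)) * exp (W t)" if "t \<le> 0" for t
  proof -
    have "exp (W t) = exp (Xs t) * exp (?H * exp (2 * t) / 20) * b t"
      using b(2)[OF that] by (simp add: W_def V_def exp_add)
    then show ?thesis by (simp add: b(1)[OF that] field_simps)
  qed
  have Heb: "0 < ?H * exp (2 * t)" "t \<le> 0 \<Longrightarrow> ?H * exp (2 * t) \<le> ?H" for t using H_disc_pos by auto
  have bmono: "b s < b t" if "s < t" "t < 0" for s t
  proof (rule DERIV_pos_imp_increasing[OF that(1)])
    fix y assume "s \<le> y" "y \<le> t"
    then have "y < 0" using that by simp
    then show "\<exists>z. (b has_real_derivative z) (at y) \<and> 0 < z" using b(3,4) by blast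
  qed
  \<comment> \<open>\<open>ln b\<close> is frozen at s, so that \<open>V - v = W\<close> at s and
    \<open>W < V - v\<close> to the left. Then \<open>1 - exp W + W * exp W \<ge> 0\<close> makes
    the Wronskian with \<open>g\<close> increase from 0. The derivative of \<open>ln b\<close>
    itself only adds a positive term at s.\<close>
  have mono_deriv: "\<exists>d. ((\<lambda>t. exp (4 * t) * W t / g t) has_real_derivative d) (at s) \<and> d > 0" if s: "s < 0" for s
  proof -
    define v where "v = - ln (b s)"
    define F where "F = (\<lambda>t. exp (4 * t) * (V t - v))"
    define F1 where "F1 = (\<lambda>t. exp (4 * t) * (V1 t + 4 * (V t - v)))"
    have Fd: "hderiv F F1" unfolding F_def
      by (rule hderiv_cong[OF hderiv_mult[OF hderiv_exp hderiv_diff[OF Vd hderiv_const]]])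
         (simp add: F1_def algebra_simps)
    have F1d: "hderiv F1 (\<lambda>t. exp (4 * t) * ((16 + ?H * exp (2 * t)) * (1 - exp (W t)) + 16 * (V t - v)))"
      unfolding F1_def
    proof (rule hderiv_cong[OF hderiv_mult[OF hderiv_exp hderiv_add[OF V1d hderiv_cmult[OF hderiv_diff[OF Vd hderiv_const]]]]])
      fix t :: real assume t: "t \<le> 0"
      have "4 * exp (4 * t) * (V1 t + 4 * (V t - v)) + (- 8 * Xs1 t + 16 * (1 - A t * exp (Xs t)) + ?H * exp (2 * t) / 5 + 4 * (V1 t - 0)) * exp (4 * t)
        = exp (4 * t) * (16 + ?H * exp (2 * t) - 16 * (A t * exp (Xs t)) + 16 * (V t - v))"
        by (simp add: V1_def algebra_simps)
      then show "4 * exp (4 * t) * (V1 t + 4 * (V t - v)) + (- 8 * Xs1 t + 16 * (1 - A t * exp (Xs t)) + ?H * exp (2 * t) / 5 + 4 * (V1 t - 0)) * exp (4 * t)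
        = exp (4 * t) * ((16 + ?H * exp (2 * t)) * (1 - exp (W t)) + 16 * (V t - v))"
        unfolding eW[OF t] by (simp add: algebra_simps)
    qed
    define u where "u = (\<lambda>t. g t * F1 t - F t * g1 t)"
    have ud: "hderiv u (\<lambda>t. g t * (exp (4 * t) * ((16 + ?H * exp (2 * t)) * (1 - exp (W t) + exp (W t) * (V t - v)))))"
      unfolding u_def
    proof (rule hderiv_cong[OF hderiv_diff[OF hderiv_mult[OF g(1) F1d] hderiv_mult[OF Fd g(2)]]])
      fix t :: real assume t: "t \<le> 0"
      have PsW: "Ps t = (16 + ?H * exp (2 * t)) * exp (W t) - 16" using eW[OF t] by (simp add: Ps_def)
      show "g1 t * F1 t + exp (4 * t) * ((16 + ?H * exp (2 * t)) * (1 - exp (W t)) + 16 * (V t - v)) * g t - (F1 t * g1 t + - Ps t * g t * F t)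
        = g t * (exp (4 * t) * ((16 + ?H * exp (2 * t)) * (1 - exp (W t) + exp (W t) * (V t - v))))"
        unfolding PsW F_def by (simp add: algebra_simps)
    qed
    define k where "k = 2 + 2 * C + ?H / 10 + 4 * (C + ?H / 20 + \<bar>v\<bar>)"
    have Vb: "\<bar>V t - v\<bar> \<le> C + ?H / 20 + \<bar>v\<bar>" "\<bar>V1 t\<bar> \<le> 2 + 2 * C + ?H / 10" if t: "t \<le> 0" for t
    proof -
      have "C * exp (2 * t) \<le> C * 1" using C t by (intro mult_left_mono) auto
      then have "\<bar>Xs t\<bar> \<le> C" using Xs_ge[OF t] Xs_nonpos[OF t] by simp
      then show "\<bar>V t - v\<bar> \<le> C + ?H / 20 + \<bar>v\<bar>" using Heb(1)[of t] Heb(2)[OF t] unfolding V_def by linarith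
      have "\<bar>Xs1 t\<bar> \<le> 2 + 2 * C" using Xs1_bounds[OF t] C by (simp add: abs_le_iff)
      then show "\<bar>V1 t\<bar> \<le> 2 + 2 * C + ?H / 10" using Heb(1)[of t] Heb(2)[OF t] unfolding V1_def by linarith
    qed
    have ul: "(u \<longlongrightarrow> 0) at_bot"
    proof (rule Lim_null_comparison)
      show "((\<lambda>t. N * k * ((2 - t) * exp (4 * t))) \<longlongrightarrow> 0) at_bot" by real_asymp
      show "\<forall>\<^sub>F t in at_bot. norm (u t) \<le> N * k * ((2 - t) * exp (4 * t))"
        using eventually_le_at_bot[of 0]
      proof eventually_elim
        case (elim t)
        have v4: "\<bar>V1 t + 4 * (V t - v)\<bar> \<le> k" "\<bar>V t - v\<bar> \<le> k"
        proof -
          have "\<bar>p + 4 * w\<bar> \<le> y + 4 * z" "\<bar>w\<bar> \<le> y + 4 * z" if "\<bar>w\<bar> \<le> z" "\<bar>p\<bar> \<le> y" for p w y z :: real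
            using that by linarith+
          from this[OF Vb[OF elim]] show "\<bar>V1 t + 4 * (V t - v)\<bar> \<le> k" "\<bar>V t - v\<bar> \<le> k"
            unfolding k_def by auto
        qed
        have k0: "k \<ge> 0" using v4 by linarith
        have "norm (u t) \<le> \<bar>g t\<bar> * \<bar>F1 t\<bar> + \<bar>F t\<bar> * \<bar>g1 t\<bar>"
          unfolding u_def real_norm_def abs_mult[symmetric] by (rule abs_triangle_ineq4)
        also have "\<dots> \<le> (N * (1 - t)) * (exp (4 * t) * k) + (exp (4 * t) * k) * N"
          using v4 k0 g(6) elim unfolding F_def F1_def abs_mult abs_exp_cancel
          by (intro add_mono mult_mono g(9,10) order.refl) auto
        finally show ?case by (simp add: algebra_simps)
      qed
    qed
    have "0 < u s"
    proof (rule hderiv_strict_mono_from_bot[OF ud less_imp_le[OF s] _ ul order.refl])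
      fix t assume t: "t < s"
      have "ln (b t) < ln (b s)" using bmono[OF t s] b(2)[of t] b(2)[of s] t s by simp
      then have "W t < V t - v" by (simp add: W_def v_def)
      then have "exp (W t) * W t < exp (W t) * (V t - v)" by simp
      moreover have "exp (W t) * (1 + (- W t)) \<le> exp (W t) * exp (- W t)" by (intro mult_left_mono exp_ge_add_one_self) auto
      then have "exp (W t) - exp (W t) * W t \<le> 1" by (simp add: algebra_simps flip: exp_add)
      ultimately have "0 < 1 - exp (W t) + exp (W t) * (V t - v)" by linarith
      then show "0 < g t * (exp (4 * t) * ((16 + ?H * exp (2 * t)) * (1 - exp (W t) + exp (W t) * (V t - v))))"
        using gpos[of t] t s Heb(1)[of t] by (intro mult_pos_pos) auto
    qed
    then have "0 < exp (4 * s) * (g s * (V1 s + 4 * W s) - W s * g1 s)"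
      by (simp add: u_def F_def F1_def W_def v_def algebra_simps)
    then have pos: "0 < g s * (V1 s + 4 * W s) - W s * g1 s" by (simp add: zero_less_mult_iff)
    have bs: "b s > 0" using b(2) s by simp
    have Wd: "(W has_real_derivative V1 s + b1 s / b s) (at s)" unfolding W_def
      using hderiv_at[OF Vd s] b(3)[OF s] bs by (auto intro!: derivative_eq_intros)
    have md: "((\<lambda>t. exp (4 * t) * W t / g t) has_real_derivative
       ((4 * exp (4 * s) * W s + (V1 s + b1 s / b s) * exp (4 * s)) * g s - exp (4 * s) * W s * g1 s) / (g s * g s)) (at s)"
      using gpos[OF s] by (auto intro!: derivative_eq_intros Wd hderiv_at[OF g(1) s])
    have "(4 * exp (4 * s) * W s + (V1 s + b1 s / b s) * exp (4 * s)) * g s - exp (4 * s) * W s * g1 s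
       = exp (4 * s) * ((g s * (V1 s + 4 * W s) - W s * g1 s) + b1 s / b s * g s)" by (simp add: algebra_simps)
    also have "\<dots> > 0" using pos b(4)[OF s] bs gpos[OF s] by (intro mult_pos_pos add_pos_pos) auto
    finally have num: "0 < (4 * exp (4 * s) * W s + (V1 s + b1 s / b s) * exp (4 * s)) * g s - exp (4 * s) * W s * g1 s" .
    have "0 < g s * g s" using gpos[OF s] by simp
    from divide_pos_pos[OF num this] md show ?thesis by blast
  qed
  \<comment> \<open>W tends to 0 and \<open>g\<close> is bounded below near -infinity, so the
    increasing quotient \<open>exp (4 * t) * W t / g t\<close> starts from 0.\<close>
  have Wpos: "W t > 0" if t: "t < 0" for t
  proof -
    have Xl: "(Xs \<longlongrightarrow> 0) at_bot"
    proof (rule Lim_null_comparison)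
      show "((\<lambda>t. C * exp (2 * t)) \<longlongrightarrow> 0) at_bot" by real_asymp
      show "\<forall>\<^sub>F t in at_bot. norm (Xs t) \<le> C * exp (2 * t)"
        using eventually_le_at_bot[of 0] by eventually_elim (use Xs_ge Xs_nonpos in \<open>auto simp: abs_le_iff\<close>, force)
    qed
    have hl: "((\<lambda>t. ?H * exp (2 * t) / 20) \<longlongrightarrow> 0) at_bot" by real_asymp
    have "(W \<longlongrightarrow> 0 + 0 + ln 1) at_bot" unfolding W_def V_def
      by (intro tendsto_add Xl hl tendsto_ln b(5)) auto
    then have "((\<lambda>t. exp (4 * t) * W t) \<longlongrightarrow> 0) at_bot" by (rule exp4_tendsto_0)
    then have el: "((\<lambda>t. \<bar>exp (4 * t) * W t\<bar> / c) \<longlongrightarrow> 0) at_bot"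
      using tendsto_divide[OF tendsto_rabs tendsto_const[of c]] g(5) by force
    have "((\<lambda>t. exp (4 * t) * W t / g t) \<longlongrightarrow> 0) at_bot"
    proof (rule Lim_null_comparison[OF _ el])
      show "\<forall>\<^sub>F t in at_bot. norm (exp (4 * t) * W t / g t) \<le> \<bar>exp (4 * t) * W t\<bar> / c"
        using eventually_le_at_bot[of T]
      proof eventually_elim
        case (elim t)
        have "norm (exp (4 * t) * W t / g t) = \<bar>exp (4 * t) * W t\<bar> / g t" using g(8)[OF elim] g(5) by (simp add: abs_mult)
        also have "\<dots> \<le> \<bar>exp (4 * t) * W t\<bar> / c" using g(8)[OF elim] g(5) by (intro divide_left_mono) auto
        finally show ?case .
      qed
    qed
    from DERIV_pos_imp_increasing_at_bot[OF _ this, of t] mono_deriv t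
    have "0 < exp (4 * t) * W t / g t" by force
    then show ?thesis using gpos[OF t] by (simp add: zero_less_divide_iff zero_less_mult_iff)
  qed
  have PsH: "Ps t > ?H * exp (2 * t)" if t: "t < 0" for t
  proof -
    have "Ps t = (16 + ?H * exp (2 * t)) * exp (W t) - 16" using eW[of t] t by (simp add: Ps_def)
    moreover have "(16 + ?H * exp (2 * t)) * 1 < (16 + ?H * exp (2 * t)) * exp (W t)"
      using Wpos[OF t] Heb(1)[of t] by (intro mult_strict_left_mono) auto
    ultimately show ?thesis by simp
  qed
  define q where "q = (\<lambda>t. g t * psi1 t - psi t * g1 t)"
  have qd: "hderiv q (\<lambda>t. psi t * g t * (Ps t - ?H * exp (2 * t)))" unfolding q_def
    by (rule hderiv_cong[OF hderiv_diff[OF hderiv_mult[OF g(1) psi1_deriv] hderiv_mult[OF psi_deriv g(2)]]])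
       (simp add: algebra_simps)
  have qmono: "q s < q t" if "s < t" "t \<le> 0" for s t
  proof (rule hderiv_strict_mono[OF qd that])
    fix y assume y: "s < y" "y < t"
    then have "y < 0" using that by simp
    then show "0 < psi y * g y * (Ps y - ?H * exp (2 * y))"
      using psi_pos gpos PsH by (intro mult_pos_pos) auto
  qed
  \<comment> \<open>The Wronskian \<open>q\<close> vanishes at 0 and increases strictly, so it is at
    most \<open>- \<delta>\<close> left of -1. As \<open>g * psi1\<close> tends to 0 and
    \<open>psi\<close> to 1, this forces \<open>g1 \<ge> \<delta> / 4\<close> near
    -infinity.\<close>
  define \<delta> where "\<delta> = - q (-1)"
  have \<delta>: "\<delta> > 0" using qmono[of "-1" 0] by (simp add: \<delta>_def q_def g(3) psi_0)
  have el: "((\<lambda>t. g t * psi1 t) \<longlongrightarrow> 0) at_bot"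
  proof (rule Lim_null_comparison)
    have e: "((\<lambda>t. ?H * exp (2 * t)) \<longlongrightarrow> 0) at_bot" by real_asymp
    have "((\<lambda>t. bj1 (?H * exp (2 * t))) \<longlongrightarrow> bj1 0) at_bot"
      by (rule isCont_tendsto_compose[OF DERIV_isCont[OF bj1_deriv] e])
    moreover have "((\<lambda>t. N * (1 - t) * (2 * (?H * exp (2 * t)))) \<longlongrightarrow> 0) at_bot" by real_asymp
    ultimately have "((\<lambda>t. N * (1 - t) * (2 * (?H * exp (2 * t))) * \<bar>bj1 (?H * exp (2 * t))\<bar>) \<longlongrightarrow> 0 * \<bar>bj1 0\<bar>) at_bot"
      by (intro tendsto_mult tendsto_rabs)
    then show "((\<lambda>t. N * (1 - t) * (2 * (?H * exp (2 * t))) * \<bar>bj1 (?H * exp (2 * t))\<bar>) \<longlongrightarrow> 0) at_bot" by simp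
    show "\<forall>\<^sub>F t in at_bot. norm (g t * psi1 t) \<le> N * (1 - t) * (2 * (?H * exp (2 * t))) * \<bar>bj1 (?H * exp (2 * t))\<bar>"
      using eventually_le_at_bot[of 0]
    proof eventually_elim
      case (elim t)
      have "norm (g t * psi1 t) = \<bar>g t\<bar> * (2 * (?H * exp (2 * t)) * \<bar>bj1 (?H * exp (2 * t))\<bar>)"
        using H_disc_pos by (simp add: psi1_def abs_mult)
      also have "\<dots> \<le> (N * (1 - t)) * (2 * (?H * exp (2 * t)) * \<bar>bj1 (?H * exp (2 * t))\<bar>)"
        using H_disc_pos by (intro mult_right_mono g(9) elim) auto
      finally show ?case by (simp only: mult.assoc)
    qed
  qed
  have "\<forall>\<^sub>F t in at_bot. \<bar>g t * psi1 t\<bar> < \<delta> / 2"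
    using tendsto_rabs[OF el] \<delta> by (intro order_tendstoD) auto
  moreover have "\<forall>\<^sub>F t in at_bot. psi t < 2" using psi_lim(1) by (rule order_tendstoD) simp
  ultimately have "\<forall>\<^sub>F t in at_bot. \<bar>g t * psi1 t\<bar> < \<delta> / 2 \<and> psi t < 2" by (rule eventually_conj)
  then obtain S where S: "\<And>t. t \<le> S \<Longrightarrow> \<bar>g t * psi1 t\<bar> < \<delta> / 2 \<and> psi t < 2" by (auto simp: eventually_at_bot_linorder)
  define S' where "S' = min S (-1)"
  have g1_ge: "g1 t \<ge> \<delta> / 4" if t: "t \<le> S'" for t
  proof -
    have "q t \<le> - \<delta>" using qmono[of t "-1"] t by (cases "t = -1") (auto simp: \<delta>_def S'_def)
    then have p: "psi t * g1 t \<ge> \<delta> / 2" using S[of t] t unfolding q_def S'_def by linarith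
    have "psi t > 0" "psi t < 2" using psi_pos[of t] S[of t] t by (auto simp: S'_def)
    show ?thesis
    proof (rule ccontr)
      assume "\<not> ?thesis"
      then have "psi t * g1 t < psi t * (\<delta> / 4)" using \<open>psi t > 0\<close> by simp
      also have "\<dots> \<le> 2 * (\<delta> / 4)" using \<open>psi t < 2\<close> \<delta> by (intro mult_right_mono) auto
      finally show False using p by simp
    qed
  qed
  \<comment> \<open>The distance from \<open>S'\<close> over which the slope
    \<open>\<delta> / 4\<close> uses up the value \<open>g S'\<close>, and one unit more.\<close>
  define t where "t = S' - 4 * g S' / \<delta> - 1"
  have S'0: "S' < 0" by (simp add: S'_def)
  have "0 < 4 * g S' / \<delta>" using gpos[OF S'0] \<delta> by (intro divide_pos_pos) auto
  then have tS: "t < S'" by (simp add: t_def)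
  obtain y where y: "t < y" "y < S'" "g S' - g t = (S' - t) * g1 y"
    by (rule hderiv_mvt[OF g(1) tS]) (use S'0 in auto)
  have "(S' - t) * (\<delta> / 4) \<le> g S' - g t" unfolding y(3) using g1_ge[of y] y tS by (intro mult_left_mono) auto
  moreover have "(S' - t) * (\<delta> / 4) = g S' + \<delta> / 4" using \<delta> by (simp add: t_def field_simps)
  ultimately have "g t < 0" using \<delta> by simp
  then show False using gpos[of t] tS S'0 by simp
qed

end

section \<open>Type III\<close>

text \<open>Only local complex extensions are given, so the identity theorem is applied to
  \<open>deriv F\<close> on each ball; the set of accumulation points of the zeros of the derivative
  is open and closed in the reals, which replaces a global extension.\<close>

lemma real_analytic_critical_points:
  fixes f :: "real \<Rightarrow> real"
  assumes loc: "\<And>l. \<exists>\<rho>>0. \<exists>F. F holomorphic_on ball 0 \<rho> \<and> (\<forall>x. \<bar>x\<bar> < \<rho> \<longrightarrow> F (of_real x) = of_real (f (l + x)))"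
    and J: "infinite (J \<inter> {a..b})" "\<And>\<beta>. \<beta> \<in> J \<Longrightarrow> (f has_real_derivative 0) (at \<beta>)"
  shows "(f has_real_derivative 0) (at \<beta>)"
proof -
  define Z where "Z = {\<beta>. (f has_real_derivative 0) (at \<beta>)}"
  have local_zero: "\<exists>\<rho>>0. ball l \<rho> \<subseteq> Z" if l: "l islimpt Z" for l
  proof -
    obtain \<rho> F where F: "\<rho> > 0" "F holomorphic_on ball 0 \<rho>" "\<And>x. \<bar>x\<bar> < \<rho> \<Longrightarrow> F (of_real x) = of_real (f (l + x))"
      using loc by blast
    have dF: "(F has_field_derivative deriv F (of_real x)) (at (of_real x))" if "\<bar>x\<bar> < \<rho>" for x
      using that by (intro holomorphic_derivI[OF F(2)]) auto
    have vd: "((\<lambda>x. complex_of_real (f (l + x))) has_vector_derivative deriv F (of_real x)) (at x)" if x: "\<bar>x\<bar> < \<rho>" for x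
    proof -
      have "((\<lambda>x. F (of_real x)) has_vector_derivative deriv F (of_real x)) (at x)"
        by (rule has_vector_derivative_real_field[OF dF[OF x]])
      then show ?thesis
        using has_vector_derivative_transform_within_open[of _ _ x "{- \<rho><..<\<rho>}"] x F(3) by (force simp: abs_less_iff)
    qed
    have iff: "l + x \<in> Z \<longleftrightarrow> deriv F (of_real x) = 0" if x: "\<bar>x\<bar> < \<rho>" for x
    proof
      assume "l + x \<in> Z"
      then have "(f has_real_derivative 0) (at (x + l))" by (simp add: Z_def add.commute)
      then have "((\<lambda>x. f (l + x)) has_real_derivative 0) (at x)" using DERIV_shift[of f 0 x l] by (simp add: add.commute)
      from has_vector_derivative_of_real[OF this]
      have "((\<lambda>x. complex_of_real (f (l + x))) has_vector_derivative 0) (at x)" by simp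
      then show "deriv F (of_real x) = 0" using vd[OF x] vector_derivative_unique_at by blast
    next
      assume "deriv F (of_real x) = 0"
      then have "((\<lambda>x. complex_of_real (f (l + x))) has_vector_derivative 0) (at x)" using vd[OF x] by simp
      from bounded_linear.has_vector_derivative[OF bounded_linear_Re this]
      have "((\<lambda>x. f (l + x)) has_real_derivative 0) (at x)"
        by (simp add: has_real_derivative_iff_has_vector_derivative)
      then show "l + x \<in> Z" using DERIV_shift[of f 0 x l] by (simp add: add.commute Z_def)
    qed
    define U where "U = {complex_of_real x |x. \<bar>x\<bar> < \<rho> \<and> l + x \<in> Z}"
    have "0 islimpt U"
      unfolding islimpt_approachable
    proof (intro allI impI)
      fix e :: real assume "e > 0"
      then obtain y where y: "y \<in> Z" "y \<noteq> l" "dist y l < min e \<rho>"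
        using l F(1) unfolding islimpt_approachable by (metis min_less_iff_conj)
      then show "\<exists>u\<in>U. u \<noteq> 0 \<and> dist u 0 < e"
        by (intro bexI[of _ "complex_of_real (y - l)"])
           (auto simp: U_def dist_real_def simp del: of_real_diff intro!: exI[of _ "y - l"])
    qed
    moreover have "deriv F holomorphic_on ball 0 \<rho>" by (intro holomorphic_deriv F) auto
    ultimately have z: "deriv F w = 0" if "w \<in> ball 0 \<rho>" for w
      by (intro analytic_continuation[of "deriv F" "ball 0 \<rho>" U 0 w])
         (use F(1) that iff in \<open>auto simp: U_def\<close>)
    have "ball l \<rho> \<subseteq> Z"
    proof
      fix y assume "y \<in> ball l \<rho>"
      then have y: "\<bar>y - l\<bar> < \<rho>" by (simp add: dist_real_def)
      then have "deriv F (of_real (y - l)) = 0" by (intro z) (simp flip: of_real_diff)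
      then show "y \<in> Z" using iff[OF y] by simp
    qed
    then show ?thesis using F(1) by blast
  qed
  define L where "L = {l. l islimpt Z}"
  have "closed L" unfolding L_def by (rule closed_limpts)
  moreover have "open L"
    unfolding open_contains_ball
  proof
    fix l assume "l \<in> L"
    then obtain \<rho> where \<rho>: "\<rho> > 0" "ball l \<rho> \<subseteq> Z" using local_zero by (auto simp: L_def)
    have "ball l \<rho> \<subseteq> L"
    proof
      fix y assume "y \<in> ball l \<rho>"
      then have "y \<in> interior Z" using \<rho>(2) open_ball interior_maximal by blast
      then show "y \<in> L" unfolding L_def using interior_limit_point by blast
    qed
    then show "\<exists>e>0. ball l e \<subseteq> L" using \<rho>(1) by blast
  qed
  moreover have "L \<noteq> {}"
  proof -
    obtain l where "l \<in> {a..b}" "l islimpt (J \<inter> {a..b})"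
      using Heine_Borel_imp_Bolzano_Weierstrass[OF compact_Icc J(1), of a b] by auto
    then have "l islimpt Z" using J(2) by (elim islimpt_subset) (auto simp: Z_def)
    then show ?thesis by (auto simp: L_def)
  qed
  ultimately have "L = UNIV" using connected_UNIV connected_clopen by (metis clopen)
  then have "\<beta> islimpt Z" by (auto simp: L_def)
  then obtain \<rho> where "\<rho> > 0" "ball \<beta> \<rho> \<subseteq> Z" using local_zero by blast
  then have "\<beta> \<in> Z" by auto
  then show ?thesis by (simp add: Z_def)
qed

lemma local_extremum_DERIV:
  assumes "local_extremum f x" "(f has_real_derivative d) (at x)"
  shows "d = 0"
  using assms(1) unfolding local_extremum_def
proof
  assume "\<forall>\<^sub>F y in nhds x. f x \<le> f y"
  then obtain e where "e > 0" "\<And>y. dist y x < e \<Longrightarrow> f x \<le> f y" unfolding eventually_nhds_metric by blast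
  then show ?thesis using DERIV_local_min[OF assms(2), of e] by (simp add: dist_real_def abs_minus_commute)
next
  assume "\<forall>\<^sub>F y in nhds x. f y \<le> f x"
  then obtain e where "e > 0" "\<And>y. dist y x < e \<Longrightarrow> f y \<le> f x" unfolding eventually_nhds_metric by blast
  then show ?thesis using DERIV_local_max[OF assms(2), of e] by (simp add: dist_real_def abs_minus_commute)
qed

lemma local_extremum_exp: "local_extremum (\<lambda>x. exp (f x)) x \<longleftrightarrow> local_extremum f x"
  by (simp add: local_extremum_def)

text \<open>If \<open>f a = f b\<close>, the maximum and the minimum over the interval sit at the
  endpoints and coincide, so f is constant there; an interior point of constancy counts as an
  extremum, because the inequalities in \<open>local_extremum\<close> are not strict.\<close>

lemma no_local_extremum_inj:
  fixes f :: "real \<Rightarrow> real"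
  assumes c: "continuous_on UNIV f" and no: "\<And>x. \<not> local_extremum f x"
  shows "inj f"
proof -
  have False if ab: "a < b" "f a = f b" for a b
  proof -
    have cab: "continuous_on {a..b} f" by (rule continuous_on_subset[OF c]) simp
    obtain p where p: "p \<in> {a..b}" "\<And>y. y \<in> {a..b} \<Longrightarrow> f y \<le> f p"
      using continuous_attains_sup[OF compact_Icc _ cab] ab by auto
    obtain m where m: "m \<in> {a..b}" "\<And>y. y \<in> {a..b} \<Longrightarrow> f m \<le> f y"
      using continuous_attains_inf[OF compact_Icc _ cab] ab by auto
    have int: "\<forall>\<^sub>F y in nhds z. y \<in> {a..b}" if "a < z" "z < b" for z
      using eventually_nhds_in_open[of "{a<..<b}" z] that by (auto elim!: eventually_mono)
    have P: "p = a \<or> p = b"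
    proof (rule ccontr)
      assume "\<not> (p = a \<or> p = b)"
      then have "\<forall>\<^sub>F y in nhds p. f y \<le> f p" using int[of p] p by (auto elim!: eventually_mono)
      then show False using no[of p] by (auto simp: local_extremum_def)
    qed
    have Mm: "m = a \<or> m = b"
    proof (rule ccontr)
      assume "\<not> (m = a \<or> m = b)"
      then have "\<forall>\<^sub>F y in nhds m. f m \<le> f y" using int[of m] m by (auto elim!: eventually_mono)
      then show False using no[of m] by (auto simp: local_extremum_def)
    qed
    have const: "f y = f a" if "y \<in> {a..b}" for y
      using p(2)[OF that] m(2)[OF that] P Mm ab(2) by force
    have c: "a < (a + b) / 2" "(a + b) / 2 < b" using ab by auto
    have "\<forall>\<^sub>F y in nhds ((a + b) / 2). f ((a + b) / 2) \<le> f y"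
      using int[OF c]
    proof eventually_elim
      case (elim y)
      then show ?case using const[OF elim] const[of "(a + b) / 2"] c by simp
    qed
    then show False using no[of "(a + b) / 2"] by (simp add: local_extremum_def)
  qed
  then show ?thesis by (intro injI) (metis linorder_neqE_linordered_idom)
qed

lemma type_III_case:
  assumes a: "regular_weight a" "\<And>r. r \<in> {0..1} \<Longrightarrow> a r > 0" "a 0 = 1"
    and b: "\<And>r. r \<in> {0<..1} \<Longrightarrow> deriv01 (\<lambda>s. a s / a_fam 10 H_disc s) r > 0"
  shows "type_III 10 a"
proof -
  define q where "q = (\<lambda>s. a s / a_fam 10 H_disc s)"
  define q1 where "q1 = deriv01 q"
  have qd: "(q has_real_derivative q1 r) (at r)" if "0 < r" "r < 1" for r
    using ratio_deriv[OF a(1) that] unfolding q1_def q_def .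
  have q1pos: "q1 r > 0" if "0 < r" "r < 1" for r using b[of r] that unfolding q1_def q_def by simp
  have qc: "continuous_on {0..1} q" unfolding q_def by (rule ratio_cont[OF a(1)])
  have q0: "q 0 = 1" using a(3) by (simp add: q_def a_fam_def)
  have qge: "q r \<ge> 1" if "0 \<le> r" "r \<le> 1" for r
  proof -
    have "q 0 \<le> q r"
    proof (rule DERIV_nonneg_imp_increasing_open[OF that(1)])
      fix y assume "0 < y" "y < r"
      then show "\<exists>z. (q has_real_derivative z) (at y) \<and> 0 \<le> z"
        using qd[of y] q1pos[of y] that by (intro exI conjI) auto
    qed (use that in \<open>auto intro: continuous_on_subset[OF qc]\<close>)
    then show ?thesis using q0 by simp
  qed
  have aq: "a r = q r * a_fam 10 H_disc r" for r using a_fam_H_ge[of r] by (simp add: q_def)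
  have ac: "continuous_on {0..1} a" using a(1) by (simp add: regular_weight_def)
  have a0: "a r \<ge> 0" if "r \<in> {0..1}" for r using a(2)[OF that] by simp
  have age: "a r \<ge> 1" if "0 \<le> r" "r \<le> 1" for r
    using mult_mono[OF qge[OF that] a_fam_H_ge[of r]] qge[OF that] by (simp add: aq)
  obtain C0 where C0: "C0 \<ge> 0" "\<And>r. r \<in> {0..1} \<Longrightarrow> \<bar>a r - a 0\<bar> \<le> C0 * r\<^sup>2"
    using a(1) by (auto simp: regular_weight_def)
  define C where "C = C0 + 1"
  define A where "A = (\<lambda>t::real. a (exp t))"
  define v where "v = (\<lambda>\<beta>. radial_sol 10 a \<beta>)"
  define x where "x = (\<lambda>\<beta> t. v \<beta> (exp t))"
  have vsol: "solves_radial_ivp 10 a \<beta> (v \<beta>)" for \<beta> unfolding v_def by (rule radial_sol_solves[OF ac a0])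
  have "\<forall>\<beta>. \<exists>x1. logsol A \<beta> (x \<beta>) x1"
    unfolding A_def x_def using radial_ivp_logsol[OF vsol] by metis
  then obtain x1 where x1: "\<And>\<beta>. logsol A \<beta> (x \<beta>) (x1 \<beta>)" by metis
  interpret radial_III A C x x1
  proof
    show "continuous_on {..0} A" unfolding A_def by (intro continuous_on_compose2[OF ac] continuous_intros) auto
    show "1 \<le> A t" if "t \<le> 0" for t using that unfolding A_def by (intro age) auto
    show "A t \<le> 1 + C * exp (2 * t)" if "t \<le> 0" for t
    proof -
      have "\<bar>a (exp t) - a 0\<bar> \<le> C0 * (exp t)\<^sup>2" using that by (intro C0) auto
      also have "(exp t)\<^sup>2 = exp (2 * t)" by (simp add: exp_double)
      also have "C0 * exp (2 * t) \<le> C * exp (2 * t)" unfolding C_def by (intro mult_right_mono) auto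
      finally show ?thesis using a(3) by (simp add: A_def abs_le_iff)
    qed
    show "C > 0" using C0 by (simp add: C_def)
  qed (rule x1)
  define f where "f = (\<lambda>\<beta>. v \<beta> 1)"
  have fx: "f \<beta> = x \<beta> 0" for \<beta> by (simp add: f_def x_def)
  have bif: "bif_lambda 10 a = (\<lambda>\<beta>. exp (f \<beta>))" by (simp add: fun_eq_iff bif_lambda_def f_def v_def)
  have aM: "a r \<le> 1 + C" if "r \<in> {0..1}" for r
  proof (cases "r = 0")
    case False
    then show ?thesis using A_le'[of "ln r"] that by (simp add: A_def)
  qed (use a(3) C in simp)
  have vdiff: "\<bar>v \<beta> r - v \<gamma> r\<bar> \<le> \<bar>\<beta> - \<gamma>\<bar> * exp ((1 + (1 + C) * exp B) / 2)" if "\<beta> \<le> B" "\<gamma> \<le> B" "r \<in> {0..1}" for \<beta> \<gamma> B r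
    by (rule radial_ivp_diff_le[OF a0 aM vsol vsol that]) auto
  have vc: "continuous_on {0..1} (v \<beta>)" for \<beta>
    by (rule solves_radial_ivpE[OF vsol[of \<beta>]]) (rule DERIV_continuous_on)
  have v0: "v \<beta> 0 = \<beta>" for \<beta>
    by (rule solves_radial_ivpE[OF vsol[of \<beta>]])
  have loc: "\<exists>\<rho>>0. \<exists>F. F holomorphic_on ball 0 \<rho> \<and> (\<forall>x. \<bar>x\<bar> < \<rho> \<longrightarrow> F (of_real x) = of_real (f (l + x)))" for l
    by (rule radial_sol_analytic[OF ac a0, of l]) (auto simp: f_def v_def)
  have fd: "\<exists>d. (f has_real_derivative d) (at l)" for l
  proof -
    obtain \<rho> F where F: "\<rho> > 0" "F holomorphic_on ball 0 \<rho>" "\<And>x. \<bar>x\<bar> < \<rho> \<Longrightarrow> F (of_real x) = of_real (f (l + x))"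
      using loc by blast
    have "(F has_field_derivative deriv F (of_real 0)) (at (of_real 0))"
      using F(1) by (intro holomorphic_derivI[OF F(2)]) auto
    then have "((\<lambda>x. F (of_real x)) has_vector_derivative deriv F (of_real 0)) (at 0)"
      by (rule has_vector_derivative_real_field)
    then have "((\<lambda>x. complex_of_real (f (l + x))) has_vector_derivative deriv F (of_real 0)) (at 0)"
      using has_vector_derivative_transform_within_open[of _ _ 0 "{- \<rho><..<\<rho>}"] F by (force simp: abs_less_iff)
    from bounded_linear.has_vector_derivative[OF bounded_linear_Re this]
    have "((\<lambda>x. f (x + l)) has_real_derivative Re (deriv F (of_real 0))) (at 0)"
      by (simp add: has_real_derivative_iff_has_vector_derivative add.commute)
    then show ?thesis using DERIV_shift[of f _ 0 l] by auto
  qed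
  have fc: "continuous_on UNIV f" using fd by (meson DERIV_isCont continuous_at_imp_continuous_on)
  define B0 where "B0 = ln (16 / (1 + C))"
  have early: "f \<beta> < f \<gamma>" if "\<beta> < \<gamma>" "\<gamma> \<le> B0" for \<beta> \<gamma>
  proof -
    have "exp \<gamma> \<le> 16 / (1 + C)" using that C by (metis B0_def add_pos_pos divide_pos_pos exp_le_cancel_iff exp_ln zero_less_numeral zero_less_one)
    then have "(1 + C) * exp \<gamma> \<le> 16" using C by (simp add: le_divide_eq mult.commute)
    then show ?thesis unfolding fx by (intro early_increasing that) auto
  qed
  obtain B1 where B1: "(\<forall>\<beta> \<gamma>. B1 \<le> \<beta> \<longrightarrow> \<beta> < \<gamma> \<longrightarrow> f \<beta> < f \<gamma>) \<or> (\<forall>\<beta> \<gamma>. B1 \<le> \<beta> \<longrightarrow> \<beta> < \<gamma> \<longrightarrow> f \<gamma> < f \<beta>)"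
    unfolding fx by (rule eventually_monotone)
  define Crit where "Crit = {\<beta>. local_extremum f \<beta>}"
  have tp: "turning_points 10 a = (\<lambda>\<beta>. (bif_lambda 10 a \<beta>, bif_alpha 10 a \<beta>)) ` Crit"
    unfolding turning_points_def Crit_def bif local_extremum_exp by auto
  have not_ext: "\<not> local_extremum f \<beta>" if "l < \<beta>" "\<beta> < u"
      "(\<forall>y z. l < y \<longrightarrow> y < z \<longrightarrow> z < u \<longrightarrow> f y < f z) \<or> (\<forall>y z. l < y \<longrightarrow> y < z \<longrightarrow> z < u \<longrightarrow> f z < f y)" for l u \<beta>
  proof
    assume "local_extremum f \<beta>"
    then obtain e where e: "e > 0" "(\<forall>y. dist y \<beta> < e \<longrightarrow> f \<beta> \<le> f y) \<or> (\<forall>y. dist y \<beta> < e \<longrightarrow> f y \<le> f \<beta>)"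
      unfolding local_extremum_def eventually_nhds_metric by blast
    define h where "h = min e (min (\<beta> - l) (u - \<beta>)) / 2"
    have h: "0 < h" "h < e" "l < \<beta> - h" "\<beta> + h < u" using e(1) that(1,2) by (auto simp: h_def min_def field_simps)
    have "dist (\<beta> - h) \<beta> < e" "dist (\<beta> + h) \<beta> < e" using h by (auto simp: dist_real_def)
    then show False using e(2) that h
      by (smt (verit, best))
  qed
  \<comment> \<open>The margins of 1 leave room for an open interval on which \<open>early\<close>
    or \<open>B1\<close> gives strict monotonicity.\<close>
  have sub: "Crit \<subseteq> {B0 - 1..B1 + 1}"
  proof
    fix \<beta> assume "\<beta> \<in> Crit"
    then have ext: "local_extremum f \<beta>" by (simp add: Crit_def)
    have "\<not> \<beta> < B0 - 1"
    proof
      assume "\<beta> < B0 - 1"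
      then have "\<not> local_extremum f \<beta>" by (intro not_ext[of "\<beta> - 1" \<beta> B0]) (use early in auto)
      then show False using ext by simp
    qed
    moreover have "\<not> \<beta> > B1 + 1"
    proof
      assume "\<beta> > B1 + 1"
      then have "\<not> local_extremum f \<beta>" by (intro not_ext[of B1 \<beta> "\<beta> + 1"]) (use B1 in auto)
      then show False using ext by simp
    qed
    ultimately show "\<beta> \<in> {B0 - 1..B1 + 1}" by simp
  qed
  have "finite Crit"
  proof (rule ccontr)
    assume "infinite Crit"
    then have inf: "infinite (Crit \<inter> {B0 - 1..B1 + 1})" using sub by (simp add: Int_absorb2)
    have crit: "(f has_real_derivative 0) (at \<beta>)" if "\<beta> \<in> Crit" for \<beta>
      using fd[of \<beta>] local_extremum_DERIV[of f \<beta>] that by (auto simp: Crit_def)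
    \<comment> \<open>Infinitely many extrema in a bounded interval would make the analytic function
      f constant, whereas it increases strictly up to \<open>B0\<close>.\<close>
    have "(f has_real_derivative 0) (at \<beta>)" for \<beta>
      by (rule real_analytic_critical_points[OF loc inf crit])
    then have "f (B0 - 1) = f B0" by (intro DERIV_isconst_all) auto
    then show False using early[of "B0 - 1" B0] by simp
  qed
  then have "finite (turning_points 10 a)" by (simp add: tp)
  moreover have "Crit \<noteq> {}"
  proof
    assume "Crit = {}"
    then have inj: "inj f" using no_local_extremum_inj[OF fc] by (auto simp: Crit_def)
    \<comment> \<open>A continuous injection is monotone; the direction is read off at very negative
      initial values.\<close>
    have mono: "f \<beta> < f \<gamma>" if bg: "\<beta> < \<gamma>" for \<beta> \<gamma>
    proof -
      define l where "l = min \<beta> B0 - 2"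
      have l: "l < l + 1" "l + 1 < \<beta>" "l + 1 \<le> B0" by (auto simp: l_def)
      have m: "(f l < f y \<and> f y < f \<gamma>) \<or> (f \<gamma> < f y \<and> f y < f l)" if "l < y" "y < \<gamma>" for y
        by (rule continuous_inj_imp_mono[OF that continuous_on_subset[OF fc] inj_on_subset[OF inj]]) auto
      have "f l < f (l + 1)" using early l by simp
      then have "f l < f \<gamma>" using m[of "l + 1"] l bg by auto
      then show ?thesis using m[of \<beta>] l bg by auto
    qed
    \<comment> \<open>Both initial values are lowered by s. For large s the solutions are strictly
      ordered, and the least gap \<open>m s\<close> varies continuously. It could vanish only at an
      interior contact point, since the gap is positive at r = 0 and, by \<open>mono\<close>, at r =
      1. There D has a double zero, hence vanishes up to the boundary, against \<open>mono\<close>.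
      So the order persists down to s = 0.\<close>
    have ordered: "x \<beta> t < x \<gamma> t" if bg: "\<beta> < \<gamma>" and t: "t \<le> 0" for \<beta> \<gamma> t
    proof -
      define d where "d = (\<lambda>s r. v (\<gamma> - s) r - v (\<beta> - s) r)"
      define m where "m = (\<lambda>s. INF r\<in>{0..1}. d s r)"
      define k where "k = exp ((1 + (1 + C) * exp \<gamma>) / 2)"
      have dc: "continuous_on {0..1} (d s)" for s unfolding d_def by (intro continuous_intros vc)
      have att: "\<exists>r\<in>{0..1}. m s = d s r \<and> (\<forall>y\<in>{0..1}. d s r \<le> d s y)" for s
      proof -
        obtain r where r: "r \<in> {0..1}" "\<And>y. y \<in> {0..1} \<Longrightarrow> d s r \<le> d s y"
          using continuous_attains_inf[OF compact_Icc _ dc[of s]] by auto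
        have "m s = d s r" unfolding m_def
          by (intro antisym cINF_greatest cINF_lower bdd_belowI2[of _ "d s r"]) (use r in auto)
        then show ?thesis using r by blast
      qed
      have lip: "m s \<ge> m s' - 2 * k * \<bar>s - s'\<bar>" if "0 \<le> s" "0 \<le> s'" for s s'
      proof -
        obtain r where r: "r \<in> {0..1}" "m s = d s r" using att[of s] by blast
        have 1: "\<bar>v (\<gamma> - s) r - v (\<gamma> - s') r\<bar> \<le> \<bar>(\<gamma> - s) - (\<gamma> - s')\<bar> * k" unfolding k_def
          by (rule vdiff) (use that r in auto)
        have 2: "\<bar>v (\<beta> - s) r - v (\<beta> - s') r\<bar> \<le> \<bar>(\<beta> - s) - (\<beta> - s')\<bar> * k" unfolding k_def
          by (rule vdiff) (use that r bg in auto)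
        have e: "\<bar>(\<gamma> - s) - (\<gamma> - s')\<bar> * k = k * \<bar>s - s'\<bar>" "\<bar>(\<beta> - s) - (\<beta> - s')\<bar> * k = k * \<bar>s - s'\<bar>"
          by (simp_all add: abs_minus_commute)
        have "d s' r - 2 * (k * \<bar>s - s'\<bar>) \<le> d s r" using 1 2 unfolding d_def e by linarith
        moreover have "m s' \<le> d s' r" using att[of s'] r(1) by force
        ultimately show ?thesis using r(2) by simp
      qed
      have lipm: "\<bar>m s - m s'\<bar> \<le> 2 * k * \<bar>s - s'\<bar>" if "0 \<le> s" "0 \<le> s'" for s s'
        using lip[OF that] lip[OF that(2,1)] by (simp add: abs_le_iff abs_minus_commute)
      \<comment> \<open>\<open>S \<ge> \<gamma> - B0\<close> brings both lowered values into the
        range of \<open>early_increasing\<close>.\<close>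
      define S where "S = max 0 (\<gamma> - B0)"
      have mc: "continuous_on {0..S} m"
        by (rule lipschitz_on_continuous_on[of "2 * k"], rule lipschitz_onI)
           (use lipm in \<open>auto simp: dist_real_def k_def\<close>)
      have nz: "m s \<noteq> 0" if s: "0 \<le> s" for s
      proof
        assume "m s = 0"
        then obtain r where r: "r \<in> {0..1}" "d s r = 0" "\<And>y. y \<in> {0..1} \<Longrightarrow> 0 \<le> d s y" using att[of s] by auto
        have "r \<noteq> 0" using r(2) v0 bg by (auto simp: d_def)
        moreover have "r \<noteq> 1" using r(2) mono[of "\<beta> - s" "\<gamma> - s"] bg by (auto simp: d_def f_def)
        ultimately have r01: "0 < r" "r < 1" using r(1) by auto
        define t where "t = ln r"
        have t: "t < 0" "exp t = r" using r01 by (auto simp: t_def)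
        have De: "D (\<beta> - s) (\<gamma> - s) y = exp (4 * y) * d s (exp y)" for y
          unfolding D_eq X_def by (simp add: x_def d_def)
        have D0: "D (\<beta> - s) (\<gamma> - s) t = 0" by (simp add: De t r)
        have "D1 (\<beta> - s) (\<gamma> - s) t = 0"
        proof (rule DERIV_local_min[OF hderiv_at[OF D_deriv(1) t(1)]])
          show "0 < - t" using t by simp
          show "\<forall>y. \<bar>t - y\<bar> < - t \<longrightarrow> D (\<beta> - s) (\<gamma> - s) t \<le> D (\<beta> - s) (\<gamma> - s) y"
            unfolding D0 unfolding De by (auto intro!: mult_nonneg_nonneg r(3))
        qed
        then have "(D (\<beta> - s) (\<gamma> - s) 0)\<^sup>2 + (D1 (\<beta> - s) (\<gamma> - s) 0)\<^sup>2 \<le> 0"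
          using energy_gronwall[OF D_deriv P_abs, of t 0 "\<beta> - s" "\<gamma> - s"] D0 t by simp
        then have "D (\<beta> - s) (\<gamma> - s) 0 = 0" by (simp add: sum_power2_le_zero_iff)
        then show False using mono[of "\<beta> - s" "\<gamma> - s"] bg by (simp add: De d_def f_def)
      qed
      have mS: "m S > 0"
      proof -
        obtain r where r: "r \<in> {0..1}" "m S = d S r" using att[of S] by blast
        show ?thesis
        proof (cases "r = 0")
          case True
          then show ?thesis using r v0 bg by (simp add: d_def)
        next
          case False
          then have "ln r \<le> 0" "exp (ln r) = r" using r(1) by auto
          moreover have "(1 + C) * exp (\<gamma> - S) \<le> 16"
          proof -
            have "exp (\<gamma> - S) \<le> exp B0" by (simp add: S_def)
            also have "\<dots> = 16 / (1 + C)" using C by (simp add: B0_def)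
            finally show ?thesis using C by (simp add: le_divide_eq mult.commute)
          qed
          ultimately have "x (\<beta> - S) (ln r) < x (\<gamma> - S) (ln r)" using bg by (intro early_increasing) auto
          then show ?thesis using r(2) \<open>exp (ln r) = r\<close> by (simp add: x_def d_def)
        qed
      qed
      have "m 0 > 0"
      proof (rule ccontr)
        assume "\<not> m 0 > 0"
        moreover have "0 \<le> S" by (simp add: S_def)
        ultimately obtain s where "0 \<le> s" "m s = 0" using IVT'[of m 0 0 S] mS mc by auto
        then show False using nz by blast
      qed
      moreover have "m 0 \<le> d 0 (exp t)" using att[of 0] t by force
      ultimately show ?thesis by (simp add: d_def x_def)
    qed
    show False
    proof (rule not_all_ordered[of "\<lambda>t. q (exp t)" "\<lambda>t. q1 (exp t) * exp t"])
      show "A t = q (exp t) * ((1 + H_disc * exp (2 * t) / 16) * exp (H_disc * exp (2 * t) / 20))" for t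
        by (simp add: A_def aq[of "exp t"] a_fam_H exp_double)
      show "((\<lambda>t. q (exp t)) has_real_derivative q1 (exp t) * exp t) (at t)" if "t < 0" for t
        by (rule DERIV_chain2[OF qd DERIV_exp]) (use that in auto)
      show "((\<lambda>t. q (exp t)) \<longlongrightarrow> 1) at_bot" using exp_at_bot_within01[OF qc] q0 by simp
      show "q (exp t) > 0" if "t \<le> 0" for t using qge[of "exp t"] that by simp
      show "q1 (exp t) * exp t > 0" if "t < 0" for t using q1pos[of "exp t"] that by simp
    qed (rule ordered)
  qed
  then have "turning_points 10 a \<noteq> {}" by (simp add: tp)
  ultimately show ?thesis by (simp add: type_III_def)
qed

section \<open>The explicit family of weights\<close>

lemma a_fam_ratio_deriv01:
  assumes h: "h > - 16" and r: "r \<in> {0<..1}"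
  obtains p where "p > 0" "deriv01 (\<lambda>s. a_fam 10 h s / a_fam 10 H_disc s) r = p * (h - H_disc)"
proof -
  let ?H = H_disc
  \<comment> \<open>Both factors are monotone in the direction given by the sign of
    \<open>h - H_disc\<close>, hence that common factor in the derivative; \<open>h > - 16\<close>
    keeps the numerator positive on \<open>[0,1]\<close>.\<close>
  define R where "R = (\<lambda>s. (1 + h / 16 * s\<^sup>2) / (1 + ?H / 16 * s\<^sup>2) * exp ((h - ?H) / 20 * s\<^sup>2))"
  have Hp: "1 + ?H / 16 * s\<^sup>2 > 0" for s using H_disc_pos by (simp add: add_pos_nonneg)
  have eq: "(\<lambda>s. a_fam 10 h s / a_fam 10 ?H s) = R"
    by (simp add: fun_eq_iff R_def a_fam_def left_diff_distrib diff_divide_distrib exp_diff)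
  define e where "e = exp ((h - ?H) / 20 * r\<^sup>2)"
  define u where "u = 1 + h / 16 * r\<^sup>2"
  define w where "w = 1 + ?H / 16 * r\<^sup>2"
  have r2: "0 < r\<^sup>2" "r\<^sup>2 \<le> 1" using r by (auto simp: power_le_one)
  have upos: "u > 0"
  proof (cases "h \<ge> 0")
    case False
    then have "h / 16 * r\<^sup>2 \<ge> h / 16 * 1" using r2 by (intro mult_left_mono_neg) auto
    then show ?thesis using h by (simp add: u_def)
  qed (simp add: u_def add_pos_nonneg)
  have wpos: "w > 0" using Hp by (simp add: w_def)
  define p where "p = 2 * r * e * (1 / (16 * w\<^sup>2) + u / (20 * w))"
  have d1: "((\<lambda>s. 1 + k * s\<^sup>2) has_real_derivative k * (2 * r)) (at r)" for k
    by (auto intro!: derivative_eq_intros)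
  have d2: "((\<lambda>s. exp (k * s\<^sup>2)) has_real_derivative exp (k * r\<^sup>2) * (k * (2 * r))) (at r)" for k
    by (auto intro!: derivative_eq_intros)
  have "(R has_real_derivative (h / 16 * (2 * r) * w - u * (?H / 16 * (2 * r))) / (w * w) * e + e * ((h - ?H) / 20 * (2 * r)) * (u / w)) (at r)"
    unfolding R_def e_def u_def w_def by (intro DERIV_mult DERIV_divide d1 d2) (use Hp[of r] in simp)
  moreover have "(h / 16 * (2 * r) * w - u * (?H / 16 * (2 * r))) / (w * w) * e + e * ((h - ?H) / 20 * (2 * r)) * (u / w) = p * (h - ?H)"
  proof -
    have num: "h / 16 * (2 * r) * w - u * (?H / 16 * (2 * r)) = (h - ?H) / 16 * (2 * r)"
      by (simp add: u_def w_def algebra_simps)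
    show ?thesis unfolding num p_def using wpos by (simp add: power2_eq_square field_simps)
  qed
  ultimately have "(R has_vector_derivative p * (h - ?H)) (at r within {0..1})"
    by (simp add: has_real_derivative_iff_has_vector_derivative has_vector_derivative_at_within)
  then have "deriv01 R r = p * (h - ?H)"
    unfolding deriv01_def using vector_derivative_within_cbox[of 0 1 r R "p * (h - ?H)"] r by simp
  moreover have "p > 0" unfolding p_def using r upos wpos by (intro mult_pos_pos add_pos_pos) (auto simp: e_def)
  ultimately show ?thesis using that unfolding eq by blast
qed

theorem theorem1p5:
  "(\<forall>a :: real \<Rightarrow> real.
      C2_on_closure (\<lambda>x :: real^10. a (norm x)) (ball 0 1) \<and>
      (\<forall>r\<in>{0..1}. a r > 0) \<and> a 0 = 1 \<longrightarrow>
        ((\<forall>r\<in>{0<..1}. deriv01 (\<lambda>s. a s / a_fam 10 H_disc s) r \<le> 0) \<longrightarrow> type_II 10 a) \<and>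
        ((\<forall>r\<in>{0<..1}. deriv01 (\<lambda>s. a s / a_fam 10 H_disc s) r > 0) \<longrightarrow> type_III 10 a)) \<and>
   (\<forall>h :: real. h > - 2 * (10 - 2) \<longrightarrow>
        (h \<le> H_disc \<longrightarrow> type_II 10 (a_fam 10 h)) \<and>
        (h > H_disc \<longrightarrow> type_III 10 (a_fam 10 h)))"
proof (intro conjI allI impI)
  fix a :: "real \<Rightarrow> real"
  assume a: "C2_on_closure (\<lambda>x :: real^10. a (norm x)) (ball 0 1) \<and> (\<forall>r\<in>{0..1}. a r > 0) \<and> a 0 = 1"
  then have reg: "regular_weight a" using C2_radial_regular_weight by blast
  show "type_II 10 a" if "\<forall>r\<in>{0<..1}. deriv01 (\<lambda>s. a s / a_fam 10 H_disc s) r \<le> 0"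
    by (rule type_II_case[OF reg]) (use a that in auto)
  show "type_III 10 a" if "\<forall>r\<in>{0<..1}. deriv01 (\<lambda>s. a s / a_fam 10 H_disc s) r > 0"
    by (rule type_III_case[OF reg]) (use a that in auto)
next
  fix h :: real assume "h > - 2 * (10 - 2)"
  then have h: "h > - 16" by simp
  have reg: "regular_weight (a_fam 10 h)"
    by (rule C2_radial_regular_weight[where 'a = "real^10"]) (rule a_fam_C2)
  have pos: "a_fam 10 h r > 0" if "r \<in> {0..1}" for r
  proof -
    have "h / 16 * r\<^sup>2 > - 1"
    proof (cases "h \<ge> 0")
      case False
      then have "h / 16 * r\<^sup>2 \<ge> h / 16 * 1" using that by (intro mult_left_mono_neg) (auto simp: power_le_one)
      then show ?thesis using h by simp
    qed (auto intro: less_le_trans[of _ 0])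
    then show ?thesis by (simp add: a_fam_def)
  qed
  have one: "a_fam 10 h 0 = 1" by (simp add: a_fam_def)
  show "type_II 10 (a_fam 10 h)" if "h \<le> H_disc"
  proof (rule type_II_case[OF reg pos one])
    fix r :: real assume "r \<in> {0<..1}"
    then show "deriv01 (\<lambda>s. a_fam 10 h s / a_fam 10 H_disc s) r \<le> 0"
      using a_fam_ratio_deriv01[OF h] that by (metis diff_le_0_iff_le less_imp_le mult_nonneg_nonpos)
  qed
  show "type_III 10 (a_fam 10 h)" if "h > H_disc"
  proof (rule type_III_case[OF reg pos one])
    fix r :: real assume "r \<in> {0<..1}"
    then show "deriv01 (\<lambda>s. a_fam 10 h s / a_fam 10 H_disc s) r > 0"
      using a_fam_ratio_deriv01[OF h] that by (metis diff_gt_0_iff_gt mult_pos_pos)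
  qed
qed

end
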